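(* Let $(g,L,U)$ be payoff processes and $\{\mathcal P(t,\omega)\}_{(t,\omega)\in[0,T]\times\Omega}$ a probability class such that the following properties (all defined in the context) hold: payoff regularity, integrability, adaptedness, stability under conditioning, weak stability under pasting, and path-continuity of values. Then for any $0\le t\le s\le T$ and $\omega\in\Omega$, $$\overline V_t(\omega)\ge\inf_{\mathbb P\in\mathcal P(t,\omega)}\ \inf_{\gamma\in\mathcal T^t}\ \sup_{\tau\in\mathcal T^t}\mathbb E_{\mathbb P}\bigg[\mathbf 1_{\{\tau\wedge\gamma<s\}}R^{t,\omega}(\tau,\gamma)+\mathbf 1_{\{\tau\wedge\gamma\ge s\}}\Big(\overline V^{t,\omega}_s+\int_t^sg^{t,\omega}_r\,dr\Big)\bigg].$$
   Context: **Canonical spaces.** Fix $d\in\mathbb N$, $T\in(0,\infty)$. A modulus of continuity function is a nondecreasing $\rho:[0,\infty)\to[0,\infty)$ with $\rho(0)=\lim_{x\downarrow0}\rho(x)=0$. For $t\in[0,T]$ let $\Omega^t=\{\omega\in C([t,T];\mathbb R^d):\omega(t)=0\}$, $\|\omega\|_{t,s}=\sup_{r\in[t,s]}|\omega(r)|$, $B^t$ the canonical process on $\Omega^t$, $\mathcal F^t_s=\sigma(B^t_r:r\in[t,s])$, $\mathbf F^t=\{\mathcal F^t_s\}_{s\in[t,T]}$ (raw filtration), $\mathcal T^t$ the set of all $\mathbf F^t$-stopping times (with values in $[t,T]$), $\mathcal T^t_s=\{\tau\in\mathcal T^t:\tau\ge s \text{ everywhere}\}$, and $\mathfrak P_t$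 the set of all probabilities on $(\Omega^t,\mathcal F^t_T)$. For $n\in\mathbb N$, $\mathcal T^t(n)$ is the set of $\tau\in\mathcal T^t$ with values in $\{t\vee(i2^{-n}T)\}_{i=0}^{2^n}$, and $\mathcal T^t_s(n)=\mathcal T^t(n)\cap\mathcal T^t_s$; put $\mathcal T^t(\infty)=\mathcal T^t$, $\mathcal T^t_s(\infty)=\mathcal T^t_s$. The superscript $t$ is dropped when $t=0$; $\mathbf 0\in\Omega$ is the null path. For $\omega\in\Omega^t$, $\delta>0$: $O^s_\delta(\omega)=\{\omega'\in\Omega^t:\|\omega'-\omega\|_{t,s}<\delta\}$. $\mathbb S(\mathbf F^t,\mathbb P)$ is the set of real-valued $\mathbf F^t$-adapted processes $X$ on $[t,T]$ with all paths continuous and $\mathbb E_{\mathbb P}[\sup_{s\in[t,T]}|X_s|]<\infty$. **Shifts.** For $t\le s$, $\omega\in\Omega^t$, $\tilde\omega\in\Omega^s$: $(\omega\otimes_s\tilde\omega)(r)=\omega(r)\mathbf 1_{\{r<s\}}+(\omega(s)+\tilde\omega(r))\mathbf 1_{\{r\ge s\}}$, $r\in[t,T]$. For a random variable $\xi$ (resp. process $X$) on $\Omega^t$: $\xi^{s,\omega}(\tilde\omega)=\xi(\omega\otimes_s\tilde\omega)$, $X^{s,\omega}_r(\tilde\omega)=X_r(\omega\otimes_s\tilde\omega)$, $r\in[s,T]$. For $\mathbb P\in\mathfrak P_t$, $\mathbb P^{s,\omega}\in\mathfrak P_s$ is defined by $\mathbb P^{s,\omega}(A)=\mathbb P^\omega_s(\omega\otimes_sA)$,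 $A\in\mathcal F^s_T$, where $\{\mathbb P^\omega_s\}_{\omega\in\Omega^t}$ is the regular conditional probability distribution of $\mathbb P$ given $\mathcal F^t_s$ with $\mathbb P^\omega_s(\omega\otimes_s\Omega^s)=1$ for all $\omega$. **Payoff regularity.** $g,L,U$ are real-valued processes on $[0,T]\times\Omega$ with $L\le U$ everywhere, and there is a modulus of continuity function $\rho_0$ such that each $X\in\{g,L,U\}$ satisfies $|X_{t_1}(\omega_1)-X_{t_2}(\omega_2)|\le\rho_0\big(|t_1-t_2|+\|\omega_1(\cdot\wedge t_1)-\omega_2(\cdot\wedge t_2)\|_{0,T}\big)$ for all $(t_i,\omega_i)\in[0,T]\times\Omega$. Put $\Psi_t=(-L_t)\vee U_t\vee0$ and, for $\tau,\gamma\in\mathcal T^t$, $R^{t,\omega}(\tau,\gamma)=\int_t^{\tau\wedge\gamma}g^{t,\omega}_s\,ds+\mathbf 1_{\{\tau\le\gamma\}}L^{t,\omega}_\tau+\mathbf 1_{\{\gamma<\tau\}}U^{t,\omega}_\gamma$. **Integrability.** For every $t\in[0,T]$ the set $\widehat{\mathfrak P}_t=\{\mathbb P\in\mathfrak P_t:\Psi^{t,\mathbf 0}\in\mathbb S(\mathbf F^t,\mathbb P),\ \mathbb E_{\mathbb P}\int_t^T|g^{t,\mathbf 0}_s|ds<\infty\}$ is nonempty. **Adaptedness.** For all $(t,\omega)$, $\mathcal P(t,\omega)$ is a nonempty subset of $\widehat{\mathfrak P}_t$, and $\mathcal P(t,\omega_1)=\mathcal P(t,\omega_2)$ if $\omega_1|_{[0,t]}=\omega_2|_{[0,t]}$.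 **Stability under conditioning.** For all $0\le t<s\le T$, $\omega\in\Omega$, $\mathbb P\in\mathcal P(t,\omega)$ there exist an extension $(\Omega^t,\mathcal F',\mathbb P')$ of $(\Omega^t,\mathcal F^t_T,\mathbb P)$ (i.e. $\mathcal F^t_T\subset\mathcal F'$, $\mathbb P'|_{\mathcal F^t_T}=\mathbb P$) and $\Omega'\in\mathcal F'$ with $\mathbb P'(\Omega')=1$ such that $\mathbb P^{s,\tilde\omega}\in\mathcal P(s,\omega\otimes_t\tilde\omega)$ for all $\tilde\omega\in\Omega'$. **Weak stability under pasting.** There is a modulus of continuity function $\widehat\rho_0$ such that for all $0\le t<s\le T$, $\omega\in\Omega$, $\mathbb P\in\mathcal P(t,\omega)$, $\delta\in\mathbb Q_+$ (positive rational), $\lambda\in\mathbb N$, every $\mathcal F^t_s$-measurable partition $\{\mathcal A_j\}_{j=0}^\lambda$ of $\Omega^t$ such that for $j=1,\dots,\lambda$, $\mathcal A_j\subset O^s_{\delta_j}(\tilde\omega_j)$ for some $\delta_j\in((0,\delta]\cap\mathbb Q)\cup\{\delta\}$, $\tilde\omega_j\in\Omega^t$, and all $\mathbb P_j\in\mathcal P(s,\omega\otimes_t\tilde\omega_j)$, $j=1,\dots,\lambda$, there is $\widehat{\mathbb P}\in\mathcal P(t,\omega)$ with: (i) $\widehat{\mathbb P}(A\cap\mathcal A_0)=\mathbb P(A\cap\mathcal A_0)$ for all $A\in\mathcal F^t_T$; (ii) $\widehat{\mathbb P}(A\cap\mathcal A_j)=\mathbb P(A\cap\mathcal A_j)$ for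 all $j=1,\dots,\lambda$, $A\in\mathcal F^t_s$; (iii) for any $n\in\mathbb N\cup\{\infty\}$ and $\wp\in\mathcal T^s$ there exist $\wp^n_j\in\mathcal T^t_s$, $j=1,\dots,\lambda$, such that for any $A\in\mathcal F^t_s$ and $\tau\in\mathcal T^t_s(n)$, $$\sum_{j=1}^\lambda\mathbb E_{\widehat{\mathbb P}}\big[\mathbf 1_{A\cap\mathcal A_j}R^{t,\omega}(\tau,\wp^n_j)\big]\le\sum_{j=1}^\lambda\mathbb E_{\mathbb P}\Big[\mathbf 1_{\{\tilde\omega\in A\cap\mathcal A_j\}}\Big(\sup_{\varsigma\in\mathcal T^s(n)}\mathbb E_{\mathbb P_j}\big[R^{s,\omega\otimes_t\tilde\omega}(\varsigma,\wp)\big]+\int_t^sg^{t,\omega}_r(\tilde\omega)dr\Big)\Big]+\widehat\rho_0(\delta).$$ **Values.** For $n\in\mathbb N\cup\{\infty\}$, $V^n_t(\omega)=\inf_{\mathbb P\in\mathcal P(t,\omega)}\inf_{\gamma\in\mathcal T^t}\sup_{\tau\in\mathcal T^t(n)}\mathbb E_{\mathbb P}[R^{t,\omega}(\tau,\gamma)]$, and $\overline V:=V^\infty$, i.e. $\overline V_t(\omega)=\inf_{\mathbb P\in\mathcal P(t,\omega)}\inf_{\gamma\in\mathcal T^t}\sup_{\tau\in\mathcal T^t}\mathbb E_{\mathbb P}[R^{t,\omega}(\tau,\gamma)]$. **Path-continuity of values.** There is a modulus of continuity function $\rho_1\ge\rho_0$ such that $|V^n_t(\omega_1)-V^n_t(\omega_2)|\le\rho_1(\|\omega_1-\omega_2\|_{0,t})$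 for all $n\in\mathbb N\cup\{\infty\}$, $t\in[0,T]$, $\omega_1,\omega_2\in\Omega$. *)

theory Defs
  imports "HOL-Probability.Probability"
begin

text \<open>
  A path on \<open>[t, T]\<close> is encoded as a function on the reals that is \<open>undefined\<close> outside
  \<open>[t, T]\<close> (membership in \<^const>\<open>extensional\<close>), so that equality of paths is
  equality on \<open>[t, T]\<close>.  The horizon \<open>T\<close> is an explicit argument throughout.
\<close>

definition Path :: "real \<Rightarrow> real \<Rightarrow> (real \<Rightarrow> real ^ 'd) set" where
  "Path T t = {w \<in> extensional {t..T}. continuous_on {t..T} w \<and> w t = 0}"

definition null_path :: "real \<Rightarrow> real \<Rightarrow> real ^ 'd" where
  "null_path T = (\<lambda>r\<in>{0..T}. 0)"

definition path_norm :: "real \<Rightarrow> real \<Rightarrow> (real \<Rightarrow> real ^ 'd) \<Rightarrow> real" where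
  "path_norm t s w = (SUP r\<in>{t..s}. norm (w r))"

definition path_ball ::
    "real \<Rightarrow> real \<Rightarrow> real \<Rightarrow> real \<Rightarrow> (real \<Rightarrow> real ^ 'd) \<Rightarrow> (real \<Rightarrow> real ^ 'd) set" where
  "path_ball T t s \<delta> w = {w' \<in> Path T t. path_norm t s (\<lambda>r. w' r - w r) < \<delta>}"

definition concat_path ::
    "real \<Rightarrow> real \<Rightarrow> real \<Rightarrow> (real \<Rightarrow> real ^ 'd) \<Rightarrow> (real \<Rightarrow> real ^ 'd) \<Rightarrow> real \<Rightarrow> real ^ 'd" where
  "concat_path T t s w w' = (\<lambda>r\<in>{t..T}. if r < s then w r else w s + w' r)"

definition modulus :: "(real \<Rightarrow> real) \<Rightarrow> bool" where
  "modulus \<rho> \<longleftrightarrow>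
     \<rho> \<in> {0..} \<rightarrow> {0..} \<and> mono_on {0..} \<rho> \<and> \<rho> 0 = 0 \<and> (\<rho> \<longlongrightarrow> 0) (at_right 0)"

text \<open>The raw filtration of the canonical process.  For \<open>s < t\<close> it is trivial and for \<open>s > T\<close>
  it is constant, so \<^const>\<open>stopping_time\<close>, which quantifies over all real times, imposes
  nothing beyond the condition on \<open>[t, T]\<close>.\<close>

definition path_filt :: "real \<Rightarrow> real \<Rightarrow> real \<Rightarrow> (real \<Rightarrow> real ^ 'd) measure" where
  "path_filt T t s =
     sigma (Path T t) {{w \<in> Path T t. w r \<in> B} | r B. r \<in> {t..s} \<and> B \<in> sets borel}"

definition stop_times :: "real \<Rightarrow> real \<Rightarrow> enat \<Rightarrow> ((real \<Rightarrow> real ^ 'd) \<Rightarrow> real) set" where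
  "stop_times T t n =
     {\<tau>. stopping_time (path_filt T t) \<tau> \<and> \<tau> \<in> Path T t \<rightarrow> {t..T} \<and>
         (\<forall>k::nat. n = enat k \<longrightarrow>
            \<tau> \<in> Path T t \<rightarrow> {max t (real i * (1 / 2) ^ k * T) | i. i \<le> 2 ^ k})}"

definition stop_times_from ::
    "real \<Rightarrow> real \<Rightarrow> real \<Rightarrow> enat \<Rightarrow> ((real \<Rightarrow> real ^ 'd) \<Rightarrow> real) set" where
  "stop_times_from T t s n = {\<tau> \<in> stop_times T t n. \<forall>w\<in>Path T t. s \<le> \<tau> w}"

definition path_probs :: "real \<Rightarrow> real \<Rightarrow> (real \<Rightarrow> real ^ 'd) measure set" where
  "path_probs T t = {P. prob_space P \<and> sets P = sets (path_filt T t T)}"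

definition cont_integrable_process ::
    "real \<Rightarrow> real \<Rightarrow> (real \<Rightarrow> real ^ 'd) measure \<Rightarrow> (real \<Rightarrow> (real \<Rightarrow> real ^ 'd) \<Rightarrow> real) \<Rightarrow> bool" where
  "cont_integrable_process T t P X \<longleftrightarrow>
     (\<forall>s\<in>{t..T}. X s \<in> borel_measurable (path_filt T t s)) \<and>
     (\<forall>w\<in>Path T t. continuous_on {t..T} (\<lambda>s. X s w)) \<and>
     (\<integral>\<^sup>+ w. (SUP s\<in>{t..T}. ennreal \<bar>X s w\<bar>) \<partial>P) < \<infinity>"


text \<open>\<open>K\<close> is a version of the regular conditional probability distribution of \<open>P\<close> given the
  \<open>\<sigma>\<close>-algebra at time \<open>s\<close>, concentrated for \<^emph>\<open>every\<close> \<open>w\<close> on the paths agreeing with \<open>w\<close> up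
  to time \<open>s\<close>.\<close>

definition is_rcpd ::
    "real \<Rightarrow> real \<Rightarrow> real \<Rightarrow> (real \<Rightarrow> real ^ 'd) measure \<Rightarrow>
      ((real \<Rightarrow> real ^ 'd) \<Rightarrow> (real \<Rightarrow> real ^ 'd) measure) \<Rightarrow> bool" where
  "is_rcpd T t s P K \<longleftrightarrow>
     (\<forall>w\<in>Path T t. K w \<in> path_probs T t) \<and>
     (\<forall>A\<in>sets (path_filt T t T).
        (\<lambda>w. measure (K w) A) \<in> borel_measurable (path_filt T t s) \<and>
        (AE w in P. measure (K w) A = real_cond_exp P (path_filt T t s) (indicator A) w)) \<and>
     (\<forall>w\<in>Path T t. measure (K w) (concat_path T t s w ` Path T s) = 1)"

definition shift_prob ::
    "real \<Rightarrow> real \<Rightarrow> real \<Rightarrow> ((real \<Rightarrow> real ^ 'd) \<Rightarrow> (real \<Rightarrow> real ^ 'd) measure) \<Rightarrow>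
      (real \<Rightarrow> real ^ 'd) \<Rightarrow> (real \<Rightarrow> real ^ 'd) measure" where
  "shift_prob T t s K w =
     measure_of (Path T s) (sets (path_filt T s T))
       (\<lambda>A. emeasure (K w) (concat_path T t s w ` A))"


definition Psi ::
    "(real \<Rightarrow> (real \<Rightarrow> real ^ 'd) \<Rightarrow> real) \<Rightarrow> (real \<Rightarrow> (real \<Rightarrow> real ^ 'd) \<Rightarrow> real) \<Rightarrow>
      real \<Rightarrow> (real \<Rightarrow> real ^ 'd) \<Rightarrow> real" where
  "Psi L U t w = max (max (- L t w) (U t w)) 0"

definition payoff ::
    "real \<Rightarrow> (real \<Rightarrow> (real \<Rightarrow> real ^ 'd) \<Rightarrow> real) \<Rightarrow> (real \<Rightarrow> (real \<Rightarrow> real ^ 'd) \<Rightarrow> real) \<Rightarrow>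
      (real \<Rightarrow> (real \<Rightarrow> real ^ 'd) \<Rightarrow> real) \<Rightarrow> real \<Rightarrow> (real \<Rightarrow> real ^ 'd) \<Rightarrow>
      ((real \<Rightarrow> real ^ 'd) \<Rightarrow> real) \<Rightarrow> ((real \<Rightarrow> real ^ 'd) \<Rightarrow> real) \<Rightarrow> (real \<Rightarrow> real ^ 'd) \<Rightarrow> real" where
  "payoff T g L U t w \<tau> \<gamma> w' =
     (LBINT r:{t..min (\<tau> w') (\<gamma> w')}. g r (concat_path T 0 t w w')) +
     (if \<tau> w' \<le> \<gamma> w' then L (\<tau> w') (concat_path T 0 t w w')
      else U (\<gamma> w') (concat_path T 0 t w w'))"

text \<open>The infima and suprema are taken in \<^typ>\<open>real\<close>.  Under payoff regularity, integrability
  and adaptedness (defined below) all the sets involved are nonempty and suitably bounded: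
  \<open>\<tau> = t\<close> is always admissible and gives the payoff \<open>L\<^sub>t(w)\<close>, a lower bound uniform in
  \<open>P\<close> and \<open>\<gamma>\<close>, and for each \<open>P\<close> the payoffs are dominated by a \<open>P\<close>-integrable random
  variable, uniformly in \<open>\<tau>\<close> and \<open>\<gamma>\<close>.\<close>

definition val ::
    "real \<Rightarrow> (real \<Rightarrow> (real \<Rightarrow> real ^ 'd) \<Rightarrow> real) \<Rightarrow> (real \<Rightarrow> (real \<Rightarrow> real ^ 'd) \<Rightarrow> real) \<Rightarrow>
      (real \<Rightarrow> (real \<Rightarrow> real ^ 'd) \<Rightarrow> real) \<Rightarrow>
      (real \<Rightarrow> (real \<Rightarrow> real ^ 'd) \<Rightarrow> (real \<Rightarrow> real ^ 'd) measure set) \<Rightarrow>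
      enat \<Rightarrow> real \<Rightarrow> (real \<Rightarrow> real ^ 'd) \<Rightarrow> real" where
  "val T g L U \<P> n t w =
     (INF P\<in>\<P> t w. INF \<gamma>\<in>stop_times T t \<infinity>. SUP \<tau>\<in>stop_times T t n.
        (\<integral>w'. payoff T g L U t w \<tau> \<gamma> w' \<partial>P))"


definition payoff_regularity ::
    "real \<Rightarrow> (real \<Rightarrow> real) \<Rightarrow> (real \<Rightarrow> (real \<Rightarrow> real ^ 'd) \<Rightarrow> real) \<Rightarrow>
      (real \<Rightarrow> (real \<Rightarrow> real ^ 'd) \<Rightarrow> real) \<Rightarrow> (real \<Rightarrow> (real \<Rightarrow> real ^ 'd) \<Rightarrow> real) \<Rightarrow> bool" where
  "payoff_regularity T \<rho>0 g L U \<longleftrightarrow>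
     modulus \<rho>0 \<and>
     (\<forall>t\<in>{0..T}. \<forall>w\<in>Path T 0. L t w \<le> U t w) \<and>
     (\<forall>X\<in>{g, L, U}. \<forall>t1\<in>{0..T}. \<forall>t2\<in>{0..T}. \<forall>w1\<in>Path T 0. \<forall>w2\<in>Path T 0.
        \<bar>X t1 w1 - X t2 w2\<bar>
          \<le> \<rho>0 (\<bar>t1 - t2\<bar> + path_norm 0 T (\<lambda>r. w1 (min r t1) - w2 (min r t2))))"

definition integrable_probs ::
    "real \<Rightarrow> (real \<Rightarrow> (real \<Rightarrow> real ^ 'd) \<Rightarrow> real) \<Rightarrow> (real \<Rightarrow> (real \<Rightarrow> real ^ 'd) \<Rightarrow> real) \<Rightarrow>
      (real \<Rightarrow> (real \<Rightarrow> real ^ 'd) \<Rightarrow> real) \<Rightarrow> real \<Rightarrow> (real \<Rightarrow> real ^ 'd) measure set" where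
  "integrable_probs T g L U t =
     {P \<in> path_probs T t.
        cont_integrable_process T t P
          (\<lambda>s w'. Psi L U s (concat_path T 0 t (null_path T) w')) \<and>
        (\<integral>\<^sup>+ w'. (\<integral>\<^sup>+ s\<in>{t..T}. ennreal \<bar>g s (concat_path T 0 t (null_path T) w')\<bar> \<partial>lborel) \<partial>P)
          < \<infinity>}"

definition integrability ::
    "real \<Rightarrow> (real \<Rightarrow> (real \<Rightarrow> real ^ 'd) \<Rightarrow> real) \<Rightarrow> (real \<Rightarrow> (real \<Rightarrow> real ^ 'd) \<Rightarrow> real) \<Rightarrow>
      (real \<Rightarrow> (real \<Rightarrow> real ^ 'd) \<Rightarrow> real) \<Rightarrow> bool" where
  "integrability T g L U \<longleftrightarrow> (\<forall>t\<in>{0..T}. integrable_probs T g L U t \<noteq> {})"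

definition adaptedness ::
    "real \<Rightarrow> (real \<Rightarrow> (real \<Rightarrow> real ^ 'd) \<Rightarrow> real) \<Rightarrow> (real \<Rightarrow> (real \<Rightarrow> real ^ 'd) \<Rightarrow> real) \<Rightarrow>
      (real \<Rightarrow> (real \<Rightarrow> real ^ 'd) \<Rightarrow> real) \<Rightarrow>
      (real \<Rightarrow> (real \<Rightarrow> real ^ 'd) \<Rightarrow> (real \<Rightarrow> real ^ 'd) measure set) \<Rightarrow> bool" where
  "adaptedness T g L U \<P> \<longleftrightarrow>
     (\<forall>t\<in>{0..T}. \<forall>w\<in>Path T 0. \<P> t w \<noteq> {} \<and> \<P> t w \<subseteq> integrable_probs T g L U t) \<and>
     (\<forall>t\<in>{0..T}. \<forall>w1\<in>Path T 0. \<forall>w2\<in>Path T 0.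
        (\<forall>r\<in>{0..t}. w1 r = w2 r) \<longrightarrow> \<P> t w1 = \<P> t w2)"

text \<open>Versions of the regular conditional probability distribution agree up to a \<open>P\<close>-null set,
  which can be removed from \<open>\<Omega>'\<close>; hence it does not matter which version \<open>K\<close> is used.\<close>

definition stability_conditioning ::
    "real \<Rightarrow> (real \<Rightarrow> (real \<Rightarrow> real ^ 'd) \<Rightarrow> (real \<Rightarrow> real ^ 'd) measure set) \<Rightarrow> bool" where
  "stability_conditioning T \<P> \<longleftrightarrow>
     (\<forall>t s. 0 \<le> t \<and> t < s \<and> s \<le> T \<longrightarrow>
       (\<forall>w\<in>Path T 0. \<forall>P\<in>\<P> t w.
         \<exists>K. is_rcpd T t s P K \<and>
           (\<exists>P' \<Omega>'. prob_space P' \<and> space P' = Path T t \<and>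
              sets (path_filt T t T) \<subseteq> sets P' \<and>
              (\<forall>A\<in>sets (path_filt T t T). emeasure P' A = emeasure P A) \<and>
              \<Omega>' \<in> sets P' \<and> emeasure P' \<Omega>' = 1 \<and>
              (\<forall>w'\<in>\<Omega>'. shift_prob T t s K w' \<in> \<P> s (concat_path T 0 t w w')))))"

text \<open>The partition is indexed by \<open>{0..m}\<close>; \<open>m\<close> and the discretisation level \<open>n\<close> are positive
  (\<open>n = \<infinity>\<close> allowed), and members of the partition may be empty.\<close>

definition weak_pasting ::
    "real \<Rightarrow> (real \<Rightarrow> (real \<Rightarrow> real ^ 'd) \<Rightarrow> real) \<Rightarrow> (real \<Rightarrow> (real \<Rightarrow> real ^ 'd) \<Rightarrow> real) \<Rightarrow>
      (real \<Rightarrow> (real \<Rightarrow> real ^ 'd) \<Rightarrow> real) \<Rightarrow>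
      (real \<Rightarrow> (real \<Rightarrow> real ^ 'd) \<Rightarrow> (real \<Rightarrow> real ^ 'd) measure set) \<Rightarrow> bool" where
  "weak_pasting T g L U \<P> \<longleftrightarrow>
     (\<exists>\<rho>. modulus \<rho> \<and>
       (\<forall>t s. 0 \<le> t \<and> t < s \<and> s \<le> T \<longrightarrow>
         (\<forall>w\<in>Path T 0. \<forall>P\<in>\<P> t w. \<forall>\<delta>\<in>\<rat>. \<forall>m::nat. \<forall>A. \<forall>d. \<forall>c. \<forall>Q.
            0 < \<delta> \<and> 1 \<le> m \<and>
            (\<forall>j\<le>m. A j \<in> sets (path_filt T t s)) \<and>
            disjoint_family_on A {..m} \<and> (\<Union>j\<le>m. A j) = Path T t \<and>
            (\<forall>j\<in>{1..m}. d j \<in> ({0<..\<delta>} \<inter> \<rat>) \<union> {\<delta>} \<and> c j \<in> Path T t \<and>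
               A j \<subseteq> path_ball T t s (d j) (c j) \<and>
               Q j \<in> \<P> s (concat_path T 0 t w (c j))) \<longrightarrow>
            (\<exists>P'\<in>\<P> t w.
               (\<forall>E\<in>sets (path_filt T t T). measure P' (E \<inter> A 0) = measure P (E \<inter> A 0)) \<and>
               (\<forall>j\<in>{1..m}. \<forall>E\<in>sets (path_filt T t s).
                  measure P' (E \<inter> A j) = measure P (E \<inter> A j)) \<and>
               (\<forall>n::enat. 1 \<le> n \<longrightarrow> (\<forall>\<nu>\<in>stop_times T s \<infinity>.
                  \<exists>\<nu>'. (\<forall>j\<in>{1..m}. \<nu>' j \<in> stop_times_from T t s \<infinity>) \<and>
                    (\<forall>E\<in>sets (path_filt T t s). \<forall>\<tau>\<in>stop_times_from T t s n.
                       (\<Sum>j = 1..m. \<integral>w'. indicator (E \<inter> A j) w' *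
                            payoff T g L U t w \<tau> (\<nu>' j) w' \<partial>P')
                       \<le> (\<Sum>j = 1..m. \<integral>w'. indicator (E \<inter> A j) w' *
                            ((SUP \<sigma>\<in>stop_times T s n.
                                \<integral>v. payoff T g L U s (concat_path T 0 t w w') \<sigma> \<nu> v \<partial>(Q j)) +
                             (LBINT r:{t..s}. g r (concat_path T 0 t w w'))) \<partial>P)
                         + \<rho> \<delta>)))))))"

definition path_continuity ::
    "real \<Rightarrow> (real \<Rightarrow> real) \<Rightarrow> (real \<Rightarrow> (real \<Rightarrow> real ^ 'd) \<Rightarrow> real) \<Rightarrow>
      (real \<Rightarrow> (real \<Rightarrow> real ^ 'd) \<Rightarrow> real) \<Rightarrow> (real \<Rightarrow> (real \<Rightarrow> real ^ 'd) \<Rightarrow> real) \<Rightarrow>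
      (real \<Rightarrow> (real \<Rightarrow> real ^ 'd) \<Rightarrow> (real \<Rightarrow> real ^ 'd) measure set) \<Rightarrow> bool" where
  "path_continuity T \<rho>0 g L U \<P> \<longleftrightarrow>
     (\<exists>\<rho>1. modulus \<rho>1 \<and> (\<forall>x\<ge>0. \<rho>0 x \<le> \<rho>1 x) \<and>
       (\<forall>n::enat. 1 \<le> n \<longrightarrow>
         (\<forall>t\<in>{0..T}. \<forall>w1\<in>Path T 0. \<forall>w2\<in>Path T 0.
            \<bar>val T g L U \<P> n t w1 - val T g L U \<P> n t w2\<bar>
              \<le> \<rho>1 (path_norm 0 t (\<lambda>r. w1 r - w2 r)))))"

end

theory Submission
  imports Defs
begin

text \<open>
  Fix \<open>P\<close>, a stopping time \<open>\<gamma>\<close> of the minimizer and \<open>\<tau>\<close> of the maximizer.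
  On the event \<open>\<tau> \<and> \<gamma> \<ge> s\<close> the number \<open>V\<^sub>s + \<integral>\<^sub>t\<^sup>s g\<close> is, by stability under conditioning, at
  most the supremum over stopping times \<open>\<sigma>\<close> after \<open>s\<close> of the conditional expected payoff of
  \<open>(\<sigma>, max s \<gamma>)\<close> given \<open>\<F>\<^sub>s\<close>.  That supremum is unchanged when restricted to a countable family of \<open>\<sigma>\<close> that does
  not depend on the conditional law: round \<open>\<sigma>\<close> up to a dyadic grid (harmless in the limit since
  \<open>L \<le> U\<close>) and approximate the finitely many events \<open>{\<sigma> \<le> c}\<close> by members of a countable algebra
  generating \<open>\<F>\<^sub>c\<close>.  Finite maxima over the family are realized by one stopping time, chosen
  \<open>\<F>\<^sub>s\<close>-measurably; splicing it to \<open>\<tau>\<close> before \<open>s\<close> and passing to the limit by dominated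
  convergence bounds the modified expected payoff of \<open>(\<tau>, \<gamma>)\<close> by the supremum of the original ones.
\<close>

section \<open>Paths, shifts and the raw filtration\<close>

text \<open>The obstacle is measurability. Good replies in the games restarted at \<open>s\<close>
  depend on the path seen so far, and the conditioned laws are known to belong to the class only on
  a set that is measurable in an extension of the probability space. A countable family of replies
  replaces a measurable selection and turns the event on which it approximates \<open>V\<close> into
  an ordinary event of the raw filtration. Regularity in the path variable supplies the
  measurability of \<open>g\<close>, \<open>L\<close>, \<open>U\<close> and \<open>V\<close>. No law
  has to be selected: \<open>V\<close> is an infimum, so a conditioned law together with the
  continuation of \<open>\<gamma>\<close> is just one competitor in the restarted game. Hence
  \<open>P\<close> and \<open>\<gamma>\<close> stay fixed and only the maximizer's time is spliced.
  All limits are dominated through \<open>path_bound\<close>, one path functional that majorizes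
  every payoff and is integrable under every admissible law. For \<open>V\<close> it gives a lower
  bound directly; the upper bound comes from its conditional expectation. The case
  \<open>t = s\<close> is separate, because conditioning is assumed for
  \<open>t < s\<close>.\<close>

lemma space_path_filt [simp]: "space (path_filt T t s) = Path T t"
  unfolding path_filt_def by (rule space_measure_of) auto

lemma sets_path_filt:
  "sets (path_filt T t s) =
     sigma_sets (Path T t) {{w \<in> Path T t. w r \<in> B} | r B. r \<in> {t..s} \<and> B \<in> sets borel}"
  unfolding path_filt_def by (rule sets_measure_of) auto

lemma measurable_path_coord:
  assumes "r \<in> {t..s}"
  shows "(\<lambda>w. w r) \<in> borel_measurable (path_filt T t s)"
proof (rule measurableI)
  fix B :: "(real^'d) set" assume "B \<in> sets borel"
  then have "{w \<in> Path T t. w r \<in> B} \<in> sets (path_filt T t s)"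
    unfolding sets_path_filt using assms by (intro sigma_sets.Basic) blast
  moreover have "(\<lambda>w. w r) -` B \<inter> space (path_filt T t s) = {w \<in> Path T t. w r \<in> B}"
    by auto
  ultimately show "(\<lambda>w. w r) -` B \<inter> space (path_filt T t s) \<in> sets (path_filt T t s)"
    by simp
qed simp

lemma measurable_path_filtI:
  fixes f :: "'a \<Rightarrow> real \<Rightarrow> real ^ 'd"
  assumes "f \<in> space N \<rightarrow> Path T t"
    and "\<And>r. r \<in> {t..s} \<Longrightarrow> (\<lambda>x. f x r) \<in> borel_measurable N"
  shows "f \<in> measurable N (path_filt T t s)"
  unfolding path_filt_def
proof (rule measurable_measure_of)
  fix C :: "(real \<Rightarrow> real ^ 'd) set"
  assume "C \<in> {{w \<in> Path T t. w r \<in> B} | r B. r \<in> {t..s} \<and> B \<in> sets borel}"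
  then obtain r B where C: "C = {w \<in> Path T t. w r \<in> B}" "r \<in> {t..s}" "B \<in> sets borel"
    by blast
  have "f -` C \<inter> space N = (\<lambda>x. f x r) -` B \<inter> space N"
    using assms(1) C(1) by auto
  then show "f -` C \<inter> space N \<in> sets N"
    using assms(2)[OF C(2)] C(3) by (simp add: measurable_sets)
qed (use assms(1) in auto)

lemma sets_path_filt_mono:
  assumes "s \<le> s'"
  shows "sets (path_filt T t s) \<subseteq> sets (path_filt T t s')"
  unfolding sets_path_filt using assms by (intro sigma_sets_mono') force

lemma measurable_path_filt_mono:
  assumes "f \<in> measurable (path_filt T t s) N" "s \<le> s'"
  shows "f \<in> measurable (path_filt T t s') N"
  using assms sets_path_filt_mono[of s s' T t] by (auto simp: measurable_def)

text \<open>The generators test coordinates up to \<open>s\<close> only, and the property survives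
  complements and countable unions. Later it makes events of time \<open>s\<close> deterministic
  under a conditional law that is concentrated on the continuations of one path.\<close>

lemma path_filt_same_paths:
  assumes "C \<in> sets (path_filt T t s)" "v \<in> Path T t" "v' \<in> Path T t" "\<And>r. r \<in> {t..s} \<Longrightarrow> v r = v' r"
  shows "v \<in> C \<longleftrightarrow> v' \<in> C"
  using assms(1) unfolding sets_path_filt
proof (induction rule: sigma_sets.induct)
  case (Basic a)
  then show ?case using assms(2-4) by auto
qed (use assms in auto)

text \<open>Left inverse of concatenation with a fixed initial path. It lets strategies of the
  restarted game act on full paths and turns \<open>shift_prob\<close> into a push-forward.\<close>

definition shift_path :: "real \<Rightarrow> real \<Rightarrow> (real \<Rightarrow> real ^ 'd) \<Rightarrow> real \<Rightarrow> real ^ 'd" where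
  "shift_path T s v = (\<lambda>r\<in>{s..T}. v r - v s)"

lemma PathI:
  "\<lbrakk>w \<in> extensional {t..T}; continuous_on {t..T} w; w t = 0\<rbrakk> \<Longrightarrow> w \<in> Path T t"
  by (simp add: Path_def)

lemma Path_zero: "w \<in> Path T t \<Longrightarrow> w t = 0"
  and Path_continuous: "w \<in> Path T t \<Longrightarrow> continuous_on {t..T} w"
  by (simp_all add: Path_def)

lemma concat_path_apply:
  assumes "r \<in> {t..T}"
  shows "concat_path T t s w w' r = (if r < s then w r else w s + w' r)"
  using assms by (simp add: concat_path_def)

text \<open>The endpoint \<open>r = s\<close> is included because \<open>w'\<close> starts at
  zero.\<close>

lemma concat_path_before:
  assumes "r \<in> {t..s}" "s \<le> T" "w' \<in> Path T s"
  shows "concat_path T t s w w' r = w r"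
  using assms Path_zero[OF assms(3)] by (cases "r = s") (auto simp: concat_path_apply)

lemma concat_path_in_Path:
  assumes "w \<in> Path T t" "w' \<in> Path T s" "t \<le> s" "s \<le> T"
  shows "concat_path T t s w w' \<in> Path T t"
proof (rule PathI)
  show "concat_path T t s w w' \<in> extensional {t..T}"
    by (simp add: concat_path_def)
  show "concat_path T t s w w' t = 0"
    using concat_path_before[of t t s T w' w] assms Path_zero[OF assms(1)] by simp
  have "continuous_on ({t..s} \<union> {s..T}) (\<lambda>r. if r \<le> s then w r else w s + w' r)"
  proof (rule continuous_on_cases_le[where h = "\<lambda>r. r" and a = s])
    show "continuous_on {r \<in> {t..s} \<union> {s..T}. r \<le> s} w"
      by (rule continuous_on_subset[OF Path_continuous[OF assms(1)]]) (use assms in auto)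
    show "continuous_on {r \<in> {t..s} \<union> {s..T}. s \<le> r} (\<lambda>r. w s + w' r)"
      by (intro continuous_intros continuous_on_subset[OF Path_continuous[OF assms(2)]])
        (use assms in auto)
  qed (use Path_zero[OF assms(2)] in \<open>auto intro: continuous_intros\<close>)
  moreover have "{t..s} \<union> {s..T} = {t..T}"
    using assms by auto
  ultimately have "continuous_on {t..T} (\<lambda>r. if r \<le> s then w r else w s + w' r)"
    by simp
  then show "continuous_on {t..T} (concat_path T t s w w')"
    by (rule continuous_on_eq)
      (use Path_zero[OF assms(2)] in \<open>auto simp: concat_path_apply\<close>)
qed

lemma shift_path_in_Path:
  assumes "v \<in> Path T t" "t \<le> s" "s \<le> T"
  shows "shift_path T s v \<in> Path T s"
proof (rule PathI)
  have "continuous_on {s..T} (\<lambda>r. v r - v s)"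
    by (intro continuous_intros continuous_on_subset[OF Path_continuous[OF assms(1)]])
      (use assms in auto)
  then show "continuous_on {s..T} (shift_path T s v)"
    by (rule continuous_on_eq) (simp add: shift_path_def)
qed (use assms in \<open>auto simp: shift_path_def\<close>)

lemma Path_eqI:
  assumes "v \<in> Path T t" "v' \<in> Path T t" "\<And>r. r \<in> {t..T} \<Longrightarrow> v r = v' r"
  shows "v = v'"
  using assms by (auto simp: Path_def intro: extensionalityI)

lemma shift_concat_path:
  assumes "v \<in> Path T t" "w' \<in> Path T s" "t \<le> s" "s \<le> T"
  shows "shift_path T s (concat_path T t s v w') = w'"
  by (rule Path_eqI[OF shift_path_in_Path[OF concat_path_in_Path[OF assms] assms(3,4)] assms(2)])
    (use assms Path_zero[OF assms(2)] in \<open>auto simp: concat_path_apply shift_path_def\<close>)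

lemma concat_path_assoc:
  assumes "t \<le> s" "a \<le> t" "s \<le> T"
  shows "concat_path T a s (concat_path T a t w v) w' = concat_path T a t w (concat_path T t s v w')"
  using assms by (auto simp: concat_path_def fun_eq_iff restrict_def add.assoc)

lemma concat_path_cong_left:
  assumes "\<And>r. r \<in> {a..s} \<Longrightarrow> v r = v' r" "a \<le> s" 
  shows "concat_path T a s v w' = concat_path T a s v' w'"
  using assms by (auto simp: concat_path_def fun_eq_iff restrict_def)

lemma measurable_concat_path:
  assumes "v \<in> Path T t" "t \<le> s" "s \<le> u" "u \<le> T"
  shows "concat_path T t s v \<in> measurable (path_filt T s u) (path_filt T t u)"
proof (rule measurable_path_filtI)
  show "concat_path T t s v \<in> space (path_filt T s u) \<rightarrow> Path T t"
    using assms by (auto intro: concat_path_in_Path)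
  fix r assume r: "r \<in> {t..u}"
  show "(\<lambda>x. concat_path T t s v x r) \<in> borel_measurable (path_filt T s u)"
  proof (cases "r < s")
    case True
    then show ?thesis using r assms by (simp add: concat_path_apply)
  next
    case False
    then show ?thesis using r assms
      by (simp add: concat_path_apply) (intro borel_measurable_add measurable_path_coord; simp)
  qed
qed

lemma measurable_shift_path:
  assumes "t \<le> s" "s \<le> u" "u \<le> T"
  shows "shift_path T s \<in> measurable (path_filt T t u) (path_filt T s u)"
proof (rule measurable_path_filtI)
  show "shift_path T s \<in> space (path_filt T t u) \<rightarrow> Path T s"
    using assms by (auto intro: shift_path_in_Path)
  fix r assume r: "r \<in> {s..u}"
  then show "(\<lambda>x. shift_path T s x r) \<in> borel_measurable (path_filt T t u)"
    using assms
    by (simp add: shift_path_def) (intro borel_measurable_diff measurable_path_coord; simp)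
qed

section \<open>Supremum norms and moduli of continuity\<close>

lemma path_norm_le:
  assumes "a \<le> b" "\<And>r. r \<in> {a..b} \<Longrightarrow> norm (f r) \<le> c"
  shows "path_norm a b f \<le> c"
  unfolding path_norm_def using assms by (intro cSUP_least) auto

lemma norm_le_path_norm:
  assumes "continuous_on {a..b} f" "r \<in> {a..b}"
  shows "norm (f r) \<le> path_norm a b f"
  unfolding path_norm_def
proof (rule cSUP_upper[OF assms(2)])
  have "compact ((\<lambda>r. norm (f r)) ` {a..b})"
    using assms by (intro compact_continuous_image continuous_intros) auto
  then show "bdd_above ((\<lambda>r. norm (f r)) ` {a..b})"
    by (intro bounded_imp_bdd_above compact_imp_bounded)
qed

lemma path_norm_nonneg:
  assumes "continuous_on {a..b} f" "a \<le> b"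
  shows "0 \<le> path_norm a b f"
  using norm_le_path_norm[OF assms(1), of a] assms(2) norm_ge_zero[of "f a"]
  by (auto simp del: norm_ge_zero)

lemma modulus_mono: "\<lbrakk>modulus \<rho>; 0 \<le> x; x \<le> y\<rbrakk> \<Longrightarrow> \<rho> x \<le> \<rho> y"
  by (auto simp: modulus_def mono_on_def)

lemma modulus_tendsto_zero:
  assumes "modulus \<rho>" "(f \<longlongrightarrow> 0) F" "eventually (\<lambda>x. 0 \<le> f x) F"
  shows "((\<lambda>x. \<rho> (f x)) \<longlongrightarrow> 0) F"
proof (rule tendstoI)
  fix e :: real assume "0 < e"
  have "eventually (\<lambda>x. dist (\<rho> x) 0 < e) (at_right 0)"
    using assms(1) \<open>0 < e\<close> unfolding modulus_def by (auto dest: tendstoD)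
  then obtain d where d: "0 < d" "\<And>x. 0 < x \<Longrightarrow> x < d \<Longrightarrow> \<bar>\<rho> x\<bar> < e"
    unfolding eventually_at_right_field by auto
  \<comment> \<open>The filter \<open>at_right 0\<close> does not see the point 0, which
    \<open>f\<close> may well attain; there \<open>\<rho> 0 = 0\<close> is used.\<close>
  have d': "\<bar>\<rho> x\<bar> < e" if "0 \<le> x" "x < d" for x
    using d(2)[of x] that assms(1) \<open>0 < e\<close> by (cases "x = 0") (auto simp: modulus_def)
  have "eventually (\<lambda>x. f x < d) F"
    using order_tendstoD(2)[OF assms(2) d(1)] .
  with assms(3) show "eventually (\<lambda>x. dist (\<rho> (f x)) 0 < e) F"
    by eventually_elim (use d' in auto)
qed

section \<open>Measurability of continuous path functionals\<close>

text \<open>The Bernstein polynomial with coefficients \<open>x\<close> on \<open>[t, u]\<close>,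
  frozen after \<open>u\<close>. The coefficient of index 0 is forced to be 0, so that every
  coefficient sequence yields an element of the path space. If \<open>t = u\<close>, division by
  zero gives the null path.\<close>

definition bernstein_path :: "real \<Rightarrow> real \<Rightarrow> real \<Rightarrow> nat \<Rightarrow> (nat \<Rightarrow> real ^ 'd) \<Rightarrow> real \<Rightarrow> real ^ 'd" where
  "bernstein_path T t u n x =
     (\<lambda>r\<in>{t..T}. \<Sum>k\<le>n. Bernstein n k ((min r u - t) / (u - t)) *\<^sub>R (if k = 0 then 0 else x k))"

lemma bernstein_path_in_Path:
  assumes "t \<le> u" "u \<le> T"
  shows "bernstein_path T t u n x \<in> Path T t"
proof (rule PathI)
  have "continuous_on {t..T} (\<lambda>r. \<Sum>k\<le>n. Bernstein n k ((min r u - t) / (u - t)) *\<^sub>R (if k = 0 then 0 else x k))"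
    unfolding Bernstein_def divide_inverse by (intro continuous_intros)
  then show "continuous_on {t..T} (bernstein_path T t u n x)"
    by (rule continuous_on_eq) (simp add: bernstein_path_def)
  show "bernstein_path T t u n x t = 0"
    using assms by (auto simp: bernstein_path_def Bernstein_def intro!: sum.neutral)
qed (simp add: bernstein_path_def)

lemma Bernstein_le_1:
  assumes "0 \<le> x" "x \<le> 1" "k \<le> n"
  shows "Bernstein n k x \<le> 1"
proof -
  have "Bernstein n k x \<le> (\<Sum>k\<le>n. Bernstein n k x)"
    using assms by (intro member_le_sum Bernstein_nonneg) auto
  then show ?thesis by simp
qed

lemma unit_rescale:
  assumes "r \<in> {t..u}"
  shows "0 \<le> (r - t) / (u - t)" "(r - t) / (u - t) \<le> (1::real)" "t + (u - t) * ((r - t) / (u - t)) = r"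
  using assms by (auto simp: divide_simps)

text \<open>All Bernstein weights lie in \<open>[0, 1]\<close>. The estimate makes the path depend
  continuously on its finitely many relevant coefficients.\<close>

lemma path_norm_bernstein_path_diff:
  assumes "t \<le> u" "u \<le> T"
  shows "path_norm t u (\<lambda>r. bernstein_path T t u n x r - bernstein_path T t u n y r)
    \<le> (\<Sum>k\<le>n. norm (x k - y k))"
proof (rule path_norm_le[OF assms(1)])
  fix r assume r: "r \<in> {t..u}"
  let ?b = "\<lambda>k. Bernstein n k ((r - t) / (u - t))"
  have "bernstein_path T t u n x r - bernstein_path T t u n y r
      = (\<Sum>k\<le>n. ?b k *\<^sub>R (if k = 0 then 0 else x k) - ?b k *\<^sub>R (if k = 0 then 0 else y k))"
    using r assms by (simp add: bernstein_path_def sum_subtractf)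
  also have "norm \<dots> \<le> (\<Sum>k\<le>n. norm (x k - y k))"
  proof (rule order_trans[OF norm_sum sum_mono])
    fix k assume k: "k \<in> {..n}"
    have "norm (?b k *\<^sub>R (x k - y k)) \<le> 1 * norm (x k - y k)"
      unfolding norm_scaleR
      using Bernstein_le_1[OF unit_rescale(1,2)[OF r]] Bernstein_nonneg[OF unit_rescale(1,2)[OF r]] k
      by (intro mult_right_mono) auto
    then show "norm (?b k *\<^sub>R (if k = 0 then 0 else x k) - ?b k *\<^sub>R (if k = 0 then 0 else y k))
        \<le> norm (x k - y k)"
      by (simp add: scaleR_diff_right)
  qed
  finally show "norm (bernstein_path T t u n x r - bernstein_path T t u n y r) \<le> (\<Sum>k\<le>n. norm (x k - y k))" .
qed

lemma path_norm_diff_nonneg: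
  assumes "v \<in> Path T t" "v' \<in> Path T t" "t \<le> u" "u \<le> T"
  shows "0 \<le> path_norm t u (\<lambda>r. v r - v' r)"
proof (rule path_norm_nonneg[OF _ assms(3)])
  have "{t..u} \<subseteq> {t..T}" using assms by auto
  then show "continuous_on {t..u} (\<lambda>r. v r - v' r)"
    by (intro continuous_on_diff continuous_on_subset[OF Path_continuous[OF assms(1)]]
        continuous_on_subset[OF Path_continuous[OF assms(2)]])
qed

text \<open>Bernstein's theorem, applied to each component of the path rescaled to the unit
  interval. The index is capped by \<open>min k n\<close> so that all terms of the coefficient
  sequence, even those the polynomial ignores, are values of \<open>v\<close> in
  \<open>[t, u]\<close>.\<close>

lemma bernstein_path_approx:
  fixes v :: "real \<Rightarrow> real ^ 'd"
  assumes "t \<le> u" "u \<le> T" "v \<in> Path T t"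
  shows "(\<lambda>n. path_norm t u (\<lambda>r. bernstein_path T t u n (\<lambda>k. v (t + (u - t) * (real (min k n) / real n))) r - v r))
    \<longlonglongrightarrow> 0"
proof (rule LIMSEQ_I)
  fix e :: real assume e: "0 < e"
  \<comment> \<open>The norm is at most the sum of the absolute components, so \<open>e'\<close> per
    component gives \<open>e / 2\<close>, strictly below \<open>e\<close>.\<close>
  define e' where "e' = e / (2 * CARD('d))"
  have e': "0 < e'" using e by (simp add: e'_def)
  have "\<exists>N. \<forall>n x. N \<le> n \<and> x \<in> {0..1} \<longrightarrow>
      \<bar>v (t + (u - t) * x) $ i - (\<Sum>k\<le>n. v (t + (u - t) * (real k / real n)) $ i * Bernstein n k x)\<bar> < e'" for i
  proof (rule Bernstein_Weierstrass[OF _ e'])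
    have "(\<lambda>x. t + (u - t) * x) ` {0..1} \<subseteq> {t..T}"
      using assms(1,2) mult_left_le[of _ "u - t"] by fastforce
    then show "continuous_on {0..1} (\<lambda>x. v (t + (u - t) * x) $ i)"
      by (intro continuous_intros continuous_on_compose2[OF Path_continuous[OF assms(3)]])
  qed
  then have "\<exists>N. \<forall>i n x. N i \<le> n \<and> x \<in> {0..1} \<longrightarrow>
      \<bar>v (t + (u - t) * x) $ i - (\<Sum>k\<le>n. v (t + (u - t) * (real k / real n)) $ i * Bernstein n k x)\<bar> < e'"
    by (intro choice allI)
  then obtain N where N: "\<And>i n x. N i \<le> n \<Longrightarrow> x \<in> {0..1} \<Longrightarrow>
      \<bar>v (t + (u - t) * x) $ i - (\<Sum>k\<le>n. v (t + (u - t) * (real k / real n)) $ i * Bernstein n k x)\<bar> < e'"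
    by blast
  show "\<exists>n0. \<forall>n\<ge>n0. norm (path_norm t u (\<lambda>r. bernstein_path T t u n
      (\<lambda>k. v (t + (u - t) * (real (min k n) / real n))) r - v r) - 0) < e"
  proof (intro exI allI impI)
    fix n assume n: "Max (range N) \<le> n"
    let ?b = "bernstein_path T t u n (\<lambda>k. v (t + (u - t) * (real (min k n) / real n)))"
    have b: "?b \<in> Path T t"
      using assms by (intro bernstein_path_in_Path)
    have "path_norm t u (\<lambda>r. ?b r - v r) \<le> e / 2"
    proof (rule path_norm_le[OF assms(1)])
      fix r assume r: "r \<in> {t..u}"
      let ?x = "(r - t) / (u - t)"
      have "norm (?b r - v r) \<le> (\<Sum>i\<in>UNIV. \<bar>(?b r - v r) $ i\<bar>)"
        by (rule norm_le_l1_cart)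
      also have "\<dots> \<le> (\<Sum>i\<in>(UNIV::'d set). e')"
      proof (rule sum_mono)
        fix i :: 'd
        have "N i \<le> n" using n Max_ge[of "range N" "N i"] by simp
        have "?b r $ i = (\<Sum>k\<le>n. v (t + (u - t) * (real k / real n)) $ i * Bernstein n k ?x)"
          using r assms by (auto simp: bernstein_path_def Path_zero[OF assms(3)] intro!: sum.cong)
        with N[OF \<open>N i \<le> n\<close>, of ?x] unit_rescale[OF r]
        show "\<bar>(?b r - v r) $ i\<bar> \<le> e'"
          by simp
      qed
      also have "\<dots> = e / 2" by (simp add: e'_def)
      finally show "norm (?b r - v r) \<le> e / 2" .
    qed
    moreover have "0 \<le> path_norm t u (\<lambda>r. ?b r - v r)"
      by (rule path_norm_diff_nonneg[OF b assms(3,1,2)])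
    ultimately show "norm (path_norm t u (\<lambda>r. ?b r - v r) - 0) < e"
      using e by simp
  qed
qed

text \<open>Uniformly continuous path functionals are limits of continuous functions of finitely many
  coordinates, obtained by replacing a path by its Bernstein polynomial.\<close>

lemma borel_measurable_path_functional:
  fixes F :: "(real \<Rightarrow> real ^ 'd) \<Rightarrow> real"
  assumes "t \<le> u" "u \<le> T" "modulus \<rho>"
    and F: "\<And>v v'. v \<in> Path T t \<Longrightarrow> v' \<in> Path T t \<Longrightarrow>
      \<bar>F v - F v'\<bar> \<le> \<rho> (path_norm t u (\<lambda>r. v r - v' r))"
  shows "F \<in> borel_measurable (path_filt T t u)"
proof (rule borel_measurable_LIMSEQ_metric)
  let ?c = "\<lambda>n (v :: real \<Rightarrow> real ^ 'd) k. v (t + (u - t) * (real (min k n) / real n))"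
  note bP = bernstein_path_in_Path[OF assms(1,2)]
  note nn = path_norm_diff_nonneg[OF bP bP assms(1,2)]
  fix n
  \<comment> \<open>Coefficients are taken in the product space of all sequences, where convergence
    is coordinatewise; continuity there yields Borel measurability.\<close>
  have "continuous_on UNIV (\<lambda>x. F (bernstein_path T t u n x))"
    unfolding continuous_on_sequentially
  proof (intro allI ballI impI)
    fix x :: "nat \<Rightarrow> nat \<Rightarrow> real ^ 'd" and a
    assume x: "(\<forall>j. x j \<in> UNIV) \<and> x \<longlonglongrightarrow> a"
    have "(\<lambda>j. x j k) \<longlonglongrightarrow> a k" for k
      by (rule continuous_on_tendsto_compose[OF continuous_on_product_coordinates[of k]]) (use x in auto)
    then have *: "(\<lambda>j. \<Sum>k\<le>n. norm (x j k - a k)) \<longlonglongrightarrow> 0"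
      by (intro tendsto_null_sum tendsto_norm_zero) (simp add: LIM_zero)
    have "(\<lambda>j. path_norm t u (\<lambda>r. bernstein_path T t u n (x j) r - bernstein_path T t u n a r)) \<longlonglongrightarrow> 0"
      by (rule real_tendsto_sandwich[OF _ _ tendsto_const *])
        (auto intro!: always_eventually path_norm_bernstein_path_diff[OF assms(1,2)] nn)
    then have "(\<lambda>j. \<rho> (path_norm t u (\<lambda>r. bernstein_path T t u n (x j) r - bernstein_path T t u n a r))) \<longlonglongrightarrow> 0"
      by (rule modulus_tendsto_zero[OF assms(3)]) (auto intro!: always_eventually nn)
    then have "(\<lambda>j. F (bernstein_path T t u n (x j)) - F (bernstein_path T t u n a)) \<longlonglongrightarrow> 0"
      by (rule Lim_null_comparison[rotated]) (auto intro!: always_eventually F bP)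
    then show "((\<lambda>x. F (bernstein_path T t u n x)) \<circ> x) \<longlonglongrightarrow> F (bernstein_path T t u n a)"
      by (simp add: o_def LIM_zero_iff)
  qed
  then have "(\<lambda>x. F (bernstein_path T t u n x)) \<in> borel_measurable borel"
    by (rule borel_measurable_continuous_onI)
  moreover have "?c n \<in> borel_measurable (path_filt T t u)"
  proof (rule measurable_coordinatewise_then_product)
    fix k
    have "0 \<le> (u - t) * (real (min k n) / n)" "(u - t) * (real (min k n) / n) \<le> (u - t) * 1"
      using assms(1) by (auto intro!: mult_nonneg_nonneg mult_left_mono simp: divide_simps)
    then show "(\<lambda>v::real \<Rightarrow> real ^ 'd. v (t + (u - t) * (real (min k n) / n))) \<in> borel_measurable (path_filt T t u)"
      by (intro measurable_path_coord) auto
  qed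
  ultimately show "(\<lambda>v. F (bernstein_path T t u n (?c n v))) \<in> borel_measurable (path_filt T t u)"
    by simp
next
  let ?c = "\<lambda>n (v :: real \<Rightarrow> real ^ 'd) k. v (t + (u - t) * (real (min k n) / real n))"
  fix v :: "real \<Rightarrow> real ^ 'd" assume "v \<in> space (path_filt T t u)"
  then have v: "v \<in> Path T t" by simp
  note bP = bernstein_path_in_Path[OF assms(1,2)]
  have "(\<lambda>n. \<rho> (path_norm t u (\<lambda>r. bernstein_path T t u n (?c n v) r - v r))) \<longlonglongrightarrow> 0"
    by (intro modulus_tendsto_zero[OF assms(3) bernstein_path_approx[OF assms(1,2) v]]
        always_eventually allI path_norm_diff_nonneg[OF bP v assms(1,2)])
  then have "(\<lambda>n. F (bernstein_path T t u n (?c n v)) - F v) \<longlonglongrightarrow> 0"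
    by (rule Lim_null_comparison[rotated]) (auto intro!: always_eventually F bP v)
  then show "(\<lambda>n. F (bernstein_path T t u n (?c n v))) \<longlonglongrightarrow> F v"
    by (simp add: LIM_zero_iff)
qed

text \<open>The grid starts at \<open>t\<close> and is capped at \<open>T\<close>. It is an
  auxiliary device, different from the grid of multiples of \<open>T\<close> behind the finite
  levels of \<open>stop_times\<close>.\<close>

definition dyadic_up :: "real \<Rightarrow> real \<Rightarrow> nat \<Rightarrow> real \<Rightarrow> real" where
  "dyadic_up T t n a = min T (t + \<lceil>2 ^ n * (a - t)\<rceil> / 2 ^ n)"

lemma dyadic_up_bounds:
  assumes "a \<in> {t..T}"
  shows "a \<le> dyadic_up T t n a" "dyadic_up T t n a \<le> a + (1/2) ^ n" "dyadic_up T t n a \<in> {t..T}"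
proof -
  have "a - t \<le> \<lceil>2 ^ n * (a - t)\<rceil> / 2 ^ n"
    using le_of_int_ceiling[of "2 ^ n * (a - t)"] by (simp add: pos_le_divide_eq mult.commute)
  then show *: "a \<le> dyadic_up T t n a"
    using assms by (simp add: dyadic_up_def)
  have "\<lceil>2 ^ n * (a - t)\<rceil> \<le> 2 ^ n * (a - t) + 1" by linarith
  then have "\<lceil>2 ^ n * (a - t)\<rceil> / 2 ^ n \<le> (2 ^ n * (a - t) + 1) / 2 ^ n"
    by (intro divide_right_mono) auto
  also have "\<dots> = a - t + (1/2) ^ n"
    by (simp add: field_simps power_one_over)
  finally show "dyadic_up T t n a \<le> a + (1/2) ^ n"
    by (simp add: dyadic_up_def)
  show "dyadic_up T t n a \<in> {t..T}"
    using * assms by (auto simp: dyadic_up_def)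
qed

lemma dyadic_up_tendsto:
  assumes "a \<in> {t..T}"
  shows "(\<lambda>n. dyadic_up T t n a) \<longlonglongrightarrow> a"
proof (rule real_tendsto_sandwich[where f = "\<lambda>_. a"])
  have "(\<lambda>n. (1/2) ^ n :: real) \<longlonglongrightarrow> 0" by (rule LIMSEQ_power_zero) simp
  then show "(\<lambda>n. a + (1/2) ^ n) \<longlonglongrightarrow> a"
    using tendsto_add[OF tendsto_const, of _ 0 _ a] by simp
qed (use dyadic_up_bounds[OF assms] in auto)

text \<open>A rounded random time has countably many values, so evaluation there is measurable piece
  by piece; continuity in time removes the rounding.\<close>

lemma borel_measurable_eval_random_time:
  fixes H :: "real \<Rightarrow> 'a \<Rightarrow> real"
  assumes H: "\<And>a. a \<in> {t..T} \<Longrightarrow> H a \<in> borel_measurable M"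
    and cont: "\<And>v. v \<in> space M \<Longrightarrow> continuous_on {t..T} (\<lambda>a. H a v)"
    and \<alpha>: "\<alpha> \<in> borel_measurable M" "\<alpha> \<in> space M \<rightarrow> {t..T}"
  shows "(\<lambda>v. H (\<alpha> v) v) \<in> borel_measurable M"
proof (cases "space M = {}")
  case True
  then show ?thesis by (simp add: measurable_def)
next
  case False
  then have "t \<le> T" using \<alpha>(2) by force
  show ?thesis
  proof (rule borel_measurable_LIMSEQ_metric)
    fix n
    \<comment> \<open>The countable composition asks for measurability at every integer, including
      those that would give times before \<open>t\<close>. The extra \<open>max t\<close> repairs
      these and is inactive on the values that occur.\<close>
    have "(\<lambda>v. H (min T (max t (t + \<lceil>2 ^ n * (\<alpha> v - t)\<rceil> / 2 ^ n))) v) \<in> borel_measurable M"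
    proof (rule measurable_compose_countable[where g = "\<lambda>v. \<lceil>2 ^ n * (\<alpha> v - t)\<rceil>"])
      show "H (min T (max t (t + real_of_int i / 2 ^ n))) \<in> borel_measurable M" for i :: int
        using \<open>t \<le> T\<close> by (intro H) auto
    qed (use \<alpha>(1) in measurable)
    moreover have "min T (max t (t + \<lceil>2 ^ n * (\<alpha> v - t)\<rceil> / 2 ^ n)) = dyadic_up T t n (\<alpha> v)" 
      if "v \<in> space M" for v
      using that \<alpha>(2) dyadic_up_bounds[of "\<alpha> v" t T n] by (force simp: dyadic_up_def)
    ultimately show "(\<lambda>v. H (dyadic_up T t n (\<alpha> v)) v) \<in> borel_measurable M"
      by (simp cong: measurable_cong)
  next
    fix v assume v: "v \<in> space M"
    with \<alpha>(2) have a: "\<alpha> v \<in> {t..T}" by auto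
    show "(\<lambda>n. H (dyadic_up T t n (\<alpha> v)) v) \<longlonglongrightarrow> H (\<alpha> v) v"
      by (rule continuous_on_tendsto_compose[OF cont[OF v] dyadic_up_tendsto[OF a] a])
        (use dyadic_up_bounds(3)[OF a] in auto)
  qed
qed

section \<open>Payoffs\<close>

text \<open>One instance of the estimate in \<open>payoff_regularity\<close>, isolated so that it
  can be used for \<open>Psi L U\<close> as well.\<close>

definition regular_process ::
    "real \<Rightarrow> (real \<Rightarrow> real) \<Rightarrow> (real \<Rightarrow> (real \<Rightarrow> real ^ 'd) \<Rightarrow> real) \<Rightarrow> bool" where
  "regular_process T \<rho> X \<longleftrightarrow> (\<forall>t1\<in>{0..T}. \<forall>t2\<in>{0..T}. \<forall>w1\<in>Path T 0. \<forall>w2\<in>Path T 0.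
        \<bar>X t1 w1 - X t2 w2\<bar>
          \<le> \<rho> (\<bar>t1 - t2\<bar> + path_norm 0 T (\<lambda>r. w1 (min r t1) - w2 (min r t2))))"

lemma regular_processD:
  "\<lbrakk>regular_process T \<rho> X; t1 \<in> {0..T}; t2 \<in> {0..T}; w1 \<in> Path T 0; w2 \<in> Path T 0\<rbrakk> \<Longrightarrow>
    \<bar>X t1 w1 - X t2 w2\<bar> \<le> \<rho> (\<bar>t1 - t2\<bar> + path_norm 0 T (\<lambda>r. w1 (min r t1) - w2 (min r t2)))"
  by (simp add: regular_process_def)

lemma continuous_on_stopped_diff:
  assumes "w1 \<in> Path T 0" "w2 \<in> Path T 0" "t1 \<in> {0..T}" "t2 \<in> {0..T}"
  shows "continuous_on {0..T} (\<lambda>r. w1 (min r t1) - w2 (min r t2))"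
  using assms(3,4)
  by (intro continuous_on_diff continuous_on_compose2[OF Path_continuous[OF assms(1)]]
      continuous_on_compose2[OF Path_continuous[OF assms(2)]] continuous_intros) auto

text \<open>Stopping one path at \<open>q\<close> and at \<open>r\<close> changes it by at most its
  oscillation over distance \<open>|q - r|\<close>, which is small by uniform continuity on the
  compact interval.\<close>

lemma regular_process_continuous:
  assumes "modulus \<rho>" "regular_process T \<rho> X" "w \<in> Path T 0"
  shows "continuous_on {0..T} (\<lambda>r. X r w)"
  unfolding continuous_on_def
proof
  fix r assume r: "r \<in> {0..T}"
  let ?n = "\<lambda>q. path_norm 0 T (\<lambda>p. w (min p q) - w (min p r))"
  have nn: "0 \<le> ?n q" if "q \<in> {0..T}" for q
    using r by (intro path_norm_nonneg continuous_on_stopped_diff assms(3) that) auto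
  have ev: "eventually (\<lambda>q. q \<in> {0..T}) (at r within {0..T})"
    by (simp add: eventually_at_filter)
  have "((\<lambda>q. ?n q) \<longlongrightarrow> 0) (at r within {0..T})"
  proof (rule tendstoI)
    fix e :: real assume "0 < e"
    have "uniformly_continuous_on {0..T} w"
      by (rule compact_uniformly_continuous[OF Path_continuous[OF assms(3)]]) simp
    then obtain d where d: "0 < d" "\<And>x x'. x \<in> {0..T} \<Longrightarrow> x' \<in> {0..T} \<Longrightarrow> dist x' x < d \<Longrightarrow> dist (w x') (w x) < e / 2"
      unfolding uniformly_continuous_on_def using \<open>0 < e\<close> half_gt_zero by meson
    have "eventually (\<lambda>q. dist q r < d) (at r within {0..T})"
      using d(1) by (auto simp: eventually_at)
    with ev show "eventually (\<lambda>q. dist (?n q) 0 < e) (at r within {0..T})"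
    proof eventually_elim
      case (elim q)
      have "?n q \<le> e / 2"
      proof (rule path_norm_le)
        fix p assume p: "p \<in> {0..T}"
        have "dist (min p q) (min p r) < d" using elim(2) by (auto simp: dist_real_def min_def split: if_splits)
        with d(2)[of "min p r" "min p q"] p r elim
        show "norm (w (min p q) - w (min p r)) \<le> e / 2"
          by (auto simp: dist_norm intro: less_imp_le)
      qed (use r in auto)
      with nn[OF elim(1)] \<open>0 < e\<close> show ?case by simp
    qed
  qed
  moreover have "((\<lambda>q. \<bar>q - r\<bar>) \<longlongrightarrow> 0) (at r within {0..T})"
    by (intro tendsto_rabs_zero LIM_zero tendsto_ident_at)
  ultimately have "((\<lambda>q. \<bar>q - r\<bar> + ?n q) \<longlongrightarrow> 0) (at r within {0..T})"
    by (rule tendsto_add_zero[rotated])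
  then have "((\<lambda>q. \<rho> (\<bar>q - r\<bar> + ?n q)) \<longlongrightarrow> 0) (at r within {0..T})"
    by (rule modulus_tendsto_zero[OF assms(1)]) (use ev in \<open>eventually_elim, use nn in simp\<close>)
  then have "((\<lambda>q. X q w - X r w) \<longlongrightarrow> 0) (at r within {0..T})"
  proof (rule Lim_null_comparison[rotated])
    from ev show "eventually (\<lambda>q. norm (X q w - X r w) \<le> \<rho> (\<bar>q - r\<bar> + ?n q)) (at r within {0..T})"
      by eventually_elim (use regular_processD[OF assms(2) _ r assms(3,3)] in simp)
  qed
  then show "((\<lambda>q. X q w) \<longlongrightarrow> X r w) (at r within {0..T})"
    by (simp add: LIM_zero_iff)
qed

lemma regular_process_diff:
  assumes "modulus \<rho>" "regular_process T \<rho> X" "w1 \<in> Path T 0" "w2 \<in> Path T 0" "r \<in> {0..T}"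
    and "\<And>q. q \<in> {0..r} \<Longrightarrow> norm (w1 q - w2 q) \<le> c"
  shows "\<bar>X r w1 - X r w2\<bar> \<le> \<rho> c"
proof -
  let ?n = "path_norm 0 T (\<lambda>q. w1 (min q r) - w2 (min q r))"
  have "?n \<le> c"
    using assms(5) by (intro path_norm_le assms(6)) auto
  moreover have "0 \<le> ?n"
    using assms(5) by (intro path_norm_nonneg continuous_on_stopped_diff assms(3,4)) auto
  ultimately have "\<rho> ?n \<le> \<rho> c"
    by (intro modulus_mono[OF assms(1)])
  with regular_processD[OF assms(2,5,5,3,4)] show ?thesis by simp
qed

text \<open>Nonanticipativity is built into the regularity estimate: the stopped paths coincide and
  \<open>\<rho> 0 = 0\<close>.\<close>

lemma regular_process_agree:
  assumes "modulus \<rho>" "regular_process T \<rho> X" "w1 \<in> Path T 0" "w2 \<in> Path T 0" "r \<in> {0..T}"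
    and "\<And>q. q \<in> {0..r} \<Longrightarrow> w1 q = w2 q"
  shows "X r w1 = X r w2"
  using regular_process_diff[OF assms(1-5), of 0] assms(1,6) by (simp add: modulus_def)

lemma regular_process_concat:
  assumes "modulus \<rho>" "regular_process T \<rho> X" "w \<in> Path T 0" "v1 \<in> Path T t" "v2 \<in> Path T t"
    and "t \<in> {0..T}" "r \<in> {t..a}" "a \<le> T"
  shows "\<bar>X r (concat_path T 0 t w v1) - X r (concat_path T 0 t w v2)\<bar>
    \<le> \<rho> (path_norm t a (\<lambda>q. v1 q - v2 q))"
proof (rule regular_process_diff[OF assms(1,2)])
  fix q assume q: "q \<in> {0..r}"
  have c: "continuous_on {t..a} (\<lambda>q. v1 q - v2 q)"
    using assms(8)
    by (intro continuous_on_diff continuous_on_subset[OF Path_continuous[OF assms(4)]]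
        continuous_on_subset[OF Path_continuous[OF assms(5)]]) auto
  show "norm (concat_path T 0 t w v1 q - concat_path T 0 t w v2 q) \<le> path_norm t a (\<lambda>q. v1 q - v2 q)"
    using q assms(6-8) norm_le_path_norm[OF c, of q] path_norm_nonneg[OF c]
    by (auto simp: concat_path_apply)
qed (use assms in \<open>auto intro!: concat_path_in_Path\<close>)

text \<open>From \<open>t\<close> on, the two concatenations differ by the constant
  \<open>w1 t - w2 t\<close>, so only the bases up to \<open>t\<close> enter the bound.\<close>

lemma regular_process_concat_base:
  assumes "modulus \<rho>" "regular_process T \<rho> X" "w1 \<in> Path T 0" "w2 \<in> Path T 0" "v \<in> Path T t"
    and "t \<in> {0..T}" "r \<in> {t..T}"
  shows "\<bar>X r (concat_path T 0 t w1 v) - X r (concat_path T 0 t w2 v)\<bar>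
    \<le> \<rho> (path_norm 0 t (\<lambda>q. w1 q - w2 q))"
proof (rule regular_process_diff[OF assms(1,2)])
  fix q assume q: "q \<in> {0..r}"
  have c: "continuous_on {0..t} (\<lambda>q. w1 q - w2 q)"
    using assms(6)
    by (intro continuous_on_diff continuous_on_subset[OF Path_continuous[OF assms(3)]]
        continuous_on_subset[OF Path_continuous[OF assms(4)]]) auto
  show "norm (concat_path T 0 t w1 v q - concat_path T 0 t w2 v q) \<le> path_norm 0 t (\<lambda>q. w1 q - w2 q)"
    using q assms(6,7) norm_le_path_norm[OF c, of q] norm_le_path_norm[OF c, of t] by (auto simp: concat_path_apply)
qed (use assms in \<open>auto intro!: concat_path_in_Path\<close>)

lemma modulus_cmult:
  assumes "modulus \<rho>" "0 \<le> c"
  shows "modulus (\<lambda>x. c * \<rho> x)"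
  using assms unfolding modulus_def
  by (auto simp: Pi_def mono_on_def intro!: mult_left_mono tendsto_mult_right_zero)

lemma LBINT_continuous:
  fixes f :: "real \<Rightarrow> real"
  assumes "continuous_on {a..b} f"
  shows "(LBINT r:{a..b}. f r) = integral {a..b} f"
  by (rule set_borel_integral_eq_integral(2)[OF borel_integrable_atLeastAtMost'[OF assms]])

section \<open>Pathwise bounds, measurability and integrability of payoffs\<close>

locale payoff_processes =
  fixes T :: real and \<rho> :: "real \<Rightarrow> real" and g L U :: "real \<Rightarrow> (real \<Rightarrow> real ^ 'd) \<Rightarrow> real"
  assumes T_pos: "0 < T" and regularity: "payoff_regularity T \<rho> g L U"
begin

abbreviation conc :: "real \<Rightarrow> (real \<Rightarrow> real ^ 'd) \<Rightarrow> (real \<Rightarrow> real ^ 'd) \<Rightarrow> real \<Rightarrow> real ^ 'd" where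
  "conc \<equiv> concat_path T 0"

lemma modulus: "modulus \<rho>"
  and L_le_U: "\<lbrakk>r \<in> {0..T}; p \<in> Path T 0\<rbrakk> \<Longrightarrow> L r p \<le> U r p"
  and regular_g: "regular_process T \<rho> g"
  and regular_L: "regular_process T \<rho> L"
  and regular_U: "regular_process T \<rho> U"
  using regularity by (simp_all add: payoff_regularity_def regular_process_def)

lemma regular_Psi: "regular_process T \<rho> (Psi L U)"
  unfolding regular_process_def
proof (intro ballI)
  fix t1 t2 and w1 w2 :: "real \<Rightarrow> real ^ 'd"
  assume *: "t1 \<in> {0..T}" "t2 \<in> {0..T}" "w1 \<in> Path T 0" "w2 \<in> Path T 0"
  let ?c = "\<rho> (\<bar>t1 - t2\<bar> + path_norm 0 T (\<lambda>r. w1 (min r t1) - w2 (min r t2)))"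
  show "\<bar>Psi L U t1 w1 - Psi L U t2 w2\<bar> \<le> ?c"
    using regular_processD[OF regular_L *] regular_processD[OF regular_U *]
    unfolding Psi_def by linarith
qed

lemma continuous_g: "p \<in> Path T 0 \<Longrightarrow> 0 \<le> a \<Longrightarrow> b \<le> T \<Longrightarrow> continuous_on {a..b} (\<lambda>r. g r p)"
  and continuous_L: "p \<in> Path T 0 \<Longrightarrow> 0 \<le> a \<Longrightarrow> b \<le> T \<Longrightarrow> continuous_on {a..b} (\<lambda>r. L r p)"
  and continuous_Psi: "p \<in> Path T 0 \<Longrightarrow> 0 \<le> a \<Longrightarrow> b \<le> T \<Longrightarrow> continuous_on {a..b} (\<lambda>r. Psi L U r p)"
  by (rule continuous_on_subset[OF regular_process_continuous[OF modulus]], (rule regular_g regular_L regular_U regular_Psi), simp, force)+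

lemma integrable_g: "p \<in> Path T 0 \<Longrightarrow> 0 \<le> a \<Longrightarrow> b \<le> T \<Longrightarrow> (\<lambda>r. g r p) integrable_on {a..b}"
  and integrable_abs_g: "p \<in> Path T 0 \<Longrightarrow> 0 \<le> a \<Longrightarrow> b \<le> T \<Longrightarrow> (\<lambda>r. \<bar>g r p\<bar>) integrable_on {a..b}"
  by (rule integrable_continuous_interval; intro continuous_intros continuous_g; assumption)+

lemma payoff_alt:
  assumes "w \<in> Path T 0" "v \<in> Path T t" "t \<in> {0..T}" "\<tau> v \<in> {t..T}" "\<gamma> v \<in> {t..T}"
  shows "payoff T g L U t w \<tau> \<gamma> v =
    integral {t..min (\<tau> v) (\<gamma> v)} (\<lambda>r. g r (conc t w v)) +
    (if \<tau> v \<le> \<gamma> v then L (\<tau> v) (conc t w v) else U (\<gamma> v) (conc t w v))"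
proof -
  have "continuous_on {t..min (\<tau> v) (\<gamma> v)} (\<lambda>r. g r (conc t w v))"
    using assms by (intro continuous_g concat_path_in_Path) auto
  then show ?thesis by (simp add: payoff_def LBINT_continuous)
qed

text \<open>The common majorant of the absolute payoffs over all pairs of stopping times, used for
  every domination argument below.\<close>

definition path_bound :: "real \<Rightarrow> (real \<Rightarrow> real ^ 'd) \<Rightarrow> real" where
  "path_bound t p = integral {t..T} (\<lambda>r. \<bar>g r p\<bar>) + (SUP r\<in>{t..T}. Psi L U r p)"

lemma Psi_le_SUP:
  assumes "p \<in> Path T 0" "t \<in> {0..T}" "r \<in> {t..T}"
  shows "Psi L U r p \<le> (SUP r\<in>{t..T}. Psi L U r p)"
proof (rule cSUP_upper[OF assms(3)])
  have "compact ((\<lambda>r. Psi L U r p) ` {t..T})"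
    using assms by (intro compact_continuous_image continuous_Psi) auto
  then show "bdd_above ((\<lambda>r. Psi L U r p) ` {t..T})"
    by (intro bounded_imp_bdd_above compact_imp_bounded)
qed

lemma path_bound_nonneg:
  assumes "p \<in> Path T 0" "t \<in> {0..T}"
  shows "0 \<le> path_bound t p"
proof -
  have "0 \<le> Psi L U t p" by (simp add: Psi_def)
  with Psi_le_SUP[OF assms, of t] have "0 \<le> (SUP r\<in>{t..T}. Psi L U r p)"
    using assms(2) by simp
  then show ?thesis
    using assms unfolding path_bound_def by (intro add_nonneg_nonneg integral_nonneg integrable_abs_g) auto
qed

lemma abs_L_U_le_Psi:
  assumes "p \<in> Path T 0" "r \<in> {0..T}"
  shows "\<bar>L r p\<bar> \<le> Psi L U r p" "\<bar>U r p\<bar> \<le> Psi L U r p"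
  using L_le_U[OF assms(2,1)] by (auto simp: Psi_def)

lemma abs_integral_g_le:
  assumes "p \<in> Path T 0" "0 \<le> t" "a \<in> {t..T}"
  shows "\<bar>integral {t..a} (\<lambda>r. g r p)\<bar> \<le> integral {t..T} (\<lambda>r. \<bar>g r p\<bar>)"
proof -
  have "\<bar>integral {t..a} (\<lambda>r. g r p)\<bar> \<le> integral {t..a} (\<lambda>r. \<bar>g r p\<bar>)"
    using integral_norm_bound_integral[of "\<lambda>r. g r p" "{t..a}" "\<lambda>r. \<bar>g r p\<bar>"]
      integrable_g[of p t a] integrable_abs_g[of p t a] assms by simp
  also have "\<dots> \<le> integral {t..T} (\<lambda>r. \<bar>g r p\<bar>)"
    using assms by (intro integral_subset_le integrable_abs_g) auto
  finally show ?thesis .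
qed

lemma abs_payoff_le:
  assumes "w \<in> Path T 0" "v \<in> Path T t" "t \<in> {0..T}" "\<tau> v \<in> {t..T}" "\<gamma> v \<in> {t..T}"
  shows "\<bar>payoff T g L U t w \<tau> \<gamma> v\<bar> \<le> path_bound t (conc t w v)"
proof -
  let ?p = "conc t w v"
  have p: "?p \<in> Path T 0" using assms by (intro concat_path_in_Path) auto
  have m: "min (\<tau> v) (\<gamma> v) \<in> {t..T}" using assms by auto
  have "\<bar>integral {t..min (\<tau> v) (\<gamma> v)} (\<lambda>r. g r ?p)\<bar> \<le> integral {t..T} (\<lambda>r. \<bar>g r ?p\<bar>)"
    using assms by (intro abs_integral_g_le[OF p _ m]) auto
  moreover have "\<bar>L (\<tau> v) ?p\<bar> \<le> (SUP r\<in>{t..T}. Psi L U r ?p)"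
    using assms by (intro order_trans[OF abs_L_U_le_Psi(1)[OF p] Psi_le_SUP[OF p]]) auto
  moreover have "\<bar>U (\<gamma> v) ?p\<bar> \<le> (SUP r\<in>{t..T}. Psi L U r ?p)"
    using assms by (intro order_trans[OF abs_L_U_le_Psi(2)[OF p] Psi_le_SUP[OF p]]) auto
  ultimately show ?thesis
    unfolding payoff_alt[of w v t \<tau> \<gamma>, OF assms] path_bound_def by auto
qed

lemma abs_SUP_Psi_diff:
  assumes "p \<in> Path T 0" "p' \<in> Path T 0" "t \<in> {0..T}"
    and c: "\<And>r. r \<in> {t..T} \<Longrightarrow> \<bar>Psi L U r p - Psi L U r p'\<bar> \<le> c"
  shows "\<bar>(SUP r\<in>{t..T}. Psi L U r p) - (SUP r\<in>{t..T}. Psi L U r p')\<bar> \<le> c"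
proof -
  have "(SUP r\<in>{t..T}. Psi L U r q) \<le> (SUP r\<in>{t..T}. Psi L U r q') + c"
    if "q \<in> {p, p'}" "q' \<in> {p, p'}" "\<And>r. r \<in> {t..T} \<Longrightarrow> \<bar>Psi L U r q - Psi L U r q'\<bar> \<le> c" for q q'
  proof (rule cSUP_least)
    fix r assume r: "r \<in> {t..T}"
    show "Psi L U r q \<le> (SUP r\<in>{t..T}. Psi L U r q') + c"
      using that(3)[OF r] Psi_le_SUP[OF _ assms(3) r, of q'] that(2) assms(1,2) by auto
  qed (use assms in auto)
  from this[of p p'] this[of p' p] c show ?thesis by (fastforce simp: abs_le_iff abs_minus_commute)
qed

lemma abs_integral_diff_le:
  assumes "f integrable_on {t..a}" "h integrable_on {t..a}" "t \<le> a" 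
    and c: "\<And>r. r \<in> {t..a} \<Longrightarrow> \<bar>f r - h r\<bar> \<le> c"
  shows "\<bar>integral {t..a} f - integral {t..a} h\<bar> \<le> (a - t) * (c::real)"
proof -
  have "norm (integral {t..a} (\<lambda>r. f r - h r)) \<le> integral {t..a} (\<lambda>r. c)"
    by (rule integral_norm_bound_integral) (use assms in \<open>auto intro: integrable_diff\<close>)
  also have "\<dots> = (a - t) * c" using assms(3) by simp
  finally show ?thesis
    using Henstock_Kurzweil_Integration.integral_diff[OF assms(1,2)] by simp
qed

text \<open>In the constant, \<open>T\<close> bounds the length of the integration interval and 1
  accounts for the supremum.\<close>

lemma abs_path_bound_diff:
  assumes "p \<in> Path T 0" "p' \<in> Path T 0" "t \<in> {0..T}"
    and c: "\<And>r. r \<in> {t..T} \<Longrightarrow> \<bar>Psi L U r p - Psi L U r p'\<bar> \<le> c"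
      "\<And>r. r \<in> {t..T} \<Longrightarrow> \<bar>g r p - g r p'\<bar> \<le> c"
  shows "\<bar>path_bound t p - path_bound t p'\<bar> \<le> (T + 1) * c"
proof -
  have "\<bar>integral {t..T} (\<lambda>r. \<bar>g r p\<bar>) - integral {t..T} (\<lambda>r. \<bar>g r p'\<bar>)\<bar> \<le> (T - t) * c"
    using assms(3) c(2)
    by (intro abs_integral_diff_le integrable_abs_g assms(1,2)) (fastforce intro: order_trans[OF abs_triangle_ineq3])+
  also have "\<dots> \<le> T * c"
    using assms(3) order_trans[OF abs_ge_zero c(1)[of t]] by (intro mult_right_mono) auto
  finally show ?thesis
    using abs_SUP_Psi_diff[OF assms(1-3) c(1)] unfolding path_bound_def by (simp add: algebra_simps)
qed

text \<open>The estimate involves the paths only up to \<open>a\<close>, which gives measurability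
  at time \<open>a\<close> and not merely at \<open>T\<close>.\<close>

lemma borel_measurable_integral_g:
  assumes "w \<in> Path T 0" "t \<in> {0..T}" "a \<in> {t..T}"
  shows "(\<lambda>v. integral {t..a} (\<lambda>r. g r (conc t w v))) \<in> borel_measurable (path_filt T t a)"
proof (rule borel_measurable_path_functional[where \<rho> = "\<lambda>x. (a - t) * \<rho> x"])
  show "modulus (\<lambda>x. (a - t) * \<rho> x)" using assms by (intro modulus_cmult modulus) auto
  fix v v' :: "real \<Rightarrow> real ^ 'd" assume v: "v \<in> Path T t" "v' \<in> Path T t"
  show "\<bar>integral {t..a} (\<lambda>r. g r (conc t w v)) - integral {t..a} (\<lambda>r. g r (conc t w v'))\<bar>
      \<le> (a - t) * \<rho> (path_norm t a (\<lambda>r. v r - v' r))"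
  proof (rule abs_integral_diff_le)
    fix r assume r: "r \<in> {t..a}"
    then show "\<bar>g r (conc t w v) - g r (conc t w v')\<bar> \<le> \<rho> (path_norm t a (\<lambda>r. v r - v' r))"
      using assms by (intro regular_process_concat[OF modulus regular_g assms(1) v]) auto
  qed (use v assms in \<open>auto intro!: integrable_g concat_path_in_Path\<close>)
qed (use assms in auto)

lemma borel_measurable_regular_process:
  assumes "regular_process T \<rho> X" "w \<in> Path T 0" "t \<in> {0..T}" "a \<in> {t..T}"
  shows "(\<lambda>v. X a (conc t w v)) \<in> borel_measurable (path_filt T t a)"
  using assms by (intro borel_measurable_path_functional[OF _ _ modulus] regular_process_concat[OF modulus]) auto

lemma borel_measurable_path_bound:
  assumes "w \<in> Path T 0" "t \<in> {0..T}"
  shows "(\<lambda>v. path_bound t (conc t w v)) \<in> borel_measurable (path_filt T t T)"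
proof (rule borel_measurable_path_functional[where \<rho> = "\<lambda>x. (T + 1) * \<rho> x"])
  show "modulus (\<lambda>x. (T + 1) * \<rho> x)" using T_pos by (intro modulus_cmult modulus) auto
  fix v v' :: "real \<Rightarrow> real ^ 'd" assume v: "v \<in> Path T t" "v' \<in> Path T t"
  show "\<bar>path_bound t (conc t w v) - path_bound t (conc t w v')\<bar>
      \<le> (T + 1) * \<rho> (path_norm t T (\<lambda>r. v r - v' r))"
    using v assms by (intro abs_path_bound_diff regular_process_concat[OF modulus] regular_g regular_Psi concat_path_in_Path) auto
qed (use assms in auto)

lemma borel_measurable_payoff:
  assumes "w \<in> Path T 0" "t \<in> {0..T}"
    and \<tau>: "\<tau> \<in> borel_measurable (path_filt T t T)" "\<tau> \<in> Path T t \<rightarrow> {t..T}"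
    and \<gamma>: "\<gamma> \<in> borel_measurable (path_filt T t T)" "\<gamma> \<in> Path T t \<rightarrow> {t..T}"
  shows "payoff T g L U t w \<tau> \<gamma> \<in> borel_measurable (path_filt T t T)"
proof -
  let ?M = "path_filt T t T"
  note [measurable] = \<tau>(1) \<gamma>(1)
  have p: "conc t w v \<in> Path T 0" if "v \<in> Path T t" for v
    using that assms by (intro concat_path_in_Path) auto
  have [measurable]: "(\<lambda>v. integral {t..min (\<tau> v) (\<gamma> v)} (\<lambda>r. g r (conc t w v))) \<in> borel_measurable ?M"
  proof (rule borel_measurable_eval_random_time[of t T "\<lambda>a v. integral {t..a} (\<lambda>r. g r (conc t w v))"])
    show "(\<lambda>v. integral {t..a} (\<lambda>r. g r (conc t w v))) \<in> borel_measurable ?M" if "a \<in> {t..T}" for a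
      using that by (intro measurable_path_filt_mono[OF borel_measurable_integral_g[OF assms(1,2)]]) auto
    show "continuous_on {t..T} (\<lambda>a. integral {t..a} (\<lambda>r. g r (conc t w v)))" if "v \<in> space ?M" for v
      using that assms p by (intro indefinite_integral_continuous_1 integrable_g) auto
    show "(\<lambda>v. min (\<tau> v) (\<gamma> v)) \<in> space ?M \<rightarrow> {t..T}"
      using \<tau>(2) \<gamma>(2) by (fastforce simp: min_def)
  qed measurable
  have [measurable]: "(\<lambda>v. X (\<alpha> v) (conc t w v)) \<in> borel_measurable ?M"
    if "regular_process T \<rho> X" "\<alpha> \<in> borel_measurable ?M" "\<alpha> \<in> Path T t \<rightarrow> {t..T}" for X \<alpha>
  proof (rule borel_measurable_eval_random_time[of t T "\<lambda>a v. X a (conc t w v)"])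
    show "(\<lambda>v. X a (conc t w v)) \<in> borel_measurable ?M" if "a \<in> {t..T}" for a
      using that \<open>regular_process T \<rho> X\<close>
      by (intro measurable_path_filt_mono[OF borel_measurable_regular_process[OF _ assms(1,2)]]) auto
    show "continuous_on {t..T} (\<lambda>a. X a (conc t w v))" if "v \<in> space ?M" for v
      using that assms(2) p
      by (intro continuous_on_subset[OF regular_process_continuous[OF modulus \<open>regular_process T \<rho> X\<close>]]) auto
  qed (use that in auto)
  note [measurable] = this[OF regular_L \<tau>] this[OF regular_U \<gamma>]
  have "(\<lambda>v. integral {t..min (\<tau> v) (\<gamma> v)} (\<lambda>r. g r (conc t w v)) +
    (if \<tau> v \<le> \<gamma> v then L (\<tau> v) (conc t w v) else U (\<gamma> v) (conc t w v))) \<in> borel_measurable ?M"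
    by measurable
  moreover have "payoff T g L U t w \<tau> \<gamma> v = integral {t..min (\<tau> v) (\<gamma> v)} (\<lambda>r. g r (conc t w v)) +
    (if \<tau> v \<le> \<gamma> v then L (\<tau> v) (conc t w v) else U (\<gamma> v) (conc t w v))" if "v \<in> space ?M" for v
    using that \<tau>(2) \<gamma>(2) by (intro payoff_alt[OF assms(1) _ assms(2)]) auto
  ultimately show ?thesis by (subst measurable_cong)
qed

lemma null_path_in_Path: "null_path T \<in> Path T 0"
  using T_pos by (auto simp: null_path_def intro!: PathI continuous_on_eq[OF continuous_on_const])

text \<open>Integrability is assumed along the null path only. Replacing that base by
  \<open>w\<close> changes the bound by at most the deterministic constant \<open>c\<close>, which
  is integrable under a probability.\<close>

lemma integrable_path_bound:
  assumes P: "P \<in> integrable_probs T g L U t" and w: "w \<in> Path T 0" and t: "t \<in> {0..T}"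
  shows "integrable P (\<lambda>v. path_bound t (conc t w v))"
proof -
  have P': "prob_space P" "sets P = sets (path_filt T t T)"
    "(\<integral>\<^sup>+ v. (SUP s\<in>{t..T}. ennreal \<bar>Psi L U s (conc t (null_path T) v)\<bar>) \<partial>P) < \<infinity>"
    "(\<integral>\<^sup>+ v. (\<integral>\<^sup>+ s\<in>{t..T}. ennreal \<bar>g s (conc t (null_path T) v)\<bar> \<partial>lborel) \<partial>P) < \<infinity>"
    using P by (simp_all add: integrable_probs_def path_probs_def cont_integrable_process_def)
  interpret prob_space P by fact
  have sp: "space P = Path T t"
    using sets_eq_imp_space_eq[OF P'(2)] by simp
  note meas = measurable_cong_sets[OF P'(2) refl, of borel]
  let ?p = "\<lambda>v. conc t (null_path T) v"
  have p: "?p v \<in> Path T 0" "conc t w v \<in> Path T 0" if "v \<in> Path T t" for v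
    using that t w null_path_in_Path by (auto intro!: concat_path_in_Path)
  have I: "(\<lambda>v. integral {t..T} (\<lambda>r. \<bar>g r (?p v)\<bar>)) \<in> borel_measurable P \<and>
      (\<lambda>v. SUP r\<in>{t..T}. Psi L U r (?p v)) \<in> borel_measurable P"
  proof -
    note d = regular_process_concat[OF modulus _ null_path_in_Path]
    have "(\<lambda>v. integral {t..T} (\<lambda>r. \<bar>g r (?p v)\<bar>)) \<in> borel_measurable (path_filt T t T)"
    proof (rule borel_measurable_path_functional[where \<rho> = "\<lambda>x. (T - t) * \<rho> x"])
      show "modulus (\<lambda>x. (T - t) * \<rho> x)" using t by (intro modulus_cmult modulus) auto
    next
      fix v v' :: "real \<Rightarrow> real ^ 'd" assume v: "v \<in> Path T t" "v' \<in> Path T t"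
      show "\<bar>integral {t..T} (\<lambda>r. \<bar>g r (?p v)\<bar>) - integral {t..T} (\<lambda>r. \<bar>g r (?p v')\<bar>)\<bar>
          \<le> (T - t) * \<rho> (path_norm t T (\<lambda>r. v r - v' r))"
        using t p v by (intro abs_integral_diff_le integrable_abs_g order_trans[OF abs_triangle_ineq3 d[OF regular_g v]]) auto
    qed (use t in auto)
    moreover have "(\<lambda>v. SUP r\<in>{t..T}. Psi L U r (?p v)) \<in> borel_measurable (path_filt T t T)"
      by (rule borel_measurable_path_functional[OF _ _ modulus])
        (use t p in \<open>auto intro!: abs_SUP_Psi_diff d[OF regular_Psi]\<close>)
    ultimately show ?thesis by (simp add: meas)
  qed
  have "integrable P (\<lambda>v. integral {t..T} (\<lambda>r. \<bar>g r (?p v)\<bar>))"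
  proof (rule integrableI_nonneg)
    have "(\<integral>\<^sup>+ s\<in>{t..T}. ennreal \<bar>g s (?p v)\<bar> \<partial>lborel) = ennreal (integral {t..T} (\<lambda>r. \<bar>g r (?p v)\<bar>))"
      if "v \<in> space P" for v
    proof -
      have c: "continuous_on {t..T} (\<lambda>r. \<bar>g r (?p v)\<bar>)"
        using that t p sp by (intro continuous_intros continuous_g) auto
      have "(\<integral>\<^sup>+ s\<in>{t..T}. ennreal \<bar>g s (?p v)\<bar> \<partial>lborel)
          = (\<integral>\<^sup>+ s. ennreal (indicator {t..T} s * \<bar>g s (?p v)\<bar>) \<partial>lborel)"
        by (intro nn_integral_cong) (auto split: split_indicator)
      also have "\<dots> = ennreal (LBINT s:{t..T}. \<bar>g s (?p v)\<bar>)"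
        using borel_integrable_atLeastAtMost'[OF c]
        unfolding set_integrable_def set_lebesgue_integral_def
        by (subst nn_integral_eq_integral) auto
      finally show ?thesis by (simp add: LBINT_continuous[OF c])
    qed
    then show "(\<integral>\<^sup>+ v. ennreal (integral {t..T} (\<lambda>r. \<bar>g r (?p v)\<bar>)) \<partial>P) < \<infinity>"
      using P'(4) by (simp cong: nn_integral_cong)
  qed (use I p t sp in \<open>auto intro!: integral_nonneg integrable_abs_g\<close>)
  moreover have "integrable P (\<lambda>v. SUP r\<in>{t..T}. Psi L U r (?p v))"
  proof (rule integrableI_nonneg)
    have "ennreal (SUP r\<in>{t..T}. Psi L U r (?p v)) \<le> (SUP s\<in>{t..T}. ennreal \<bar>Psi L U s (?p v)\<bar>)"
      if "v \<in> space P" for v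
    proof -
      \<comment> \<open>The hypothesis has the supremum in \<open>ennreal\<close>, the bound has it
        in \<open>real\<close>; an attained maximum compares the two.\<close>
      have "\<exists>r\<in>{t..T}. \<forall>q\<in>{t..T}. Psi L U q (?p v) \<le> Psi L U r (?p v)"
        using that t sp by (intro continuous_attains_sup continuous_Psi p) auto
      then obtain r where r: "r \<in> {t..T}" "\<And>q. q \<in> {t..T} \<Longrightarrow> Psi L U q (?p v) \<le> Psi L U r (?p v)"
        by blast
      have "(SUP r\<in>{t..T}. Psi L U r (?p v)) \<le> \<bar>Psi L U r (?p v)\<bar>"
        using r t by (intro cSUP_least) (auto intro: order_trans[OF _ abs_ge_self])
      then show ?thesis
        by (intro order_trans[OF _ SUP_upper[OF r(1)]] ennreal_leI)
    qed
    then show "(\<integral>\<^sup>+ v. ennreal (SUP r\<in>{t..T}. Psi L U r (?p v)) \<partial>P) < \<infinity>"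
      by (rule le_less_trans[OF nn_integral_mono P'(3)])
    have "0 \<le> (SUP r\<in>{t..T}. Psi L U r (?p v))" if "v \<in> space P" for v
      using Psi_le_SUP[OF p(1) t, of v t] that t sp by (auto simp: Psi_def)
    then show "AE v in P. 0 \<le> (SUP r\<in>{t..T}. Psi L U r (?p v))" by simp
  qed (use I in auto)
  ultimately have 1: "integrable P (\<lambda>v. path_bound t (?p v))"
    unfolding path_bound_def by (rule Bochner_Integration.integrable_add)
  define c where "c = (T + 1) * \<rho> (path_norm 0 t (\<lambda>q. w q - null_path T q))"
  have b: "\<bar>path_bound t (conc t w v) - path_bound t (?p v)\<bar> \<le> c" if "v \<in> Path T t" for v
    unfolding c_def using that t
    by (intro abs_path_bound_diff p regular_process_concat_base[OF modulus] regular_g regular_Psi w null_path_in_Path) auto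
  show ?thesis
  proof (rule Bochner_Integration.integrable_bound)
    show "integrable P (\<lambda>v. path_bound t (?p v) + c)"
      using 1 by simp
    show "(\<lambda>v. path_bound t (conc t w v)) \<in> borel_measurable P"
      using borel_measurable_path_bound[OF w t] by (simp add: meas)
    have "norm (path_bound t (conc t w v)) \<le> norm (path_bound t (?p v) + c)" if v: "v \<in> space P" for v
    proof -
      have "0 \<le> path_bound t (?p v)" "0 \<le> path_bound t (conc t w v)"
        using v sp t by (auto intro!: path_bound_nonneg p)
      with b[of v] v sp show ?thesis by auto
    qed
    then show "AE v in P. norm (path_bound t (conc t w v)) \<le> norm (path_bound t (?p v) + c)"
      by simp
  qed
qed

end

section \<open>Stopping times and values\<close>

lemma filtration_path_filt: "filtration (Path T t) (path_filt T t)"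
  by unfold_locales (auto dest: subsetD[OF sets_path_filt_mono])

lemma stop_timesD:
  assumes "\<tau> \<in> stop_times T t \<infinity>"
  shows "stopping_time (path_filt T t) \<tau>" "\<tau> \<in> Path T t \<rightarrow> {t..T}" 
    "v \<in> Path T t \<Longrightarrow> \<tau> v \<in> {t..T}"
  using assms by (auto simp: stop_times_def)

lemma stop_times_sets_le:
  assumes "\<tau> \<in> stop_times T t \<infinity>"
  shows "{v \<in> Path T t. \<tau> v \<le> u} \<in> sets (path_filt T t u)"
  using stopping_timeD[OF stop_timesD(1)[OF assms], of u] by (simp add: pred_def)

lemma stop_times_sets_less:
  assumes "\<tau> \<in> stop_times T t \<infinity>"
  shows "{v \<in> Path T t. \<tau> v < u} \<in> sets (path_filt T t u)"
  using filtration.stopping_time_less_const[OF filtration_path_filt stop_timesD(1)[OF assms]]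
  by (simp add: pred_def)

lemma stop_timesI:
  assumes "t \<le> T" "\<tau> \<in> Path T t \<rightarrow> {t..T}"
    and "\<And>u. u \<in> {t..T} \<Longrightarrow> {v \<in> Path T t. \<tau> v \<le> u} \<in> sets (path_filt T t u)"
  shows "\<tau> \<in> stop_times T t \<infinity>"
proof -
  have "{v \<in> Path T t. \<tau> v \<le> u} \<in> sets (path_filt T t u)" for u
  proof -
    consider "u < t" | "u \<in> {t..T}" | "T < u" using assms(1) by fastforce
    then show ?thesis
    proof cases
      case 1
      then have "{v \<in> Path T t. \<tau> v \<le> u} = {}" using funcset_mem[OF assms(2)] by force
      then show ?thesis by (simp only: sets.empty_sets)
    next
      case 2 then show ?thesis by (rule assms(3))
    next
      case 3
      then have "{v \<in> Path T t. \<tau> v \<le> u} = space (path_filt T t u)"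
        using funcset_mem[OF assms(2)] by force
      then show ?thesis by (simp only: sets.top)
    qed
  qed
  then show ?thesis
    using assms(2) by (auto simp: stop_times_def pred_def intro!: stopping_timeI)
qed

lemma borel_measurable_stop_time:
  assumes "\<tau> \<in> stop_times T t \<infinity>"
  shows "\<tau> \<in> borel_measurable (path_filt T t T)"
proof (rule borel_measurableI_le)
  fix y
  have "{v \<in> Path T t. \<tau> v \<le> y} = {v \<in> Path T t. \<tau> v \<le> min y T}"
    using stop_timesD(2)[OF assms] by fastforce
  then show "{v \<in> space (path_filt T t T). \<tau> v \<le> y} \<in> sets (path_filt T t T)"
    using stop_times_sets_le[OF assms, of "min y T"] sets_path_filt_mono[of "min y T" T T t] by auto
qed

lemma stop_times_const: "c \<in> {t..T} \<Longrightarrow> (\<lambda>_. c) \<in> stop_times T t \<infinity>"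
  by (auto simp: stop_times_def intro!: stopping_timeI)

lemma stop_times_shift:
  assumes "\<sigma> \<in> stop_times T s \<infinity>" "t \<le> s" "s \<le> T"
  shows "(\<lambda>v. \<sigma> (shift_path T s v)) \<in> stop_times T t \<infinity>"
proof (rule stop_timesI)
  show *: "(\<lambda>v. \<sigma> (shift_path T s v)) \<in> Path T t \<rightarrow> {t..T}"
    using stop_timesD(3)[OF assms(1) shift_path_in_Path] assms(2,3) by fastforce
  fix u assume u: "u \<in> {t..T}"
  show "{v \<in> Path T t. \<sigma> (shift_path T s v) \<le> u} \<in> sets (path_filt T t u)"
  proof (cases "u < s")
    case True
    then have "{v \<in> Path T t. \<sigma> (shift_path T s v) \<le> u} = {}"
      using stop_timesD(3)[OF assms(1) shift_path_in_Path] assms(2,3) by fastforce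
    then show ?thesis by (simp only: sets.empty_sets)
  next
    case False
    have "shift_path T s -` {v \<in> Path T s. \<sigma> v \<le> u} \<inter> space (path_filt T t u) \<in> sets (path_filt T t u)"
      using False u assms by (intro measurable_sets[OF measurable_shift_path stop_times_sets_le]) auto
    also have "shift_path T s -` {v \<in> Path T s. \<sigma> v \<le> u} \<inter> space (path_filt T t u)
        = {v \<in> Path T t. \<sigma> (shift_path T s v) \<le> u}"
      using shift_path_in_Path[OF _ assms(2,3)] by auto
    finally show ?thesis .
  qed
qed (use assms in auto)

lemma stop_times_max:
  assumes "\<gamma> \<in> stop_times T t \<infinity>" "t \<le> s" "s \<le> T"
  shows "(\<lambda>v. max s (\<gamma> v)) \<in> stop_times T t \<infinity>"
proof (rule stop_timesI)
  show "(\<lambda>v. max s (\<gamma> v)) \<in> Path T t \<rightarrow> {t..T}"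
    using stop_timesD(2)[OF assms(1)] assms(2,3) by fastforce
  fix u show "{v \<in> Path T t. max s (\<gamma> v) \<le> u} \<in> sets (path_filt T t u)"
    using stop_times_sets_le[OF assms(1), of u] by (cases "s \<le> u") simp_all
qed (use assms in auto)

text \<open>This is \<open>\<gamma>\<close> as a strategy of the game restarted at \<open>s\<close>
  after the path \<open>v\<close>. If \<open>\<gamma>\<close> has already stopped before
  \<open>s\<close>, the value is lifted to \<open>s\<close>; such paths are excluded when the
  payoffs are compared.\<close>

lemma stop_times_concat:
  assumes "\<gamma> \<in> stop_times T t \<infinity>" "v \<in> Path T t" "t \<le> s" "s \<le> T"
  shows "(\<lambda>v'. max s (\<gamma> (concat_path T t s v v'))) \<in> stop_times T s \<infinity>"
proof (rule stop_timesI)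
  show "(\<lambda>v'. max s (\<gamma> (concat_path T t s v v'))) \<in> Path T s \<rightarrow> {s..T}"
    using stop_timesD(3)[OF assms(1) concat_path_in_Path[OF assms(2)]] assms(3,4) by fastforce
  fix u assume u: "u \<in> {s..T}"
  have "concat_path T t s v -` {v \<in> Path T t. \<gamma> v \<le> u} \<inter> space (path_filt T s u) \<in> sets (path_filt T s u)"
    using u assms by (intro measurable_sets[OF measurable_concat_path stop_times_sets_le]) auto
  also have "concat_path T t s v -` {v \<in> Path T t. \<gamma> v \<le> u} \<inter> space (path_filt T s u)
      = {v' \<in> Path T s. max s (\<gamma> (concat_path T t s v v')) \<le> u}"
    using concat_path_in_Path[OF assms(2) _ assms(3,4)] u by auto
  finally show "{v' \<in> Path T s. max s (\<gamma> (concat_path T t s v v')) \<le> u} \<in> sets (path_filt T s u)" .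
qed (use assms in auto)

text \<open>Membership in \<open>C\<close> is known only at time \<open>s\<close>. Before
  \<open>s\<close> the spliced time can have stopped only through \<open>\<tau>\<close>, since early
  values of \<open>\<tau>\<close> force \<open>v\<close> into \<open>C\<close> and
  \<open>\<tau>'\<close> waits until \<open>s\<close>; from \<open>s\<close> on, \<open>C\<close>
  may be consulted.\<close>

lemma stop_times_if:
  assumes "\<tau> \<in> stop_times T t \<infinity>" "\<tau>' \<in> stop_times T t \<infinity>" "C \<in> sets (path_filt T t s)" "t \<le> s" "s \<le> T"
    and C: "\<And>v. v \<in> Path T t \<Longrightarrow> \<tau> v < s \<Longrightarrow> v \<in> C" and ge: "\<And>v. v \<in> Path T t \<Longrightarrow> s \<le> \<tau>' v"
  shows "(\<lambda>v. if v \<in> C then \<tau> v else \<tau>' v) \<in> stop_times T t \<infinity>"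
proof (rule stop_timesI)
  show "(\<lambda>v. if v \<in> C then \<tau> v else \<tau>' v) \<in> Path T t \<rightarrow> {t..T}"
    using stop_timesD(2)[OF assms(1)] stop_timesD(2)[OF assms(2)] by fastforce
  fix u
  show "{v \<in> Path T t. (if v \<in> C then \<tau> v else \<tau>' v) \<le> u} \<in> sets (path_filt T t u)"
  proof (cases "u < s")
    case True
    have "(if v \<in> C then \<tau> v else \<tau>' v) \<le> u \<longleftrightarrow> \<tau> v \<le> u" if "v \<in> Path T t" for v
      using C[OF that] ge[OF that] True by auto
    then have "{v \<in> Path T t. (if v \<in> C then \<tau> v else \<tau>' v) \<le> u} = {v \<in> Path T t. \<tau> v \<le> u}"
      by (intro Collect_cong conj_cong refl)
    then show ?thesis using stop_times_sets_le[OF assms(1)] by simp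
  next
    case False
    have [measurable]: "C \<in> sets (path_filt T t u)"
      using assms(3) sets_path_filt_mono[of s u] False by auto
    have "C \<inter> {v \<in> Path T t. \<tau> v \<le> u} \<union> ({v \<in> Path T t. \<tau>' v \<le> u} - C) \<in> sets (path_filt T t u)"
      using stop_times_sets_le[OF assms(1), of u] stop_times_sets_le[OF assms(2), of u] by simp
    also have "C \<inter> {v \<in> Path T t. \<tau> v \<le> u} \<union> ({v \<in> Path T t. \<tau>' v \<le> u} - C)
        = {v \<in> Path T t. (if v \<in> C then \<tau> v else \<tau>' v) \<le> u}"
      by auto
    finally show ?thesis .
  qed
qed (use assms in auto)

lemma integrable_probsD:
  assumes "P \<in> integrable_probs T g L U t"
  shows "prob_space P" "sets P = sets (path_filt T t T)" "space P = Path T t"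
  using assms sets_eq_imp_space_eq[of P "path_filt T t T"]
  by (auto simp: integrable_probs_def path_probs_def)

context payoff_processes
begin

abbreviation cost ::
  "real \<Rightarrow> (real \<Rightarrow> real ^ 'd) \<Rightarrow> (real \<Rightarrow> real ^ 'd) measure \<Rightarrow> ((real \<Rightarrow> real ^ 'd) \<Rightarrow> real) \<Rightarrow>
    ((real \<Rightarrow> real ^ 'd) \<Rightarrow> real) \<Rightarrow> real" where
  "cost t w P \<tau> \<gamma> \<equiv> \<integral>v. payoff T g L U t w \<tau> \<gamma> v \<partial>P"

lemma abs_payoff_le_stop:
  assumes "w \<in> Path T 0" "v \<in> Path T t" "t \<in> {0..T}"
    "\<tau> \<in> stop_times T t \<infinity>" "\<gamma> \<in> stop_times T t \<infinity>"
  shows "\<bar>payoff T g L U t w \<tau> \<gamma> v\<bar> \<le> path_bound t (conc t w v)"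
  by (intro abs_payoff_le assms stop_timesD(3)[OF assms(4)] stop_timesD(3)[OF assms(5)])

lemma integrable_payoff:
  assumes "P \<in> integrable_probs T g L U t" "w \<in> Path T 0" "t \<in> {0..T}"
    "\<tau> \<in> stop_times T t \<infinity>" "\<gamma> \<in> stop_times T t \<infinity>"
  shows "integrable P (payoff T g L U t w \<tau> \<gamma>)"
proof (rule Bochner_Integration.integrable_bound[OF integrable_path_bound[OF assms(1-3)]])
  have "payoff T g L U t w \<tau> \<gamma> \<in> borel_measurable (path_filt T t T)"
    by (intro borel_measurable_payoff assms borel_measurable_stop_time stop_timesD)
  then show "payoff T g L U t w \<tau> \<gamma> \<in> borel_measurable P"
    using measurable_cong_sets[OF integrable_probsD(2)[OF assms(1)] refl] by blast
  show "AE v in P. norm (payoff T g L U t w \<tau> \<gamma> v) \<le> norm (path_bound t (conc t w v))"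
  proof (rule AE_I2)
    fix v assume "v \<in> space P"
    then have v: "v \<in> Path T t" using integrable_probsD(3)[OF assms(1)] by simp
    show "norm (payoff T g L U t w \<tau> \<gamma> v) \<le> norm (path_bound t (conc t w v))"
      using abs_payoff_le_stop[OF assms(2) v assms(3-5)]
      by (simp add: order_trans[OF _ abs_ge_self])
  qed
qed

lemma bdd_above_cost:
  assumes "P \<in> integrable_probs T g L U t" "w \<in> Path T 0" "t \<in> {0..T}" "\<gamma> \<in> stop_times T t \<infinity>"
  shows "bdd_above ((\<lambda>\<tau>. cost t w P \<tau> \<gamma>) ` stop_times T t \<infinity>)"
proof (rule bdd_aboveI2)
  fix \<tau> :: "(real \<Rightarrow> real ^ 'd) \<Rightarrow> real" assume \<tau>: "\<tau> \<in> stop_times T t \<infinity>"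
  show "cost t w P \<tau> \<gamma> \<le> (\<integral>v. path_bound t (conc t w v) \<partial>P)"
  proof (rule integral_mono[OF integrable_payoff[OF assms(1-3) \<tau> assms(4)] integrable_path_bound[OF assms(1-3)]])
    fix v assume "v \<in> space P"
    then have v: "v \<in> Path T t" using integrable_probsD(3)[OF assms(1)] by simp
    show "payoff T g L U t w \<tau> \<gamma> v \<le> path_bound t (conc t w v)"
      using abs_payoff_le_stop[OF assms(2) v assms(3) \<tau> assms(4)] by simp
  qed
qed

text \<open>Ties are paid by \<open>L\<close>, so stopping at once yields a deterministic amount
  against every opponent. This is the uniform lower bound that keeps the real infima
  meaningful.\<close>

lemma payoff_stop_at_start:
  assumes "w \<in> Path T 0" "v \<in> Path T t" "t \<in> {0..T}" "\<gamma> \<in> stop_times T t \<infinity>"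
  shows "payoff T g L U t w (\<lambda>_. t) \<gamma> v = L t w"
proof -
  have "L t (conc t w v) = L t w"
    using assms
    by (intro regular_process_agree[OF modulus regular_L] concat_path_in_Path concat_path_before) auto
  then show ?thesis
    using payoff_alt[OF assms(1,2,3), of "\<lambda>_. t" \<gamma>] stop_timesD(3)[OF assms(4,2)] assms(3) by simp
qed

lemma L_le_SUP_cost:
  assumes "P \<in> integrable_probs T g L U t" "w \<in> Path T 0" "t \<in> {0..T}" "\<gamma> \<in> stop_times T t \<infinity>"
  shows "L t w \<le> (SUP \<tau>\<in>stop_times T t \<infinity>. cost t w P \<tau> \<gamma>)"
proof (rule cSUP_upper2[OF bdd_above_cost[OF assms]])
  interpret prob_space P by (rule integrable_probsD[OF assms(1)])
  show "(\<lambda>_. t) \<in> stop_times T t \<infinity>" using assms(3) by (intro stop_times_const) auto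
  have "cost t w P (\<lambda>_. t) \<gamma> = (\<integral>v. L t w \<partial>P)"
    using payoff_stop_at_start[OF assms(2) _ assms(3,4)] integrable_probsD(3)[OF assms(1)]
    by (intro Bochner_Integration.integral_cong) auto
  then show "L t w \<le> cost t w P (\<lambda>_. t) \<gamma>" by (simp add: prob_space)
qed

end

section \<open>The value as an infimum over laws and opposing strategies\<close>

locale control_problem = payoff_processes T \<rho> g L U
  for T :: real and \<rho> :: "real \<Rightarrow> real" and g L U :: "real \<Rightarrow> (real \<Rightarrow> real ^ 'd) \<Rightarrow> real" +
  fixes \<P> :: "real \<Rightarrow> (real \<Rightarrow> real ^ 'd) \<Rightarrow> (real \<Rightarrow> real ^ 'd) measure set"
  assumes adapted: "adaptedness T g L U \<P>"
begin

abbreviation V :: "real \<Rightarrow> (real \<Rightarrow> real ^ 'd) \<Rightarrow> real" where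
  "V \<equiv> val T g L U \<P> \<infinity>"

lemma \<P>_nonempty: "\<lbrakk>t \<in> {0..T}; w \<in> Path T 0\<rbrakk> \<Longrightarrow> \<P> t w \<noteq> {}"
  and \<P>_integrable: "\<lbrakk>t \<in> {0..T}; w \<in> Path T 0; P \<in> \<P> t w\<rbrakk> \<Longrightarrow> P \<in> integrable_probs T g L U t"
  using adapted unfolding adaptedness_def by blast+

lemma \<P>_agree:
  assumes "t \<in> {0..T}" "w1 \<in> Path T 0" "w2 \<in> Path T 0" "\<And>r. r \<in> {0..t} \<Longrightarrow> w1 r = w2 r"
  shows "\<P> t w1 = \<P> t w2"
  using adapted assms unfolding adaptedness_def by blast

lemma stop_times_nonempty: "t \<le> T \<Longrightarrow> stop_times T t \<infinity> \<noteq> {}"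
  using stop_times_const[of t t T] by fastforce

text \<open>In \<open>real\<close> an infimum is informative only for sets bounded below; the common
  bound \<open>c\<close> secures this at both levels.\<close>

lemma INF_INF_mono:
  assumes "t \<in> {0..T}" "w \<in> Path T 0"
    and "\<And>P \<gamma>. P \<in> \<P> t w \<Longrightarrow> \<gamma> \<in> stop_times T t \<infinity> \<Longrightarrow> c \<le> A P \<gamma>"
    and "\<And>P \<gamma>. P \<in> \<P> t w \<Longrightarrow> \<gamma> \<in> stop_times T t \<infinity> \<Longrightarrow> A P \<gamma> \<le> B P \<gamma>"
  shows "(INF P\<in>\<P> t w. INF \<gamma>\<in>stop_times T t \<infinity>. A P \<gamma>) \<le> (INF P\<in>\<P> t w. INF \<gamma>\<in>stop_times T t \<infinity>. (B P \<gamma> :: real))"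
proof -
  note ne = \<P>_nonempty[OF assms(1,2)] stop_times_nonempty[of t] 
  have t: "t \<le> T" using assms(1) by simp
  show ?thesis
  proof (rule cINF_mono[OF ne(1)])
    show "bdd_below ((\<lambda>P. INF \<gamma>\<in>stop_times T t \<infinity>. A P \<gamma>) ` \<P> t w)"
      using assms(3) by (intro bdd_belowI2[where m = c] cINF_greatest ne(2) t)
    fix P assume P: "P \<in> \<P> t w"
    have "(INF \<gamma>\<in>stop_times T t \<infinity>. A P \<gamma>) \<le> (INF \<gamma>\<in>stop_times T t \<infinity>. B P \<gamma>)"
    proof (rule cINF_mono[OF ne(2)[OF t]])
      show "bdd_below (A P ` stop_times T t \<infinity>)"
        using assms(3) P by (intro bdd_belowI2[where m = c])
    qed (use assms(4) P in blast)
    then show "\<exists>P'\<in>\<P> t w. (INF \<gamma>\<in>stop_times T t \<infinity>. A P' \<gamma>) \<le> (INF \<gamma>\<in>stop_times T t \<infinity>. B P \<gamma>)"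
      using P by blast
  qed
qed

lemma INF_INF_const:
  assumes "t \<in> {0..T}" "w \<in> Path T 0"
  shows "(INF P\<in>\<P> t w. INF \<gamma>\<in>stop_times T t \<infinity>. c) = (c :: real)"
  using \<P>_nonempty[OF assms] assms(1) by (simp add: stop_times_nonempty)

lemma V_le_SUP_cost:
  assumes "t \<in> {0..T}" "w \<in> Path T 0" "P \<in> \<P> t w" "\<gamma> \<in> stop_times T t \<infinity>"
  shows "V t w \<le> (SUP \<tau>\<in>stop_times T t \<infinity>. cost t w P \<tau> \<gamma>)"
proof -
  have t: "t \<le> T" using assms(1) by simp
  have low: "L t w \<le> (SUP \<tau>\<in>stop_times T t \<infinity>. cost t w P \<tau> \<gamma>)" 
    if "P \<in> \<P> t w" "\<gamma> \<in> stop_times T t \<infinity>" for P \<gamma>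
    using that assms by (intro L_le_SUP_cost \<P>_integrable)
  have "V t w \<le> (INF \<gamma>\<in>stop_times T t \<infinity>. SUP \<tau>\<in>stop_times T t \<infinity>. cost t w P \<tau> \<gamma>)"
    unfolding val_def
    by (intro cINF_lower[OF _ assms(3)] bdd_belowI2[where m = "L t w"] cINF_greatest stop_times_nonempty low t)
  also have "\<dots> \<le> (SUP \<tau>\<in>stop_times T t \<infinity>. cost t w P \<tau> \<gamma>)"
    by (intro cINF_lower[OF _ assms(4)] bdd_belowI2[where m = "L t w"] low assms(3))
  finally show ?thesis .
qed

lemma L_le_V:
  assumes "t \<in> {0..T}" "w \<in> Path T 0"
  shows "L t w \<le> V t w"
  using assms unfolding val_def
  by (intro cINF_greatest \<P>_nonempty stop_times_nonempty L_le_SUP_cost \<P>_integrable) auto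

lemma V_agree:
  assumes "t \<in> {0..T}" "w1 \<in> Path T 0" "w2 \<in> Path T 0" "\<And>r. r \<in> {0..t} \<Longrightarrow> w1 r = w2 r"
  shows "V t w1 = V t w2"
proof -
  have "conc t w1 = conc t w2"
    using assms by (intro ext concat_path_cong_left) auto
  moreover have "\<P> t w1 = \<P> t w2"
    by (rule \<P>_agree[OF assms])
  ultimately show ?thesis by (simp only: val_def payoff_def)
qed

end

section \<open>A countable dense family of stopping times\<close>

text \<open>The sets that can be approximated in symmetric difference are closed under complements
  and countable unions.\<close>

lemma (in finite_measure) approx_by_algebra:
  assumes "algebra (space M) \<A>" "\<A> \<subseteq> sets M" "C \<in> sigma_sets (space M) \<A>" "0 < e"
  shows "\<exists>D\<in>\<A>. measure M ((C - D) \<union> (D - C)) < e"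
  using assms(3,4)
proof (induction arbitrary: e rule: sigma_sets.induct)
  case (Basic a)
  then show ?case by (intro bexI[of _ a]) auto
next
  case Empty
  interpret algebra "space M" \<A> by fact
  show ?case using Empty by (intro bexI[of _ "{}"]) auto
next
  case (Compl a)
  interpret A: algebra "space M" \<A> by fact
  obtain D where D: "D \<in> \<A>" "measure M ((a - D) \<union> (D - a)) < e"
    using Compl by blast
  have "a \<subseteq> space M"
    using Compl(1) sigma_sets_into_sp[OF A.space_closed] by blast
  then have "(space M - a - (space M - D)) \<union> ((space M - D) - (space M - a)) = (a - D) \<union> (D - a)"
    using A.sets_into_space[OF D(1)] by blast
  with D show ?case by (intro bexI[of _ "space M - D"]) auto
next
  case (Union a)
  interpret A: algebra "space M" \<A> by fact
  have a [measurable]: "a i \<in> sets M" for i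
    using Union(1)[of i] sets.sigma_sets_subset[OF assms(2)] by blast
  let ?b = "\<lambda>n. \<Union>i<n. a i"
  have "(\<lambda>n. measure M (?b n)) \<longlonglongrightarrow> measure M (\<Union>n. ?b n)"
    by (rule finite_Lim_measure_incseq) (auto simp: lessThan_Suc intro!: incseq_SucI)
  moreover have "(\<Union>n. ?b n) = (\<Union>i. a i)" by auto
  ultimately have "(\<lambda>n. measure M (?b n)) \<longlonglongrightarrow> measure M (\<Union>i. a i)" by simp
  then have "eventually (\<lambda>n. measure M (\<Union>i. a i) - e / 2 < measure M (?b n)) sequentially"
    using \<open>0 < e\<close> by (intro order_tendstoD(1)) auto
  then obtain n where n: "measure M (\<Union>i. a i) - e / 2 < measure M (?b n)"
    by (auto simp: eventually_sequentially)
  \<comment> \<open>Cutting the union after \<open>n\<close> sets costs \<open>e / 2\<close>. The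
    \<open>n\<close> approximations share the other half; the \<open>+ 1\<close> keeps the quotient
    defined when \<open>n = 0\<close>.\<close>
  have "\<exists>D\<in>\<A>. measure M ((a i - D) \<union> (D - a i)) < e / (2 * (real n + 1))" for i
    using \<open>0 < e\<close> by (intro Union(2)) auto
  then obtain D where D: "\<And>i. D i \<in> \<A>" "\<And>i. measure M ((a i - D i) \<union> (D i - a i)) < e / (2 * (real n + 1))"
    by metis
  have Dm [measurable]: "D i \<in> sets M" for i using D(1) assms(2) by auto
  let ?E = "\<Union>i<n. D i"
  have sub: "((\<Union>i. a i) - ?E) \<union> (?E - (\<Union>i. a i)) \<subseteq> ((\<Union>i. a i) - ?b n) \<union> (\<Union>i<n. (a i - D i) \<union> (D i - a i))"
    by auto
  have "measure M (((\<Union>i. a i) - ?E) \<union> (?E - (\<Union>i. a i)))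
      \<le> measure M (((\<Union>i. a i) - ?b n) \<union> (\<Union>i<n. (a i - D i) \<union> (D i - a i)))"
    by (rule finite_measure_mono[OF sub]) measurable
  also have "\<dots> \<le> measure M ((\<Union>i. a i) - ?b n) + measure M (\<Union>i<n. (a i - D i) \<union> (D i - a i))"
    by (rule measure_Un_le) measurable
  also have "measure M ((\<Union>i. a i) - ?b n) < e / 2"
    using n by (subst finite_measure_Diff) auto
  also have "measure M (\<Union>i<n. (a i - D i) \<union> (D i - a i)) \<le> (\<Sum>i<n. measure M ((a i - D i) \<union> (D i - a i)))"
    by (rule measure_UNION_le) auto
  also have "\<dots> \<le> (\<Sum>i<n. e / (2 * (real n + 1)))"
    using D(2) by (intro sum_mono) (auto intro: less_imp_le)
  also have "\<dots> \<le> e / 2"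
    using \<open>0 < e\<close> by (simp add: field_simps)
  finally have "measure M (((\<Union>i. a i) - ?E) \<union> (?E - (\<Union>i. a i))) < e" by simp
  then show ?case
    using D(1) by (intro bexI[of _ ?E]) auto
qed

text \<open>The algebra is explicit: \<open>D (n, S)\<close> collects the points whose membership
  pattern in the first \<open>n\<close> generators belongs to \<open>S\<close>. There are countably
  many such pairs.\<close>

lemma countable_generated_algebra:
  assumes "countable G" "G \<subseteq> Pow \<Omega>"
  shows "\<exists>\<A>. countable \<A> \<and> algebra \<Omega> \<A> \<and> G \<subseteq> \<A> \<and> \<A> \<subseteq> sigma_sets \<Omega> G"
proof -
  \<comment> \<open>The empty set is added so that the set to enumerate is nonempty.\<close>
  define B where "B = from_nat_into (insert {} G)"
  have rB: "range B = insert {} G"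
    unfolding B_def using assms(1) by (intro range_from_nat_into) auto
  define D where "D = (\<lambda>(n, S). {v \<in> \<Omega>. {i. i < n \<and> v \<in> B i} \<in> S})"
  let ?A = "D ` (SIGMA n:UNIV. Pow (Pow {..<n}))"
  \<comment> \<open>A set described by \<open>n\<close> generators can be described by more; two
    sets are thus brought to a common level, where their union is a union of patterns.\<close>
  have lift: "D (n, S) = D (m, {X \<in> Pow {..<m}. X \<inter> {..<n} \<in> S})" if "n \<le> m" for n m S
  proof -
    have "{i. i < n \<and> v \<in> B i} = {i. i < m \<and> v \<in> B i} \<inter> {..<n}" for v
      using that by auto
    then show ?thesis by (auto simp: D_def)
  qed
  have in_A: "D (n, S) \<in> ?A" if "S \<subseteq> Pow {..<n}" for n S
    using that by blast
  show ?thesis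
  proof (intro exI conjI)
    show "countable ?A"
      by (intro countable_image countable_SIGMA) (auto intro: countable_finite)
    show "algebra \<Omega> ?A"
      unfolding algebra_iff_Un
    proof (intro conjI ballI)
      show "?A \<subseteq> Pow \<Omega>" by (auto simp: D_def)
      show "{} \<in> ?A" using in_A[of "{}" 0] by (simp add: D_def)
      fix a assume "a \<in> ?A"
      then obtain n S where a: "a = D (n, S)" "S \<subseteq> Pow {..<n}" by auto
      have "\<Omega> - a = D (n, Pow {..<n} - S)"
        by (auto simp: D_def a)
      then show "\<Omega> - a \<in> ?A" using in_A[of "Pow {..<n} - S" n] by auto
      fix b assume "b \<in> ?A"
      then obtain m R where b: "b = D (m, R)" "R \<subseteq> Pow {..<m}" by auto
      let ?k = "max n m"
      have "a \<union> b = D (?k, {X \<in> Pow {..<?k}. X \<inter> {..<n} \<in> S} \<union> {X \<in> Pow {..<?k}. X \<inter> {..<m} \<in> R})"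
        unfolding a(1) b(1) lift[of n ?k S, OF max.cobounded1] lift[of m ?k R, OF max.cobounded2]
        by (auto simp: D_def)
      then show "a \<union> b \<in> ?A"
        using in_A[of "{X \<in> Pow {..<?k}. X \<inter> {..<n} \<in> S} \<union> {X \<in> Pow {..<?k}. X \<inter> {..<m} \<in> R}" ?k] by auto
    qed
    show "G \<subseteq> ?A"
    proof
      fix c assume "c \<in> G"
      then obtain j where j: "c = B j" using rB by (metis insertI2 rangeE)
      have "c = D (Suc j, {X \<in> Pow {..<Suc j}. j \<in> X})"
        using \<open>c \<in> G\<close> assms(2) by (auto simp: D_def j)
      then show "c \<in> ?A" using in_A[of "{X \<in> Pow {..<Suc j}. j \<in> X}" "Suc j"] by auto
    qed
    show "?A \<subseteq> sigma_sets \<Omega> G"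
    proof
      fix a assume "a \<in> ?A"
      then obtain n S where a: "a = D (n, S)" "S \<subseteq> Pow {..<n}" by auto
      let ?M = "sigma \<Omega> G"
      have "B i \<in> insert {} G" for i using rB by blast
      then have [measurable]: "B i \<in> sets ?M" for i
        using assms(2) by (metis insertE sets.empty_sets sets_measure_of sigma_sets.Basic)
      have "finite S" using a(2) by (rule finite_subset) simp
      have "(\<Union>X\<in>S. {v \<in> space ?M. \<forall>i\<in>{..<n}. i \<in> X \<longleftrightarrow> v \<in> B i}) \<in> sets ?M"
        using \<open>finite S\<close> by (intro sets.finite_UN) measurable
      also have "(\<Union>X\<in>S. {v \<in> space ?M. \<forall>i\<in>{..<n}. i \<in> X \<longleftrightarrow> v \<in> B i}) = a"
      proof -
        have "{i. i < n \<and> v \<in> B i} \<in> S \<longleftrightarrow> (\<exists>X\<in>S. \<forall>i\<in>{..<n}. i \<in> X \<longleftrightarrow> v \<in> B i)" for v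
        proof
          assume "\<exists>X\<in>S. \<forall>i\<in>{..<n}. i \<in> X \<longleftrightarrow> v \<in> B i"
          then obtain X where X: "X \<in> S" "\<forall>i\<in>{..<n}. i \<in> X \<longleftrightarrow> v \<in> B i" by blast
          then have "{i. i < n \<and> v \<in> B i} = X" using a(2) by auto
          with X show "{i. i < n \<and> v \<in> B i} \<in> S" by simp
        qed (intro bexI[of _ "{i. i < n \<and> v \<in> B i}"], auto)
        then show ?thesis
          using assms(2) by (auto simp: a D_def space_measure_of)
      qed
      finally show "a \<in> sigma_sets \<Omega> G" using assms(2) by simp
    qed
  qed
qed

text \<open>By continuity of paths every coordinate is a limit of coordinates at countably many
  times, and each of those is tested on a countable basis.\<close>

lemma path_filt_countably_generated:
  assumes "t \<le> u" "u \<le> T"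
  shows "\<exists>G. countable G \<and> G \<subseteq> Pow (Path T t) \<and>
    sets (path_filt T t u :: (real \<Rightarrow> real ^ 'd) measure) = sigma_sets (Path T t) G"
proof -
  obtain \<B> :: "(real ^ 'd) set set" where \<B>: "countable \<B>" "topological_basis \<B>"
    using ex_countable_basis by blast
  \<comment> \<open>Rational points of the rescaled interval: this set contains both endpoints and
    is dense in \<open>[t, u]\<close> even if \<open>t\<close> and \<open>u\<close> are
    irrational.\<close>
  define R where "R = (\<lambda>q. t + (u - t) * q) ` (\<rat> \<inter> {0..1})"
  define G where "G = (\<lambda>(r, B). {w \<in> Path T t. w r \<in> B}) ` (R \<times> \<B>)"
  have R: "R \<subseteq> {t..u}"
    using assms mult_left_le[of _ "u - t"] by (fastforce simp: R_def)
  have "countable (\<rat> \<inter> {0..1} :: real set)"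
    using countable_rat by (rule countable_subset[rotated]) auto
  then have cG: "countable G"
    unfolding G_def R_def using \<B>(1) by (intro countable_image countable_SIGMA) auto
  have GP: "G \<subseteq> Pow (Path T t)" by (auto simp: G_def)
  let ?N = "sigma (Path T t) G"
  have coord: "(\<lambda>w. w r) \<in> borel_measurable ?N" if "r \<in> R" for r
    unfolding borel_eq_countable_basis[OF \<B>]
  proof (rule measurable_measure_of)
    fix B assume B: "B \<in> \<B>"
    have "(\<lambda>w. w r) -` B \<inter> space ?N = {w \<in> Path T t. w r \<in> B}"
      using GP by (auto simp: space_measure_of)
    also have "\<dots> \<in> sets ?N"
      using GP B that by (auto simp: G_def intro!: sigma_sets.Basic)
    finally show "(\<lambda>w. w r) -` B \<inter> space ?N \<in> sets ?N" .
  qed auto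
  \<comment> \<open>Measurability of the identity is the inclusion of the two
    sigma-algebras.\<close>
  have "(\<lambda>w. w) \<in> measurable ?N (path_filt T t u)"
  proof (rule measurable_path_filtI)
    fix r assume r: "r \<in> {t..u}"
    define x where "x = (r - t) / (u - t)"
    note x = unit_rescale[OF r, folded x_def]
    let ?q = "\<lambda>n. dyadic_up 1 0 n x"
    have "?q n \<in> \<rat>" for n by (simp add: dyadic_up_def min_def)
    then have q: "t + (u - t) * ?q n \<in> R" for n
      using dyadic_up_bounds(3)[of x 0 1 n] x(1,2) by (auto simp: R_def)
    show "(\<lambda>w. w r) \<in> borel_measurable ?N"
    proof (rule borel_measurable_LIMSEQ_metric)
      show "(\<lambda>w. w (t + (u - t) * ?q n)) \<in> borel_measurable ?N" for n
        by (rule coord[OF q])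
      fix w assume "w \<in> space ?N"
      then have w: "w \<in> Path T t" using GP by (simp add: space_measure_of)
      have "(\<lambda>n. t + (u - t) * ?q n) \<longlonglongrightarrow> t + (u - t) * x"
        using x(1,2) by (intro tendsto_intros dyadic_up_tendsto) auto
      then have lim: "(\<lambda>n. t + (u - t) * ?q n) \<longlonglongrightarrow> r" using x(3) by simp
      have "t + (u - t) * ?q n \<in> {t..T}" for n
        using subsetD[OF R q[of n]] assms by simp
      then show "(\<lambda>n. w (t + (u - t) * ?q n)) \<longlonglongrightarrow> w r"
        using r assms by (intro continuous_on_tendsto_compose[OF Path_continuous[OF w] lim] always_eventually) auto
    qed
  qed (use GP in \<open>auto simp: space_measure_of\<close>)
  then have "sets (path_filt T t u) \<subseteq> sets ?N"
    using GP sets.sets_into_space[of _ "path_filt T t u"]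
    by (fastforce simp: measurable_def space_measure_of Int_absorb2)
  moreover have "sigma_sets (Path T t) G \<subseteq> sets (path_filt T t u)"
    unfolding sets_path_filt using \<B> R topological_basis_open[OF \<B>(2)]
    by (intro sigma_sets_mono') (fastforce simp: G_def)
  ultimately show ?thesis
    using cG GP by (intro exI[of _ G]) auto
qed

lemma path_filt_countable_algebra:
  assumes "t \<le> u" "u \<le> T"
  shows "\<exists>\<A>. countable \<A> \<and> algebra (Path T t) \<A> \<and> \<A> \<subseteq> sets (path_filt T t u) \<and>
    sets (path_filt T t u :: (real \<Rightarrow> real ^ 'd) measure) = sigma_sets (Path T t) \<A>"
proof -
  obtain G where G: "countable G" "G \<subseteq> Pow (Path T t)"
    "sets (path_filt T t u :: (real \<Rightarrow> real ^ 'd) measure) = sigma_sets (Path T t) G"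
    using path_filt_countably_generated[OF assms] by blast
  obtain \<A> where A: "countable \<A>" "algebra (Path T t) \<A>" "G \<subseteq> \<A>" "\<A> \<subseteq> sigma_sets (Path T t) G"
    using countable_generated_algebra[OF G(1,2)] by blast
  have "sigma_sets (Path T t) G = sigma_sets (Path T t) \<A>"
    using A(3,4) sigma_sets_mono[of \<A> "Path T t" G] sigma_sets_mono'[of G \<A> "Path T t"] by blast
  with A G show ?thesis by (intro exI[of _ \<A>]) simp
qed

section \<open>Stopping times with values in a finite grid\<close>

lemma stop_times_dyadic_up:
  assumes "\<sigma> \<in> stop_times T t \<infinity>" "t \<le> T"
  shows "(\<lambda>v. dyadic_up T t n (\<sigma> v)) \<in> stop_times T t \<infinity>"
proof (rule stop_timesI[OF assms(2)])
  show "(\<lambda>v. dyadic_up T t n (\<sigma> v)) \<in> Path T t \<rightarrow> {t..T}"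
    using dyadic_up_bounds(3) stop_timesD(3)[OF assms(1)] by blast
  fix u assume u: "u \<in> {t..T}"
  show "{v \<in> Path T t. dyadic_up T t n (\<sigma> v) \<le> u} \<in> sets (path_filt T t u)"
  proof (cases "u = T")
    case True
    then have "{v \<in> Path T t. dyadic_up T t n (\<sigma> v) \<le> u} = space (path_filt T t u)"
      by (auto simp: dyadic_up_def)
    then show ?thesis by (simp only: sets.top)
  next
    case False
    \<comment> \<open>The last point of the uncapped grid not after \<open>u\<close>. The rounded
      time is at most \<open>u\<close> exactly if the original one is at most this point, so the
      event is already known by \<open>u\<close>. At \<open>u = T\<close> the cap makes the event
      trivial.\<close>
    let ?u = "t + \<lfloor>2 ^ n * (u - t)\<rfloor> / 2 ^ n"
    have "\<lfloor>2 ^ n * (u - t)\<rfloor> / 2 ^ n \<le> u - t"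
      using of_int_floor_le[of "2 ^ n * (u - t)"] by (simp add: pos_divide_le_eq mult.commute)
    then have le: "?u \<le> u" by simp
    have "dyadic_up T t n a \<le> u \<longleftrightarrow> a \<le> ?u" for a
    proof -
      have "dyadic_up T t n a \<le> u \<longleftrightarrow> \<lceil>2 ^ n * (a - t)\<rceil> \<le> 2 ^ n * (u - t)"
        using u False by (auto simp: dyadic_up_def min_le_iff_disj field_simps)
      also have "\<dots> \<longleftrightarrow> 2 ^ n * (a - t) \<le> \<lfloor>2 ^ n * (u - t)\<rfloor>"
        by (simp add: le_floor_iff[symmetric] ceiling_le_iff)
      also have "\<dots> \<longleftrightarrow> a \<le> ?u"
        by (simp add: field_simps)
      finally show ?thesis .
    qed
    then have "{v \<in> Path T t. dyadic_up T t n (\<sigma> v) \<le> u} = {v \<in> Path T t. \<sigma> v \<le> ?u}"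
      by simp
    then show ?thesis
      using stop_times_sets_le[OF assms(1), of ?u] sets_path_filt_mono[OF le, of T t] by auto
  qed
qed

definition dyadic_grid :: "real \<Rightarrow> real \<Rightarrow> nat \<Rightarrow> real set" where
  "dyadic_grid T t n = (\<lambda>i::nat. min T (t + i / 2 ^ n)) ` {..nat \<lceil>2 ^ n * (T - t)\<rceil>}"

lemma finite_dyadic_grid: "finite (dyadic_grid T t n)"
  by (simp add: dyadic_grid_def)

lemma dyadic_grid_subset: "t \<le> T \<Longrightarrow> dyadic_grid T t n \<subseteq> {t..T}"
  by (auto simp: dyadic_grid_def)

lemma dyadic_up_in_grid:
  assumes "a \<in> {t..T}"
  shows "dyadic_up T t n a \<in> dyadic_grid T t n"
proof -
  let ?i = "\<lceil>2 ^ n * (a - t)\<rceil>"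
  have "0 \<le> 2 ^ n * (a - t)" using assms by (intro mult_nonneg_nonneg) auto
  then have "0 \<le> ?i" by linarith
  have "?i \<le> \<lceil>2 ^ n * (T - t)\<rceil>" using assms by (intro ceiling_mono) simp
  then have "nat ?i \<le> nat \<lceil>2 ^ n * (T - t)\<rceil>" by (rule nat_mono)
  moreover have "min T (t + ?i / 2 ^ n) = min T (t + nat ?i / 2 ^ n)"
    using \<open>0 \<le> ?i\<close> by (simp only: of_nat_nat)
  ultimately show ?thesis
    unfolding dyadic_grid_def dyadic_up_def by (intro image_eqI[of _ _ "nat ?i"]) (simp_all only: atMost_iff)
qed

text \<open>The first grid point \<open>c\<close> whose event \<open>D c\<close> has occurred, with
  \<open>T\<close> as default. The events need not increase in \<open>c\<close>, so an arbitrary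
  choice of adapted events gives a stopping time.\<close>

definition grid_time :: "real \<Rightarrow> real set \<Rightarrow> (real \<Rightarrow> 'a set) \<Rightarrow> 'a \<Rightarrow> real" where
  "grid_time T S D v = Min (insert T {c \<in> S. v \<in> D c})"

lemma stop_times_grid_time:
  assumes "finite S" "S \<subseteq> {t..T}" "t \<le> T" "\<And>c. c \<in> S \<Longrightarrow> D c \<in> sets (path_filt T t c)"
  shows "grid_time T S D \<in> stop_times T t \<infinity>"
proof (rule stop_timesI[OF assms(3)])
  have fin: "finite {c \<in> S. v \<in> D c}" for v using assms(1) by simp
  show "grid_time T S D \<in> Path T t \<rightarrow> {t..T}"
    using assms(1-3) fin subsetD[OF assms(2)] by (fastforce simp: grid_time_def)
  fix u assume u: "u \<in> {t..T}"
  show "{v \<in> Path T t. grid_time T S D v \<le> u} \<in> sets (path_filt T t u)"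
  proof (cases "u = T")
    case True
    then have "{v \<in> Path T t. grid_time T S D v \<le> u} = space (path_filt T t u)"
      using fin by (auto simp: grid_time_def Min_le_iff)
    then show ?thesis by (simp only: sets.top)
  next
    case False
    have D: "D c \<in> sets (path_filt T t u)" if "c \<in> S" "c \<le> u" for c
      using assms(4)[OF that(1)] sets_path_filt_mono[OF that(2)] by blast
    then have "(\<Union>c\<in>{c \<in> S. c \<le> u}. D c) \<in> sets (path_filt T t u)"
      using assms(1) by (intro sets.finite_UN) auto
    also have "(\<Union>c\<in>{c \<in> S. c \<le> u}. D c) = {v \<in> Path T t. grid_time T S D v \<le> u}"
      using False u fin sets.sets_into_space[OF D] by (auto simp: grid_time_def Min_le_iff)
    finally show ?thesis .
  qed
qed

lemma grid_time_of_stop_time: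
  assumes "\<sigma> v \<in> S" "finite S" "S \<subseteq> {t..T}" "v \<in> \<Omega>"
  shows "grid_time T S (\<lambda>c. {v \<in> \<Omega>. \<sigma> v \<le> c}) v = \<sigma> v"
  unfolding grid_time_def using assms by (intro Min_eqI) auto

context payoff_processes
begin

text \<open>Rounding a stopping time of the maximizer up can only help in the limit: where it crosses
  the opponent's time, \<open>L\<close> is replaced by \<open>U \<ge> L\<close>.\<close>

lemma payoff_dyadic_up_tendsto:
  assumes "w \<in> Path T 0" "v \<in> Path T t" "t \<in> {0..T}"
    and \<sigma>: "\<sigma> v \<in> {t..T}" and \<gamma>: "\<gamma> v \<in> {t..T}"
  shows "(\<lambda>n. min (payoff T g L U t w (\<lambda>v. dyadic_up T t n (\<sigma> v)) \<gamma> v) (payoff T g L U t w \<sigma> \<gamma> v))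
    \<longlonglongrightarrow> payoff T g L U t w \<sigma> \<gamma> v"
proof -
  let ?p = "conc t w v" and ?s = "\<lambda>n. dyadic_up T t n (\<sigma> v)"
  let ?I = "\<lambda>a. integral {t..a} (\<lambda>r. g r ?p)"
  have p: "?p \<in> Path T 0" using assms by (intro concat_path_in_Path) auto
  note s = dyadic_up_bounds[OF \<sigma>] dyadic_up_tendsto[OF \<sigma>]
  have pay: "payoff T g L U t w \<sigma> \<gamma> v =
      ?I (min (\<sigma> v) (\<gamma> v)) + (if \<sigma> v \<le> \<gamma> v then L (\<sigma> v) ?p else U (\<gamma> v) ?p)"
    by (rule payoff_alt[where \<tau> = \<sigma> and \<gamma> = \<gamma>, OF assms])
  have pay_n: "payoff T g L U t w (\<lambda>v. dyadic_up T t n (\<sigma> v)) \<gamma> v =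
      ?I (min (?s n) (\<gamma> v)) + (if ?s n \<le> \<gamma> v then L (?s n) ?p else U (\<gamma> v) ?p)" for n
    by (rule payoff_alt[where \<tau> = "\<lambda>v. dyadic_up T t n (\<sigma> v)" and \<gamma> = \<gamma>, OF assms(1-3) s(3) \<gamma>])
  show ?thesis
  proof (cases "\<sigma> v < \<gamma> v")
    case True
    have "(\<lambda>n. ?I (?s n) + L (?s n) ?p) \<longlonglongrightarrow> ?I (\<sigma> v) + L (\<sigma> v) ?p"
    proof (intro tendsto_add)
      have "(\<lambda>r. g r ?p) integrable_on {t..T}"
        using assms(3) by (intro integrable_g p) auto
      from continuous_on_tendsto_compose[OF indefinite_integral_continuous_1[OF this] s(4) \<sigma>] s(3)
      show "(\<lambda>n. ?I (?s n)) \<longlonglongrightarrow> ?I (\<sigma> v)" by simp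
      have "continuous_on {t..T} (\<lambda>r. L r ?p)"
        using assms(3) by (intro continuous_L p) auto
      from continuous_on_tendsto_compose[OF this s(4) \<sigma>] s(3)
      show "(\<lambda>n. L (?s n) ?p) \<longlonglongrightarrow> L (\<sigma> v) ?p" by simp
    qed
    moreover have "eventually (\<lambda>n. ?s n < \<gamma> v) sequentially"
      by (rule order_tendstoD(2)[OF s(4) True])
    then have "eventually (\<lambda>n. ?I (?s n) + L (?s n) ?p = payoff T g L U t w (\<lambda>v. dyadic_up T t n (\<sigma> v)) \<gamma> v) sequentially"
      by eventually_elim (simp add: pay_n)
    ultimately have "(\<lambda>n. payoff T g L U t w (\<lambda>v. dyadic_up T t n (\<sigma> v)) \<gamma> v) \<longlonglongrightarrow> payoff T g L U t w \<sigma> \<gamma> v"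
      using True by (simp add: pay Lim_transform_eventually)
    from tendsto_min[OF this tendsto_const[of "payoff T g L U t w \<sigma> \<gamma> v"]] show ?thesis by simp
  next
    case False
    \<comment> \<open>At a tie \<open>\<sigma> v = \<gamma> v\<close>, rounding may turn
      \<open>L\<close> into the larger \<open>U\<close>, so the rounded payoffs can tend to a value
      above the original payoff. The \<open>min\<close> in the statement keeps only the one-sided
      convergence that is needed.\<close>
    have "payoff T g L U t w \<sigma> \<gamma> v \<le> payoff T g L U t w (\<lambda>v. dyadic_up T t n (\<sigma> v)) \<gamma> v" for n
      using False s(1)[of n] L_le_U[OF _ p, of "\<gamma> v"] \<gamma> assms(3)
      by (cases "\<sigma> v = \<gamma> v") (auto simp: pay pay_n min_def)
    then have "min (payoff T g L U t w (\<lambda>v. dyadic_up T t n (\<sigma> v)) \<gamma> v) (payoff T g L U t w \<sigma> \<gamma> v)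
        = payoff T g L U t w \<sigma> \<gamma> v" for n
      by (simp add: min_absorb2)
    then show ?thesis by simp
  qed
qed

text \<open>Dominated convergence is applied to the truncated payoffs; the truncation is then
  dropped, as it only lowers them.\<close>

lemma eventually_cost_dyadic_up:
  assumes Q: "Q \<in> integrable_probs T g L U t" and w: "w \<in> Path T 0" and t: "t \<in> {0..T}"
    and \<sigma>: "\<sigma> \<in> stop_times T t \<infinity>" and \<gamma>: "\<gamma> \<in> stop_times T t \<infinity>" and e: "0 < e"
  shows "\<exists>n. cost t w Q \<sigma> \<gamma> - e < cost t w Q (\<lambda>v. dyadic_up T t n (\<sigma> v)) \<gamma>"
proof -
  have tT: "t \<le> T" using t by simp
  let ?f = "payoff T g L U t w \<sigma> \<gamma>" and ?f' = "\<lambda>n. payoff T g L U t w (\<lambda>v. dyadic_up T t n (\<sigma> v)) \<gamma>"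
  note \<sigma>n = stop_times_dyadic_up[OF \<sigma> tT]
  note int = integrable_payoff[OF Q w t \<sigma> \<gamma>] integrable_payoff[OF Q w t \<sigma>n \<gamma>]
  note sp = integrable_probsD(3)[OF Q]
  have "(\<lambda>n. \<integral>v. min (?f' n v) (?f v) \<partial>Q) \<longlonglongrightarrow> (\<integral>v. ?f v \<partial>Q)"
  proof (rule integral_dominated_convergence)
    show "?f \<in> borel_measurable Q" "\<And>n. (\<lambda>v. min (?f' n v) (?f v)) \<in> borel_measurable Q"
      using int by measurable
    show "integrable Q (\<lambda>v. path_bound t (conc t w v))"
      by (rule integrable_path_bound[OF Q w t])
    show "AE v in Q. (\<lambda>n. min (?f' n v) (?f v)) \<longlonglongrightarrow> ?f v"
    proof (rule AE_I2)
      fix v assume "v \<in> space Q"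
      then have v: "v \<in> Path T t" using sp by simp
      show "(\<lambda>n. min (?f' n v) (?f v)) \<longlonglongrightarrow> ?f v"
        by (intro payoff_dyadic_up_tendsto w v t stop_timesD(3)[OF \<sigma>] stop_timesD(3)[OF \<gamma>])
    qed
    fix n show "AE v in Q. norm (min (?f' n v) (?f v)) \<le> path_bound t (conc t w v)"
    proof (rule AE_I2)
      fix v assume "v \<in> space Q"
      then have v: "v \<in> Path T t" using sp by simp
      show "norm (min (?f' n v) (?f v)) \<le> path_bound t (conc t w v)"
        using abs_payoff_le_stop[OF w v t \<sigma> \<gamma>] abs_payoff_le_stop[OF w v t \<sigma>n \<gamma>, of n] by simp
    qed
  qed
  then have "eventually (\<lambda>n. (\<integral>v. ?f v \<partial>Q) - e < (\<integral>v. min (?f' n v) (?f v) \<partial>Q)) sequentially"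
    using e by (intro order_tendstoD(1)) auto
  then obtain n where "(\<integral>v. ?f v \<partial>Q) - e < (\<integral>v. min (?f' n v) (?f v) \<partial>Q)"
    by (auto simp: eventually_sequentially)
  also have "\<dots> \<le> (\<integral>v. ?f' n v \<partial>Q)"
    using int by (intro integral_mono) auto
  finally show ?thesis by blast
qed

text \<open>Off \<open>E\<close> the payoffs coincide, and on \<open>E\<close> each is at most
  \<open>path_bound\<close> in absolute value. The error becomes the mass of \<open>E\<close> under
  a weighted measure, to which set approximation applies although payoffs are unbounded.\<close>

lemma cost_diff_le:
  assumes Q: "Q \<in> integrable_probs T g L U t" and w: "w \<in> Path T 0" and t: "t \<in> {0..T}"
    and \<sigma>: "\<sigma> \<in> stop_times T t \<infinity>" and \<sigma>': "\<sigma>' \<in> stop_times T t \<infinity>" and \<gamma>: "\<gamma> \<in> stop_times T t \<infinity>"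
    and E: "E \<in> sets (path_filt T t T)" "\<And>v. v \<in> Path T t - E \<Longrightarrow> \<sigma> v = \<sigma>' v"
  shows "cost t w Q \<sigma> \<gamma> - cost t w Q \<sigma>' \<gamma> \<le>
    2 * measure (density Q (\<lambda>v. ennreal (path_bound t (conc t w v)))) E"
proof -
  let ?Y = "\<lambda>v. path_bound t (conc t w v)"
  note int = integrable_payoff[OF Q w t \<sigma> \<gamma>] integrable_payoff[OF Q w t \<sigma>' \<gamma>]
  note Y = integrable_path_bound[OF Q w t]
  note sp = integrable_probsD(3)[OF Q]
  have [measurable]: "E \<in> sets Q" using E(1) integrable_probsD(2)[OF Q] by simp
  have Y0: "0 \<le> ?Y v" if "v \<in> Path T t" for v
    using that t w by (intro path_bound_nonneg concat_path_in_Path) auto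
  have YE: "integrable Q (\<lambda>v. indicator E v * ?Y v)"
    using Y by (intro integrable_real_mult_indicator[of E Q ?Y, simplified mult.commute]) auto
  have "cost t w Q \<sigma> \<gamma> - cost t w Q \<sigma>' \<gamma> = (\<integral>v. payoff T g L U t w \<sigma> \<gamma> v - payoff T g L U t w \<sigma>' \<gamma> v \<partial>Q)"
    using int by simp
  also have "\<dots> \<le> (\<integral>v. 2 * (indicator E v * ?Y v) \<partial>Q)"
  proof (rule integral_mono)
    fix v assume "v \<in> space Q"
    then have v: "v \<in> Path T t" using sp by simp
    show "payoff T g L U t w \<sigma> \<gamma> v - payoff T g L U t w \<sigma>' \<gamma> v \<le> 2 * (indicator E v * ?Y v)"
    proof (cases "v \<in> E")
      case True
      then show ?thesis
        using abs_payoff_le_stop[OF w v t \<sigma> \<gamma>] abs_payoff_le_stop[OF w v t \<sigma>' \<gamma>] by simp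
    next
      case False
      then have "\<sigma> v = \<sigma>' v" using E(2) v by blast
      then show ?thesis using False by (simp add: payoff_def)
    qed
  qed (use int YE in auto)
  also have "\<dots> = 2 * (\<integral>v. indicator E v * ?Y v \<partial>Q)" by simp
  also have "(\<integral>v. indicator E v * ?Y v \<partial>Q) = measure (density Q (\<lambda>v. ennreal (?Y v))) E"
  proof -
    have "emeasure (density Q (\<lambda>v. ennreal (?Y v))) E = (\<integral>\<^sup>+v. ennreal (?Y v) * indicator E v \<partial>Q)"
      using Y by (intro emeasure_density) auto
    also have "\<dots> = (\<integral>\<^sup>+v. ennreal (indicator E v * ?Y v) \<partial>Q)"
      by (intro nn_integral_cong) (auto split: split_indicator)
    also have "\<dots> = ennreal (\<integral>v. indicator E v * ?Y v \<partial>Q)"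
      using YE Y0 sp by (intro nn_integral_eq_integral) auto
    finally have "emeasure (density Q (\<lambda>v. ennreal (?Y v))) E = ennreal (\<integral>v. indicator E v * ?Y v \<partial>Q)" .
    moreover have "0 \<le> (\<integral>v. indicator E v * ?Y v \<partial>Q)"
      using Y0 sp by (intro integral_nonneg_AE) auto
    ultimately show ?thesis by (simp add: measure_def)
  qed
  finally show ?thesis .
qed

text \<open>Grids and countable algebras depend on \<open>t\<close> and \<open>T\<close> only. The
  base path, the law \<open>Q\<close> and the opponent \<open>\<gamma>\<close> influence merely
  which member of the family is picked, so one family serves all conditional laws at once.\<close>

lemma countable_dense_stop_times:
  assumes t: "t \<in> {0..T}"
  shows "\<exists>\<S> :: ((real \<Rightarrow> real ^ 'd) \<Rightarrow> real) set. countable \<S> \<and> \<S> \<subseteq> stop_times T t \<infinity> \<and>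
    (\<forall>w\<in>Path T 0. \<forall>Q\<in>integrable_probs T g L U t. \<forall>\<gamma>\<in>stop_times T t \<infinity>. \<forall>\<sigma>\<in>stop_times T t \<infinity>. \<forall>e>0.
      \<exists>\<sigma>'\<in>\<S>. cost t w Q \<sigma> \<gamma> - e < cost t w Q \<sigma>' \<gamma>)"
proof -
  have tT: "t \<le> T" using t by simp
  let ?G = "dyadic_grid T t"
  have G: "finite (?G n)" "?G n \<subseteq> {t..T}" for n
    using finite_dyadic_grid dyadic_grid_subset[OF tT] by auto
  have "\<forall>u\<in>{t..T}. \<exists>\<A>. countable \<A> \<and> algebra (Path T t) \<A> \<and> \<A> \<subseteq> sets (path_filt T t u) \<and>
    sets (path_filt T t u :: (real \<Rightarrow> real ^ 'd) measure) = sigma_sets (Path T t) \<A>"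
    using path_filt_countable_algebra[of t _ T] by auto
  then obtain \<A> where A: "\<And>u. u \<in> {t..T} \<Longrightarrow> countable (\<A> u)" "\<And>u. u \<in> {t..T} \<Longrightarrow> algebra (Path T t) (\<A> u)"
      "\<And>u. u \<in> {t..T} \<Longrightarrow> \<A> u \<subseteq> sets (path_filt T t u)"
      "\<And>u. u \<in> {t..T} \<Longrightarrow> sets (path_filt T t u :: (real \<Rightarrow> real ^ 'd) measure) = sigma_sets (Path T t) (\<A> u)"
    by metis
  \<comment> \<open>For each level a finite grid with countably many choices of event at each grid
    point, hence countably many times.\<close>
  define \<S> where "\<S> = (\<Union>n. grid_time T (?G n) ` (\<Pi>\<^sub>E c\<in>?G n. \<A> c))"
  show ?thesis
  proof (intro exI conjI ballI allI impI)
    show "countable \<S>"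
      unfolding \<S>_def using A(1) subsetD[OF G(2)]
      by (intro countable_UN countable_image countable_PiE G(1)) auto
    show sub: "\<S> \<subseteq> stop_times T t \<infinity>"
    proof
      fix \<sigma> assume "\<sigma> \<in> \<S>"
      then obtain n D where D: "\<sigma> = grid_time T (?G n) D" "D \<in> (\<Pi>\<^sub>E c\<in>?G n. \<A> c)"
        unfolding \<S>_def by blast
      show "\<sigma> \<in> stop_times T t \<infinity>"
        unfolding D(1)
      proof (rule stop_times_grid_time[OF G tT])
        fix c assume c: "c \<in> ?G n"
        then have "D c \<in> \<A> c" using D(2) by auto
        then show "D c \<in> sets (path_filt T t c)" using A(3)[of c] c G(2) by blast
      qed
    qed
    fix w :: "real \<Rightarrow> real ^ 'd" and Q and \<gamma> \<sigma> :: "(real \<Rightarrow> real ^ 'd) \<Rightarrow> real" and e :: real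
    assume w: "w \<in> Path T 0" and Q: "Q \<in> integrable_probs T g L U t" and \<gamma>: "\<gamma> \<in> stop_times T t \<infinity>"
      and \<sigma>: "\<sigma> \<in> stop_times T t \<infinity>" and e: "0 < e"
    obtain n where n: "cost t w Q \<sigma> \<gamma> - e / 2 < cost t w Q (\<lambda>v. dyadic_up T t n (\<sigma> v)) \<gamma>"
      using eventually_cost_dyadic_up[OF Q w t \<sigma> \<gamma>, of "e / 2"] e by auto
    let ?\<sigma> = "\<lambda>v. dyadic_up T t n (\<sigma> v)"
    note \<sigma>n = stop_times_dyadic_up[OF \<sigma> tT, of n]
    let ?C = "\<lambda>c. {v \<in> Path T t. ?\<sigma> v \<le> c}"
    \<comment> \<open>A finite measure because \<open>path_bound\<close> is integrable under
      \<open>Q\<close>.\<close>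
    define \<mu> where "\<mu> = density Q (\<lambda>v. ennreal (path_bound t (conc t w v)))"
    have s\<mu>: "sets \<mu> = sets (path_filt T t T)" "space \<mu> = Path T t"
      by (simp_all add: \<mu>_def integrable_probsD[OF Q])
    have "emeasure \<mu> (space \<mu>) < \<infinity>"
    proof -
      have "emeasure \<mu> (space \<mu>) = (\<integral>\<^sup>+v. ennreal (path_bound t (conc t w v)) \<partial>Q)"
        using integrable_path_bound[OF Q w t] unfolding \<mu>_def
        by (subst emeasure_density) (auto intro!: nn_integral_cong)
      also have "\<dots> \<le> (\<integral>\<^sup>+v. ennreal (norm (path_bound t (conc t w v))) \<partial>Q)"
        by (intro nn_integral_mono ennreal_leI) simp
      also have "\<dots> < \<infinity>"
        using integrable_path_bound[OF Q w t] by (simp add: integrable_iff_bounded)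
      finally show ?thesis .
    qed
    then interpret \<mu>: finite_measure \<mu> by (intro finite_measureI) auto
    \<comment> \<open>Each grid point contributes less than \<open>d\<close> and
      \<open>cost_diff_le\<close> doubles the sum, so the total is at most \<open>e / 2\<close>;
      rounding took the other half. The \<open>+ 1\<close> avoids a zero denominator.\<close>
    define d where "d = e / (4 * (real (card (?G n)) + 1))"
    have d: "0 < d" using e by (simp add: d_def)
    have "\<exists>D\<in>\<A> c. measure \<mu> ((?C c - D) \<union> (D - ?C c)) < d" if c: "c \<in> ?G n" for c
    proof (rule \<mu>.approx_by_algebra[OF _ _ _ d, unfolded s\<mu>(2)])
      have c': "c \<in> {t..T}" using c G(2) by blast
      show "algebra (Path T t) (\<A> c)" by (rule A(2)[OF c'])
      show "\<A> c \<subseteq> sets \<mu>"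
        using A(3)[OF c'] sets_path_filt_mono[of c T T t] c' by (auto simp: s\<mu>)
      show "?C c \<in> sigma_sets (Path T t) (\<A> c)"
        using stop_times_sets_le[OF \<sigma>n, of c] A(4)[OF c'] by simp
    qed
    then have "\<forall>c\<in>?G n. \<exists>D. D \<in> \<A> c \<and> measure \<mu> ((?C c - D) \<union> (D - ?C c)) < d" by blast
    from bchoice[OF this] obtain D0 where
      D0': "\<forall>c\<in>?G n. D0 c \<in> \<A> c \<and> measure \<mu> ((?C c - D0 c) \<union> (D0 c - ?C c)) < d"
      by (rule exE)
    note D0 = conjunct1[OF bspec[OF D0']] conjunct2[OF bspec[OF D0']]
    define D where "D = restrict D0 (?G n)"
    let ?\<sigma>' = "grid_time T (?G n) D"
    have "D \<in> (\<Pi>\<^sub>E c\<in>?G n. \<A> c)"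
      unfolding D_def by (simp add: restrict_PiE_iff D0(1))
    then have \<sigma>': "?\<sigma>' \<in> \<S>"
      unfolding \<S>_def by (intro UN_I[of n] imageI) simp_all
    \<comment> \<open>Off this set every approximating event agrees with the true one, hence both
      families define the same grid time.\<close>
    let ?E = "\<Union>c\<in>?G n. (?C c - D0 c) \<union> (D0 c - ?C c)"
    have Em: "(?C c - D0 c) \<union> (D0 c - ?C c) \<in> sets (path_filt T t T)" if c: "c \<in> ?G n" for c
    proof -
      have c': "c \<in> {t..T}" using c G(2) by blast
      have "D0 c \<in> sets (path_filt T t T)" "?C c \<in> sets (path_filt T t T)"
        using sets_path_filt_mono[of c T T t] c' D0(1)[OF c] A(3)[OF c'] stop_times_sets_le[OF \<sigma>n, of c] by auto
      then show ?thesis by blast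
    qed
    have "cost t w Q ?\<sigma> \<gamma> - cost t w Q ?\<sigma>' \<gamma> \<le> 2 * measure \<mu> ?E"
      unfolding \<mu>_def
    proof (rule cost_diff_le[OF Q w t \<sigma>n _ \<gamma>])
      show "?\<sigma>' \<in> stop_times T t \<infinity>" using \<sigma>' sub by blast
      show "?E \<in> sets (path_filt T t T)"
        using G(1) Em by (intro sets.finite_UN) auto
      fix v assume v: "v \<in> Path T t - ?E"
      have "dyadic_up T t n (\<sigma> v) = grid_time T (?G n) ?C v"
        using v stop_timesD(3)[OF \<sigma>, of v] G
        by (intro grid_time_of_stop_time[symmetric] dyadic_up_in_grid) auto
      also have "\<dots> = ?\<sigma>' v"
      proof -
        have "{c \<in> ?G n. v \<in> ?C c} = {c \<in> ?G n. v \<in> D c}"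
          unfolding D_def using v by auto
        then show ?thesis by (simp only: grid_time_def)
      qed
      finally show "dyadic_up T t n (\<sigma> v) = ?\<sigma>' v" .
    qed
    also have "measure \<mu> ?E \<le> (\<Sum>c\<in>?G n. measure \<mu> ((?C c - D0 c) \<union> (D0 c - ?C c)))"
      using G(1) Em by (intro measure_UNION_le) (auto simp: s\<mu>)
    also have "\<dots> \<le> (\<Sum>c\<in>?G n. d)"
      using D0(2) by (intro sum_mono) (auto intro: less_imp_le)
    also have "2 * (\<Sum>c\<in>?G n. d) \<le> e / 2"
      using e by (simp add: d_def field_simps)
    finally have "cost t w Q \<sigma> \<gamma> - e < cost t w Q ?\<sigma>' \<gamma>" using n by simp
    with \<sigma>' show "\<exists>\<sigma>'\<in>\<S>. cost t w Q \<sigma> \<gamma> - e < cost t w Q \<sigma>' \<gamma>" by blast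
  qed
qed

end

section \<open>Conditioning\<close>

locale rcpd =
  fixes T t s :: real and P :: "(real \<Rightarrow> real ^ 'd) measure"
    and K :: "(real \<Rightarrow> real ^ 'd) \<Rightarrow> (real \<Rightarrow> real ^ 'd) measure"
  assumes times: "t \<le> s" "s \<le> T" and P: "P \<in> path_probs T t" and K: "is_rcpd T t s P K"
begin

sublocale prob_space P
  using P by (simp add: path_probs_def)

lemma sets_P: "sets P = sets (path_filt T t T)"
  using P by (simp add: path_probs_def)

lemma space_P: "space P = Path T t"
  using sets_eq_imp_space_eq[OF sets_P] by simp

lemma borel_measurable_P: "f \<in> borel_measurable P \<longleftrightarrow> f \<in> borel_measurable (path_filt T t T)"
  using measurable_cong_sets[OF sets_P refl] by blast

lemma sets_filt_P: "C \<in> sets (path_filt T t s) \<Longrightarrow> C \<in> sets P"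
  unfolding sets_P using sets_path_filt_mono[OF times(2)] by blast

lemma borel_measurable_filt_P:
  "f \<in> borel_measurable (path_filt T t s) \<Longrightarrow> f \<in> borel_measurable P"
  unfolding borel_measurable_P by (rule measurable_path_filt_mono[OF _ times(2)])

lemma K_path_probs: "v \<in> Path T t \<Longrightarrow> K v \<in> path_probs T t"
  using K unfolding is_rcpd_def by blast

lemma prob_space_K: "v \<in> Path T t \<Longrightarrow> prob_space (K v)"
  and sets_K: "v \<in> Path T t \<Longrightarrow> sets (K v) = sets (path_filt T t T)"
  using K_path_probs by (simp_all add: path_probs_def)

lemma space_K: "v \<in> Path T t \<Longrightarrow> space (K v) = Path T t"
  using sets_eq_imp_space_eq[OF sets_K] by simp

lemma borel_measurable_K:
  "v \<in> Path T t \<Longrightarrow> f \<in> borel_measurable (K v) \<longleftrightarrow> f \<in> borel_measurable (path_filt T t T)"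
  using measurable_cong_sets[OF sets_K refl] by blast

lemma emeasure_K: "v \<in> Path T t \<Longrightarrow> emeasure (K v) A = ennreal (measure (K v) A)"
  using prob_space_K by (intro finite_measure.emeasure_eq_measure prob_space.finite_measure)

lemma measurable_K: "K \<in> measurable (path_filt T t s) (subprob_algebra (path_filt T t T))"
proof (rule measurable_subprob_algebra)
  fix A :: "(real \<Rightarrow> real ^ 'd) set" assume "A \<in> sets (path_filt T t T)"
  then have "(\<lambda>v. measure (K v) A) \<in> borel_measurable (path_filt T t s)"
    using K by (simp add: is_rcpd_def)
  then have "(\<lambda>v. ennreal (measure (K v) A)) \<in> borel_measurable (path_filt T t s)" by measurable
  then show "(\<lambda>v. emeasure (K v) A) \<in> borel_measurable (path_filt T t s)"
    by (rule measurable_cong[THEN iffD1, rotated]) (simp add: emeasure_K)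
qed (auto simp: sets_K prob_space_K intro: prob_space_imp_subprob_space)

lemma measurable_K_P: "K \<in> measurable P (subprob_algebra (path_filt T t T))"
  using measurable_path_filt_mono[OF measurable_K times(2)] measurable_cong_sets[OF sets_P refl] by blast

text \<open>The two sides are compared one event at a time, so the null set in the definition of the
  conditional law may depend on the event. The resulting disintegration of \<open>P\<close> carries
  all conditional expectations below.\<close>

lemma bind_K: "P \<bind> K = P"
proof (rule measure_eqI)
  show "sets (P \<bind> K) = sets P"
    using not_empty by (subst sets_bind[where N = "path_filt T t T"]) (auto simp: sets_P sets_K space_P)
  fix A assume "A \<in> sets (P \<bind> K)"
  then have A: "A \<in> sets (path_filt T t T)"
    using not_empty by (subst (asm) sets_bind[where N = "path_filt T t T"]) (auto simp: sets_K space_P)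
  interpret F: finite_measure_subalgebra P "path_filt T t s"
    by unfold_locales (auto simp: subalgebra_def space_P sets_filt_P)
  have int: "integrable P (indicator A :: _ \<Rightarrow> real)"
    using A by (simp add: sets_P emeasure_eq_measure)
  have ae: "AE v in P. measure (K v) A = real_cond_exp P (path_filt T t s) (indicator A) v"
    and m: "(\<lambda>v. measure (K v) A) \<in> borel_measurable (path_filt T t s)"
    using K A by (auto simp: is_rcpd_def)
  have i: "integrable P (\<lambda>v. measure (K v) A)"
    by (rule integrable_cong_AE_imp[OF F.real_cond_exp_int(1)[OF int] borel_measurable_filt_P[OF m]])
      (use ae in auto)
  have "emeasure (P \<bind> K) A = (\<integral>\<^sup>+v. emeasure (K v) A \<partial>P)"
    by (rule emeasure_bind[OF not_empty measurable_K_P A])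
  also have "\<dots> = (\<integral>\<^sup>+v. ennreal (measure (K v) A) \<partial>P)"
    by (intro nn_integral_cong emeasure_K) (simp add: space_P)
  also have "\<dots> = ennreal (\<integral>v. measure (K v) A \<partial>P)"
    by (rule nn_integral_eq_integral[OF i]) simp
  also have "(\<integral>v. measure (K v) A \<partial>P) = (\<integral>v. real_cond_exp P (path_filt T t s) (indicator A) v \<partial>P)"
    by (rule integral_cong_AE[OF borel_measurable_filt_P[OF m] _ ae]) simp
  also have "\<dots> = (\<integral>v. indicator A v \<partial>P)"
    by (rule F.real_cond_exp_int(2)[OF int])
  also have "ennreal \<dots> = emeasure P A"
    using A by (simp add: sets_P emeasure_eq_measure)
  finally show "emeasure (P \<bind> K) A = emeasure P A" .
qed

lemma nn_integral_K:
  assumes "f \<in> borel_measurable (path_filt T t T)"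
  shows "(\<integral>\<^sup>+v. (\<integral>\<^sup>+u. f u \<partial>K v) \<partial>P) = (\<integral>\<^sup>+v. f v \<partial>P)"
  using nn_integral_bind[OF assms measurable_K_P] by (simp add: bind_K)

lemma borel_measurable_integral_K:
  fixes f :: "_ \<Rightarrow> real"
  assumes "f \<in> borel_measurable (path_filt T t T)"
  shows "(\<lambda>v. \<integral>u. f u \<partial>K v) \<in> borel_measurable (path_filt T t s)"
  using measurable_compose[OF measurable_K integral_measurable_subprob_algebra[OF assms]] .

lemma integral_K_nonneg:
  fixes f :: "_ \<Rightarrow> real"
  assumes f: "integrable P f" and pos: "\<And>v. 0 \<le> f v"
  shows "AE v in P. integrable (K v) f" "integrable P (\<lambda>v. \<integral>u. f u \<partial>K v)"
    "(\<integral>v. (\<integral>u. f u \<partial>K v) \<partial>P) = (\<integral>v. f v \<partial>P)"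
proof -
  have m: "f \<in> borel_measurable (path_filt T t T)"
    using f borel_measurable_P by blast
  have nn: "(\<integral>\<^sup>+v. (\<integral>\<^sup>+u. ennreal (f u) \<partial>K v) \<partial>P) = ennreal (\<integral>v. f v \<partial>P)"
    using m pos by (subst nn_integral_K) (auto intro!: nn_integral_eq_integral f)
  have "AE v in P. (\<integral>\<^sup>+u. ennreal (f u) \<partial>K v) \<noteq> \<infinity>"
  proof (rule nn_integral_noteq_infinite)
    have "(\<lambda>u. ennreal (f u)) \<in> borel_measurable (path_filt T t T)" using m by measurable
    then show "(\<lambda>v. \<integral>\<^sup>+u. ennreal (f u) \<partial>K v) \<in> borel_measurable P"
      by (rule measurable_compose[OF measurable_K_P nn_integral_measurable_subprob_algebra])
  qed (simp add: nn)
  then show ae: "AE v in P. integrable (K v) f"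
  proof (rule AE_mp[OF _ AE_I2], intro impI)
    fix v assume v: "v \<in> space P" "(\<integral>\<^sup>+u. ennreal (f u) \<partial>K v) \<noteq> \<infinity>"
    then show "integrable (K v) f"
      using m pos borel_measurable_K[of v f] by (intro integrableI_nonneg) (auto simp: space_P less_top)
  qed
  have eq: "(\<integral>\<^sup>+v. ennreal (\<integral>u. f u \<partial>K v) \<partial>P) = ennreal (\<integral>v. f v \<partial>P)"
    unfolding nn[symmetric]
    by (rule nn_integral_cong_AE) (use ae pos in \<open>auto simp: nn_integral_eq_integral\<close>)
  have m': "(\<lambda>v. \<integral>u. f u \<partial>K v) \<in> borel_measurable P"
    by (intro borel_measurable_filt_P borel_measurable_integral_K m)
  have pos': "0 \<le> (\<integral>u. f u \<partial>K v)" for v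
    using pos by (intro integral_nonneg_AE) auto
  show "integrable P (\<lambda>v. \<integral>u. f u \<partial>K v)"
    by (rule integrableI_nonneg[OF m']) (auto simp: pos' eq)
  show "(\<integral>v. (\<integral>u. f u \<partial>K v) \<partial>P) = (\<integral>v. f v \<partial>P)"
    using pos pos' m' f by (intro integral_eq_nn_integral[THEN trans]) (auto simp: eq intro!: integral_nonneg_AE)
qed

text \<open>Integrability under \<open>K v\<close> holds only for almost every \<open>v\<close>, so
  the splitting into positive and negative parts is valid almost surely rather than
  pointwise.\<close>

lemma integral_K:
  fixes f :: "_ \<Rightarrow> real"
  assumes f: "integrable P f"
  shows "AE v in P. integrable (K v) f" "integrable P (\<lambda>v. \<integral>u. f u \<partial>K v)"
    "(\<integral>v. (\<integral>u. f u \<partial>K v) \<partial>P) = (\<integral>v. f v \<partial>P)"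
proof -
  have f1: "integrable P (\<lambda>v. max 0 (f v))" "integrable P (\<lambda>v. max 0 (- f v))"
    using f by auto
  note p = integral_K_nonneg[OF f1(1) max.cobounded1] integral_K_nonneg[OF f1(2) max.cobounded1]
  have split: "f v = max 0 (f v) - max 0 (- f v)" for v by (simp add: max_def)
  have ae: "AE v in P. integrable (K v) f \<and>
      (\<integral>u. f u \<partial>K v) = (\<integral>u. max 0 (f u) \<partial>K v) - (\<integral>u. max 0 (- f u) \<partial>K v)"
    using p(1) p(4)
  proof eventually_elim
    case (elim v)
    from Bochner_Integration.integrable_diff[OF elim] Bochner_Integration.integral_diff[OF elim]
    show ?case by (simp add: split[symmetric])
  qed
  then show "AE v in P. integrable (K v) f" by auto
  have m: "(\<lambda>v. \<integral>u. f u \<partial>K v) \<in> borel_measurable P"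
    using f borel_measurable_P by (intro borel_measurable_filt_P borel_measurable_integral_K) blast
  have ae': "AE v in P. (\<integral>u. max 0 (f u) \<partial>K v) - (\<integral>u. max 0 (- f u) \<partial>K v) = (\<integral>u. f u \<partial>K v)"
    using ae by eventually_elim simp
  note d = Bochner_Integration.integrable_diff[OF p(2) p(5)]
  show "integrable P (\<lambda>v. \<integral>u. f u \<partial>K v)"
    by (rule integrable_cong_AE_imp[OF d m ae'])
  have "(\<integral>v. (\<integral>u. f u \<partial>K v) \<partial>P) = (\<integral>v. (\<integral>u. max 0 (f u) \<partial>K v) - (\<integral>u. max 0 (- f u) \<partial>K v) \<partial>P)"
    using ae' by (intro integral_cong_AE m borel_measurable_integrable[OF d]) auto
  also have "\<dots> = (\<integral>v. max 0 (f v) \<partial>P) - (\<integral>v. max 0 (- f v) \<partial>P)"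
    by (simp add: Bochner_Integration.integral_diff[OF p(2,5)] p(3,6))
  also have "\<dots> = (\<integral>v. f v \<partial>P)"
    by (simp add: split[symmetric] flip: Bochner_Integration.integral_diff[OF f1])
  finally show "(\<integral>v. (\<integral>u. f u \<partial>K v) \<partial>P) = (\<integral>v. f v \<partial>P)" .
qed

lemma concat_image_K:
  assumes "v \<in> Path T t"
  shows "concat_path T t s v ` Path T s \<in> sets (path_filt T t T)"
    and "AE u in K v. u \<in> concat_path T t s v ` Path T s"
proof -
  interpret K: prob_space "K v" by (rule prob_space_K[OF assms])
  have m: "measure (K v) (concat_path T t s v ` Path T s) = 1"
    using K assms by (simp add: is_rcpd_def)
  \<comment> \<open>Sets outside the sigma-algebra have measure 0 by convention; measure 1 therefore
    forces measurability of the image.\<close>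
  then have "concat_path T t s v ` Path T s \<in> sets (K v)"
    using measure_notin_sets by force
  then show "concat_path T t s v ` Path T s \<in> sets (path_filt T t T)"
    by (simp add: sets_K[OF assms])
  show "AE u in K v. u \<in> concat_path T t s v ` Path T s"
    using m \<open>concat_path T t s v ` Path T s \<in> sets (K v)\<close> by (simp add: K.prob_eq_1)
qed

text \<open>Almost every path under \<open>K v\<close> agrees with \<open>v\<close> up to
  \<open>s\<close>, so an event of time \<open>s\<close> has conditional probability 0 or 1, decided
  by \<open>v\<close>.\<close>

lemma AE_K_same:
  assumes "v \<in> Path T t" "C \<in> sets (path_filt T t s)"
  shows "AE u in K v. u \<in> C \<longleftrightarrow> v \<in> C"
  using concat_image_K(2)[OF assms(1)]
proof eventually_elim
  case (elim u)
  then obtain w' where w': "w' \<in> Path T s" "u = concat_path T t s v w'" by blast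
  then have "u \<in> Path T t" using assms(1) times by (simp add: concat_path_in_Path)
  then show ?case
    using w' times assms(1) by (intro path_filt_same_paths[OF assms(2)]) (auto simp: concat_path_before)
qed

text \<open>Taking out what is known at \<open>s\<close>: under \<open>K v\<close> the indicator of
  \<open>C\<close> is almost surely the constant \<open>indicator C v\<close>.\<close>

lemma integral_indicator_K:
  fixes f :: "_ \<Rightarrow> real"
  assumes f: "integrable P f" and C: "C \<in> sets (path_filt T t s)"
  shows "(\<integral>v. indicator C v * f v \<partial>P) = (\<integral>v. indicator C v * (\<integral>u. f u \<partial>K v) \<partial>P)"
proof -
  have C': "C \<in> sets P" by (rule sets_filt_P[OF C])
  have i: "integrable P (\<lambda>v. indicator C v * f v)"
    using integrable_mult_indicator[OF C' f] by simp
  have m: "f \<in> borel_measurable (path_filt T t T)" using f borel_measurable_P by blast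
  have "(\<integral>v. indicator C v * f v \<partial>P) = (\<integral>v. (\<integral>u. indicator C u * f u \<partial>K v) \<partial>P)"
    by (rule integral_K(3)[OF i, symmetric])
  also have "\<dots> = (\<integral>v. indicator C v * (\<integral>u. f u \<partial>K v) \<partial>P)"
  proof (rule Bochner_Integration.integral_cong[OF refl])
    fix v assume "v \<in> space P"
    then have v: "v \<in> Path T t" by (simp add: space_P)
    have "(\<integral>u. indicator C u * f u \<partial>K v) = (\<integral>u. indicator C v * f u \<partial>K v)"
    proof (rule integral_cong_AE)
      show "(\<lambda>u. indicator C u * f u) \<in> borel_measurable (K v)" "(\<lambda>u. indicator C v * f u) \<in> borel_measurable (K v)"
        using C' m by (simp_all add: borel_measurable_K[OF v] sets_P)
      show "AE u in K v. indicator C u * f u = indicator C v * f u"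
        using AE_K_same[OF v C] by eventually_elim (simp add: indicator_def)
    qed
    then show "(\<integral>u. indicator C u * f u \<partial>K v) = indicator C v * (\<integral>u. f u \<partial>K v)" by simp
  qed
  finally show ?thesis .
qed

text \<open>On the concatenations with \<open>v\<close>, a set of full \<open>K v\<close>-measure,
  the image of \<open>A\<close> under concatenation is the preimage of \<open>A\<close> under the
  shift.\<close>

lemma shift_prob_eq_distr:
  assumes v: "v \<in> Path T t"
  shows "shift_prob T t s K v = distr (K v) (path_filt T s T) (shift_path T s)"
  unfolding shift_prob_def distr_def space_path_filt
proof (rule measure_of_eq)
  show "sets (path_filt T s T) \<subseteq> Pow (Path T s)"
    using sets.space_closed[of "path_filt T s T"] by simp
  fix A :: "(real \<Rightarrow> real ^ 'd) set" assume "A \<in> sigma_sets (Path T s) (sets (path_filt T s T))"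
  then have A: "A \<in> sets (path_filt T s T)"
    using sets.sigma_sets_eq[of "path_filt T s T :: (real \<Rightarrow> real ^ 'd) measure"] by simp
  let ?B = "shift_path T s -` A \<inter> space (K v)" and ?I = "concat_path T t s v ` Path T s"
  have B: "?B \<in> sets (path_filt T t T)"
    using measurable_sets[OF measurable_shift_path[of t s T T] A] times by (simp add: space_K[OF v])
  have "A \<subseteq> Path T s" using sets.sets_into_space[OF A] by simp
  then have eq: "concat_path T t s v ` A = ?B \<inter> ?I"
    using shift_concat_path[OF v _ times] concat_path_in_Path[OF v _ times]
    by (auto simp: space_K[OF v] image_iff)
  show "emeasure (K v) (concat_path T t s v ` A) = emeasure (K v) ?B"
    using concat_image_K[OF v] B unfolding eq by (intro emeasure_eq_AE) (auto simp: sets_K[OF v])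
qed

end

section \<open>The inequality for a fixed strategy\<close>

locale conditioned_control =
  control_problem T \<rho> g L U \<P> + rcpd T t s P K
  for T :: real and \<rho> :: "real \<Rightarrow> real" and g L U :: "real \<Rightarrow> (real \<Rightarrow> real ^ 'd) \<Rightarrow> real"
    and \<P> :: "real \<Rightarrow> (real \<Rightarrow> real ^ 'd) \<Rightarrow> (real \<Rightarrow> real ^ 'd) measure set"
    and t s :: real and P :: "(real \<Rightarrow> real ^ 'd) measure"
    and K :: "(real \<Rightarrow> real ^ 'd) \<Rightarrow> (real \<Rightarrow> real ^ 'd) measure" +
  fixes w :: "real \<Rightarrow> real ^ 'd" and \<gamma> :: "(real \<Rightarrow> real ^ 'd) \<Rightarrow> real"
  assumes t_nonneg: "0 \<le> t" and w: "w \<in> Path T 0" and P_class: "P \<in> \<P> t w"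
    and \<gamma>: "\<gamma> \<in> stop_times T t \<infinity>"
begin

abbreviation \<gamma>\<^sub>s :: "(real \<Rightarrow> real ^ 'd) \<Rightarrow> real" where
  "\<gamma>\<^sub>s v \<equiv> max s (\<gamma> v)"

text \<open>The conditional expected payoff given time \<open>s\<close>, in the version defined by
  \<open>K\<close>. The opponent is \<open>\<gamma>\<^sub>s\<close> instead of
  \<open>\<gamma>\<close>, so that against a maximizer who waits until \<open>s\<close> it is a
  payoff of the restarted game; the two opponents agree where
  \<open>\<gamma> v \<ge> s\<close>.\<close>

definition J :: "((real \<Rightarrow> real ^ 'd) \<Rightarrow> real) \<Rightarrow> (real \<Rightarrow> real ^ 'd) \<Rightarrow> real" where
  "J \<tau> v = (\<integral>u. payoff T g L U t w \<tau> \<gamma>\<^sub>s u \<partial>K v)"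

definition Z :: "(real \<Rightarrow> real ^ 'd) \<Rightarrow> real" where
  "Z v = V s (conc t w v) + (LBINT r:{t..s}. g r (conc t w v))"

section \<open>Conditional payoffs and the game restarted at \<open>s\<close>\<close>

lemma t_in: "t \<in> {0..T}" and s_in: "s \<in> {0..T}" and s_in_t: "s \<in> {t..T}" and t_le_T: "t \<le> T"
  using t_nonneg times by auto

lemma P_int: "P \<in> integrable_probs T g L U t"
  by (rule \<P>_integrable[OF t_in w P_class])

lemma \<gamma>\<^sub>s_stop: "\<gamma>\<^sub>s \<in> stop_times T t \<infinity>"
  by (rule stop_times_max[OF \<gamma> times])

lemma conc_in_Path: "v \<in> Path T t \<Longrightarrow> conc t w v \<in> Path T 0"
  using t_in by (intro concat_path_in_Path w) auto

lemma borel_measurable_payoff_stop: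
  "\<tau> \<in> stop_times T t \<infinity> \<Longrightarrow> payoff T g L U t w \<tau> \<gamma>\<^sub>s \<in> borel_measurable (path_filt T t T)"
  by (intro borel_measurable_payoff w t_in borel_measurable_stop_time stop_timesD \<gamma>\<^sub>s_stop)

lemma borel_measurable_J:
  "\<tau> \<in> stop_times T t \<infinity> \<Longrightarrow> J \<tau> \<in> borel_measurable (path_filt T t s)"
  unfolding J_def[abs_def] by (intro borel_measurable_integral_K borel_measurable_payoff_stop)

text \<open>Both players wait until \<open>s\<close>, so the running reward splits there; its part
  before \<open>s\<close> depends on \<open>v\<close> alone.\<close>

lemma payoff_shift:
  assumes v: "v \<in> Path T t" and w': "w' \<in> Path T s" and \<sigma>: "\<sigma> \<in> stop_times T s \<infinity>"
  shows "payoff T g L U t w (\<lambda>u. \<sigma> (shift_path T s u)) \<gamma>\<^sub>s (concat_path T t s v w') =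
    payoff T g L U s (conc t w v) \<sigma> (\<lambda>w'. \<gamma>\<^sub>s (concat_path T t s v w')) w' +
    (LBINT r:{t..s}. g r (conc t w v))"
proof -
  let ?u = "concat_path T t s v w'"
  have u: "?u \<in> Path T t" by (rule concat_path_in_Path[OF v w' times])
  have p: "conc s (conc t w v) w' = conc t w ?u"
    by (rule concat_path_assoc) (use t_in times in auto)
  have \<sigma>': "\<sigma> (shift_path T s ?u) = \<sigma> w'"
    using shift_concat_path[OF v w' times] by simp
  have \<sigma>s: "\<sigma> w' \<in> {s..T}" by (rule stop_timesD(3)[OF \<sigma> w'])
  have \<gamma>s: "\<gamma>\<^sub>s ?u \<in> {s..T}" using stop_timesD(3)[OF \<gamma> u] times by auto
  let ?m = "min (\<sigma> w') (\<gamma>\<^sub>s ?u)"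
  have m: "s \<le> ?m" "?m \<le> T" using \<sigma>s \<gamma>s by auto
  have 1: "payoff T g L U t w (\<lambda>u. \<sigma> (shift_path T s u)) \<gamma>\<^sub>s ?u =
      integral {t..?m} (\<lambda>r. g r (conc t w ?u)) +
      (if \<sigma> w' \<le> \<gamma>\<^sub>s ?u then L (\<sigma> w') (conc t w ?u) else U (\<gamma>\<^sub>s ?u) (conc t w ?u))"
    by (subst payoff_alt[OF w u t_in]) (use \<sigma>s \<gamma>s times in \<open>auto simp: \<sigma>'\<close>)
  have 2: "payoff T g L U s (conc t w v) \<sigma> (\<lambda>w'. \<gamma>\<^sub>s (concat_path T t s v w')) w' =
      integral {s..?m} (\<lambda>r. g r (conc t w ?u)) +
      (if \<sigma> w' \<le> \<gamma>\<^sub>s ?u then L (\<sigma> w') (conc t w ?u) else U (\<gamma>\<^sub>s ?u) (conc t w ?u))"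
    unfolding p[symmetric] by (rule payoff_alt[where \<tau> = \<sigma> and \<gamma> = "\<lambda>w'. \<gamma>\<^sub>s (concat_path T t s v w')",
        OF conc_in_Path[OF v] w' s_in \<sigma>s \<gamma>s])
  have agree: "g r (conc t w v) = g r (conc t w ?u)" if r: "r \<in> {t..s}" for r
  proof (rule regular_process_agree[OF modulus regular_g conc_in_Path[OF v] conc_in_Path[OF u]])
    show "r \<in> {0..T}" using r t_in times by auto
    fix q assume q: "q \<in> {0..r}"
    have "?u q = v q" if "t \<le> q" using q r that times by (intro concat_path_before[OF _ _ w']) auto
    then show "conc t w v q = conc t w ?u q" using q r times by (simp add: concat_path_apply)
  qed
  have "(LBINT r:{t..s}. g r (conc t w v)) = integral {t..s} (\<lambda>r. g r (conc t w v))"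
    by (intro LBINT_continuous continuous_g conc_in_Path v) (use t_in times in auto)
  also have "\<dots> = integral {t..s} (\<lambda>r. g r (conc t w ?u))"
    by (intro integral_cong agree)
  finally have 3: "(LBINT r:{t..s}. g r (conc t w v)) = integral {t..s} (\<lambda>r. g r (conc t w ?u))" .
  have "integral {t..s} (\<lambda>r. g r (conc t w ?u)) + integral {s..?m} (\<lambda>r. g r (conc t w ?u)) =
      integral {t..?m} (\<lambda>r. g r (conc t w ?u))"
    by (intro Henstock_Kurzweil_Integration.integral_combine integrable_g conc_in_Path u) (use m t_in times in auto)
  then show ?thesis unfolding 1 2 3 by simp
qed

text \<open>The pathwise identity \<open>payoff_shift\<close> holds almost surely under
  \<open>K v\<close>; transporting the integral by the shift produces the law of the restarted
  game.\<close>

lemma J_shift: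
  assumes v: "v \<in> Path T t" and Q: "shift_prob T t s K v \<in> integrable_probs T g L U s"
    and \<sigma>: "\<sigma> \<in> stop_times T s \<infinity>"
  shows "J (\<lambda>u. \<sigma> (shift_path T s u)) v =
    cost s (conc t w v) (shift_prob T t s K v) \<sigma> (\<lambda>w'. \<gamma>\<^sub>s (concat_path T t s v w')) +
    (LBINT r:{t..s}. g r (conc t w v))"
proof -
  interpret Kv: prob_space "K v" by (rule prob_space_K[OF v])
  let ?h = "payoff T g L U s (conc t w v) \<sigma> (\<lambda>w'. \<gamma>\<^sub>s (concat_path T t s v w'))"
  let ?c = "LBINT r:{t..s}. g r (conc t w v)"
  note distr = shift_prob_eq_distr[OF v]
  have sm: "shift_path T s \<in> measurable (K v) (path_filt T s T)"
    using measurable_shift_path[of t s T T] times measurable_cong_sets[OF sets_K[OF v] refl] by blast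
  have int: "integrable (distr (K v) (path_filt T s T) (shift_path T s)) ?h"
    unfolding distr[symmetric]
    by (rule integrable_payoff[OF Q conc_in_Path[OF v] s_in \<sigma> stop_times_concat[OF \<gamma> v times]])
  then have hm: "?h \<in> borel_measurable (path_filt T s T)"
    using borel_measurable_integrable by fastforce
  have int': "integrable (K v) (\<lambda>u. ?h (shift_path T s u))"
    using int integrable_distr_eq[OF sm hm] by simp
  have "J (\<lambda>u. \<sigma> (shift_path T s u)) v = (\<integral>u. ?h (shift_path T s u) + ?c \<partial>K v)"
    unfolding J_def
  proof (rule integral_cong_AE)
    show "payoff T g L U t w (\<lambda>u. \<sigma> (shift_path T s u)) \<gamma>\<^sub>s \<in> borel_measurable (K v)"
      unfolding borel_measurable_K[OF v] by (intro borel_measurable_payoff_stop stop_times_shift \<sigma> times)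
    show "(\<lambda>u. ?h (shift_path T s u) + ?c) \<in> borel_measurable (K v)"
      using int' by auto
    show "AE u in K v. payoff T g L U t w (\<lambda>u. \<sigma> (shift_path T s u)) \<gamma>\<^sub>s u = ?h (shift_path T s u) + ?c"
      using concat_image_K(2)[OF v]
    proof eventually_elim
      case (elim u)
      then obtain w' where w': "w' \<in> Path T s" "u = concat_path T t s v w'" by blast
      show ?case
        using payoff_shift[OF v w'(1) \<sigma>] shift_concat_path[OF v w'(1) times] by (simp add: w'(2))
    qed
  qed
  also have "\<dots> = (\<integral>u. ?h (shift_path T s u) \<partial>K v) + ?c"
    using int' by (simp add: Kv.prob_space)
  also have "(\<integral>u. ?h (shift_path T s u) \<partial>K v) = (\<integral>x. ?h x \<partial>shift_prob T t s K v)"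
    unfolding distr by (rule integral_distr[OF sm hm, symmetric])
  finally show ?thesis .
qed

text \<open>Under \<open>K v\<close> the choice between the two times is already settled by whether
  \<open>v\<close> lies in \<open>C\<close>.\<close>

lemma J_if:
  assumes v: "v \<in> Path T t" and C: "C \<in> sets (path_filt T t s)"
    and \<tau>: "\<tau> \<in> stop_times T t \<infinity>" and \<tau>': "\<tau>' \<in> stop_times T t \<infinity>"
    and if_stop: "(\<lambda>u. if u \<in> C then \<tau> u else \<tau>' u) \<in> stop_times T t \<infinity>"
  shows "J (\<lambda>u. if u \<in> C then \<tau> u else \<tau>' u) v = (if v \<in> C then J \<tau> v else J \<tau>' v)"
proof -
  have "J (\<lambda>u. if u \<in> C then \<tau> u else \<tau>' u) v = J (if v \<in> C then \<tau> else \<tau>') v"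
    unfolding J_def
  proof (rule integral_cong_AE)
    show "payoff T g L U t w (\<lambda>u. if u \<in> C then \<tau> u else \<tau>' u) \<gamma>\<^sub>s \<in> borel_measurable (K v)"
      unfolding borel_measurable_K[OF v] by (rule borel_measurable_payoff_stop[OF if_stop])
    show "payoff T g L U t w (if v \<in> C then \<tau> else \<tau>') \<gamma>\<^sub>s \<in> borel_measurable (K v)"
      unfolding borel_measurable_K[OF v] using \<tau> \<tau>' by (intro borel_measurable_payoff_stop) auto
    show "AE u in K v. payoff T g L U t w (\<lambda>u. if u \<in> C then \<tau> u else \<tau>' u) \<gamma>\<^sub>s u =
        payoff T g L U t w (if v \<in> C then \<tau> else \<tau>') \<gamma>\<^sub>s u"
      using AE_K_same[OF v C] by eventually_elim (simp add: payoff_def)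
  qed
  then show ?thesis by simp
qed

text \<open>Induction on the number of competitors: the new one replaces the current best exactly
  where its conditional payoff is strictly larger. As \<open>J\<close> is measurable at time
  \<open>s\<close>, this comparison is an admissible switching event.\<close>

lemma J_max_attained:
  assumes \<sigma>: "\<And>n::nat. \<sigma> n \<in> stop_times T s \<infinity>"
  shows "\<exists>\<theta>\<in>stop_times T t \<infinity>. (\<forall>v\<in>Path T t. s \<le> \<theta> v) \<and>
    (\<forall>m\<le>n. \<forall>v\<in>Path T t. J (\<lambda>u. \<sigma> m (shift_path T s u)) v \<le> J \<theta> v)"
proof (induction n)
  case 0
  have "s \<le> \<sigma> 0 (shift_path T s v)" if "v \<in> Path T t" for v
    using stop_timesD(3)[OF \<sigma> shift_path_in_Path[OF that times]] by simp
  then show ?case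
    using stop_times_shift[OF \<sigma> times, of 0] by (intro bexI[of _ "\<lambda>u. \<sigma> 0 (shift_path T s u)"]) auto
next
  case (Suc n)
  then obtain \<theta> where \<theta>: "\<theta> \<in> stop_times T t \<infinity>" "\<forall>v\<in>Path T t. s \<le> \<theta> v"
    "\<forall>m\<le>n. \<forall>v\<in>Path T t. J (\<lambda>u. \<sigma> m (shift_path T s u)) v \<le> J \<theta> v" by blast
  let ?\<sigma> = "\<lambda>u. \<sigma> (Suc n) (shift_path T s u)"
  have \<sigma>_stop: "?\<sigma> \<in> stop_times T t \<infinity>" by (rule stop_times_shift[OF \<sigma> times])
  have \<sigma>_ge: "s \<le> ?\<sigma> v" if "v \<in> Path T t" for v
    using stop_timesD(3)[OF \<sigma> shift_path_in_Path[OF that times]] by simp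
  define C where "C = {v \<in> space (path_filt T t s). J \<theta> v < J ?\<sigma> v}"
  have C: "C \<in> sets (path_filt T t s)"
    unfolding C_def using borel_measurable_J[OF \<theta>(1)] borel_measurable_J[OF \<sigma>_stop] by measurable
  let ?\<theta> = "\<lambda>u. if u \<in> C then ?\<sigma> u else \<theta> u"
  have stop: "?\<theta> \<in> stop_times T t \<infinity>"
    by (rule stop_times_if[OF \<sigma>_stop \<theta>(1) C times]) (use \<sigma>_ge \<theta>(2) in fastforce)+
  have J: "J ?\<theta> v = max (J \<theta> v) (J ?\<sigma> v)" if "v \<in> Path T t" for v
    using that by (subst J_if[OF that C \<sigma>_stop \<theta>(1) stop]) (auto simp: C_def)
  show ?case
  proof (intro bexI[OF _ stop] conjI ballI allI impI)
    fix v :: "real \<Rightarrow> real ^ 'd" assume v: "v \<in> Path T t"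
    then show "s \<le> ?\<theta> v" using \<sigma>_ge \<theta>(2) by auto
    fix m assume m: "m \<le> Suc n"
    show "J (\<lambda>u. \<sigma> m (shift_path T s u)) v \<le> J ?\<theta> v"
    proof (cases "m = Suc n")
      case True then show ?thesis using J[OF v] by simp
    next
      case False
      then have "J (\<lambda>u. \<sigma> m (shift_path T s u)) v \<le> J \<theta> v" using \<theta>(3) v m by simp
      then show ?thesis using J[OF v] by simp
    qed
  qed
qed

text \<open>Path-continuity makes the value at \<open>s\<close> a uniformly continuous functional of
  the path up to \<open>s\<close>, to which the Bernstein approximation applies.\<close>

lemma borel_measurable_Z:
  assumes "path_continuity T \<rho> g L U \<P>"
  shows "Z \<in> borel_measurable (path_filt T t s)"
proof -
  obtain \<rho>1 where \<rho>1: "modulus \<rho>1" "\<And>w1 w2. w1 \<in> Path T 0 \<Longrightarrow> w2 \<in> Path T 0 \<Longrightarrow>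
      \<bar>V s w1 - V s w2\<bar> \<le> \<rho>1 (path_norm 0 s (\<lambda>r. w1 r - w2 r))"
    using assms s_in unfolding path_continuity_def by fastforce
  have "(\<lambda>v. V s (conc t w v)) \<in> borel_measurable (path_filt T t s)"
  proof (rule borel_measurable_path_functional[OF times \<rho>1(1)])
    fix v v' :: "real \<Rightarrow> real ^ 'd" assume v: "v \<in> Path T t" "v' \<in> Path T t"
    have "path_norm 0 s (\<lambda>r. conc t w v r - conc t w v' r) \<le> path_norm t s (\<lambda>r. v r - v' r)"
    proof (rule path_norm_le)
      fix r assume r: "r \<in> {0..s}"
      have "continuous_on {t..s} (\<lambda>q. v q - v' q)"
        using times
        by (intro continuous_on_diff continuous_on_subset[OF Path_continuous[OF v(1)]]
            continuous_on_subset[OF Path_continuous[OF v(2)]]) auto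
      from norm_le_path_norm[OF this, of r]
      show "norm (conc t w v r - conc t w v' r) \<le> path_norm t s (\<lambda>r. v r - v' r)"
        using r times path_norm_diff_nonneg[OF v times] by (cases "r < t") (auto simp: concat_path_apply)
    qed (use s_in in auto)
    then have "\<rho>1 (path_norm 0 s (\<lambda>r. conc t w v r - conc t w v' r)) \<le> \<rho>1 (path_norm t s (\<lambda>r. v r - v' r))"
      using s_in by (intro modulus_mono[OF \<rho>1(1)] path_norm_diff_nonneg[of _ T] conc_in_Path v) auto
    with \<rho>1(2)[OF conc_in_Path[OF v(1)] conc_in_Path[OF v(2)]]
    show "\<bar>V s (conc t w v) - V s (conc t w v')\<bar> \<le> \<rho>1 (path_norm t s (\<lambda>r. v r - v' r))" by simp
  qed
  moreover have "(\<lambda>v. LBINT r:{t..s}. g r (conc t w v)) \<in> borel_measurable (path_filt T t s)"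
  proof (rule measurable_cong[THEN iffD2, OF _ borel_measurable_integral_g[OF w t_in s_in_t]])
    fix v :: "real \<Rightarrow> real ^ 'd" assume "v \<in> space (path_filt T t s)"
    then have v: "v \<in> Path T t" by simp
    show "(LBINT r:{t..s}. g r (conc t w v)) = integral {t..s} (\<lambda>r. g r (conc t w v))"
      by (intro LBINT_continuous continuous_g conc_in_Path v) (use t_in times in auto)
  qed
  ultimately show ?thesis unfolding Z_def[abs_def] by measurable
qed

lemma neg_path_bound_le_Z:
  assumes v: "v \<in> Path T t"
  shows "- path_bound t (conc t w v) \<le> Z v"
proof -
  have c: "(LBINT r:{t..s}. g r (conc t w v)) = integral {t..s} (\<lambda>r. g r (conc t w v))"
    by (intro LBINT_continuous continuous_g conc_in_Path v) (use t_in times in auto)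
  \<comment> \<open>If both players stop at \<open>s\<close>, the payoff is the running reward plus
    \<open>L\<close> at \<open>s\<close>, which is at most \<open>Z v\<close> because
    \<open>L \<le> V\<close>.\<close>
  have "\<bar>payoff T g L U t w (\<lambda>_. s) (\<lambda>_. s) v\<bar> \<le> path_bound t (conc t w v)"
    by (rule abs_payoff_le[OF w v t_in s_in_t s_in_t])
  moreover have "payoff T g L U t w (\<lambda>_. s) (\<lambda>_. s) v = integral {t..s} (\<lambda>r. g r (conc t w v)) + L s (conc t w v)"
    by (subst payoff_alt[OF w v t_in]) (use s_in_t in auto)
  ultimately show ?thesis
    using L_le_V[OF s_in conc_in_Path[OF v]] unfolding Z_def c by simp
qed

text \<open>The conditioned law is admissible, so \<open>V\<close> at \<open>s\<close> is at most
  the best reply value against the continuation of \<open>\<gamma>\<close>. One half of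
  \<open>e\<close> pays for a nearly optimal reply, the other for replacing it by a member of the
  countable family.\<close>

lemma Z_approx:
  assumes dense: "\<forall>w\<in>Path T 0. \<forall>Q\<in>integrable_probs T g L U s. \<forall>\<gamma>\<in>stop_times T s \<infinity>. \<forall>\<sigma>\<in>stop_times T s \<infinity>. \<forall>e>0.
      \<exists>\<sigma>'\<in>\<S>. cost s w Q \<sigma> \<gamma> - e < cost s w Q \<sigma>' \<gamma>"
    and \<S>: "\<S> \<subseteq> stop_times T s \<infinity>"
    and v: "v \<in> Path T t" and Q: "shift_prob T t s K v \<in> \<P> s (conc t w v)" and e: "0 < e"
  shows "\<exists>\<sigma>\<in>\<S>. Z v - e < J (\<lambda>u. \<sigma> (shift_path T s u)) v"
proof -
  let ?Q = "shift_prob T t s K v" and ?\<gamma> = "\<lambda>w'. \<gamma>\<^sub>s (concat_path T t s v w')"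
  have Qi: "?Q \<in> integrable_probs T g L U s"
    by (rule \<P>_integrable[OF s_in conc_in_Path[OF v] Q])
  have \<gamma>': "?\<gamma> \<in> stop_times T s \<infinity>" by (rule stop_times_concat[OF \<gamma> v times])
  have "V s (conc t w v) - e / 2 < (SUP \<sigma>\<in>stop_times T s \<infinity>. cost s (conc t w v) ?Q \<sigma> ?\<gamma>)"
    using V_le_SUP_cost[OF s_in conc_in_Path[OF v] Q \<gamma>'] e by linarith
  then obtain \<sigma> where \<sigma>: "\<sigma> \<in> stop_times T s \<infinity>" "V s (conc t w v) - e / 2 < cost s (conc t w v) ?Q \<sigma> ?\<gamma>"
    using less_cSUP_iff[OF stop_times_nonempty[OF times(2)] bdd_above_cost[OF Qi conc_in_Path[OF v] s_in \<gamma>']] by blast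
  have "0 < e / 2" using e by simp
  then obtain \<sigma>' where \<sigma>': "\<sigma>' \<in> \<S>" "cost s (conc t w v) ?Q \<sigma> ?\<gamma> - e / 2 < cost s (conc t w v) ?Q \<sigma>' ?\<gamma>"
    using dense conc_in_Path[OF v] Qi \<gamma>' \<sigma>(1) by blast
  have "J (\<lambda>u. \<sigma>' (shift_path T s u)) v = cost s (conc t w v) ?Q \<sigma>' ?\<gamma> + (LBINT r:{t..s}. g r (conc t w v))"
    using J_shift[OF v Qi] \<sigma>'(1) \<S> by blast
  then have "Z v - e < J (\<lambda>u. \<sigma>' (shift_path T s u)) v"
    using \<sigma>(2) \<sigma>'(2) by (simp add: Z_def)
  with \<sigma>'(1) show ?thesis by blast
qed

text \<open>The only delicate case is \<open>\<gamma> v < s \<le> \<tau> v\<close>: the maximizer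
  has switched to \<open>\<theta>\<close>, but both \<open>\<tau>\<close> and
  \<open>\<theta>\<close> come after \<open>\<gamma>\<close>, so the payoff is the same.\<close>

lemma payoff_switch:
  assumes \<tau>: "\<tau> \<in> stop_times T t \<infinity>" and \<theta>: "\<theta> \<in> stop_times T t \<infinity>" "\<And>v. v \<in> Path T t \<Longrightarrow> s \<le> \<theta> v"
    and v: "v \<in> Path T t"
  shows "payoff T g L U t w (\<lambda>v. if v \<in> {v \<in> Path T t. \<tau> v < s} then \<tau> v else \<theta> v) \<gamma> v =
    (if min (\<tau> v) (\<gamma> v) < s then payoff T g L U t w \<tau> \<gamma> v else payoff T g L U t w \<theta> \<gamma>\<^sub>s v)"
proof -
  consider "\<tau> v < s" | "s \<le> \<tau> v" "\<gamma> v < s" | "s \<le> \<tau> v" "s \<le> \<gamma> v" by linarith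
  then show ?thesis
  proof cases
    case 1 then show ?thesis using v by (simp add: payoff_def)
  next
    case 2
    have "min (\<theta> v) (\<gamma> v) = \<gamma> v" "min (\<tau> v) (\<gamma> v) = \<gamma> v" "\<not> \<theta> v \<le> \<gamma> v" "\<not> \<tau> v \<le> \<gamma> v"
      using 2 \<theta>(2)[OF v] by auto
    then show ?thesis using 2 v by (simp add: payoff_def)
  next
    case 3 then show ?thesis using v by (simp add: payoff_def max_absorb2)
  qed
qed

end

context conditioned_control
begin

lemma abs_J_le:
  assumes v: "v \<in> Path T t" and int: "integrable (K v) (\<lambda>u. path_bound t (conc t w u))"
    and \<tau>: "\<tau> \<in> stop_times T t \<infinity>"
  shows "\<bar>J \<tau> v\<bar> \<le> (\<integral>u. path_bound t (conc t w u) \<partial>K v)"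
proof -
  let ?f = "payoff T g L U t w \<tau> \<gamma>\<^sub>s"
  have b: "\<bar>?f u\<bar> \<le> path_bound t (conc t w u)" if "u \<in> space (K v)" for u
    using that space_K[OF v] by (intro abs_payoff_le_stop w t_in \<tau> \<gamma>\<^sub>s_stop) simp
  have f: "integrable (K v) ?f"
  proof (rule Bochner_Integration.integrable_bound[OF int])
    show "?f \<in> borel_measurable (K v)"
      unfolding borel_measurable_K[OF v] by (rule borel_measurable_payoff_stop[OF \<tau>])
    show "AE u in K v. norm (?f u) \<le> norm (path_bound t (conc t w u))"
      using b by (intro AE_I2) fastforce
  qed
  have "\<bar>J \<tau> v\<bar> \<le> (\<integral>u. \<bar>?f u\<bar> \<partial>K v)"
    unfolding J_def by (rule integral_abs_bound)
  also have "\<dots> \<le> (\<integral>u. path_bound t (conc t w u) \<partial>K v)"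
    using f int b by (intro integral_mono) auto
  finally show ?thesis .
qed

text \<open>The exceptional set of the conditioning hypothesis is contained in the complement of a
  \<^emph>\<open>measurable\<close> event, so the extension \<open>P'\<close> can be discarded.\<close>

lemma AE_Z_approx:
  assumes Z: "Z \<in> borel_measurable (path_filt T t s)"
    and \<sigma>: "\<And>n::nat. \<sigma> n \<in> stop_times T s \<infinity>"
    and dense: "\<And>v e. v \<in> \<Omega>' \<Longrightarrow> 0 < e \<Longrightarrow> \<exists>m. Z v - e < J (\<lambda>u. \<sigma> m (shift_path T s u)) v"
    and ext: "prob_space P'" "space P' = Path T t" "sets (path_filt T t T) \<subseteq> sets P'"
      "\<And>A. A \<in> sets (path_filt T t T) \<Longrightarrow> emeasure P' A = emeasure P A"
      "\<Omega>' \<in> sets P'" "emeasure P' \<Omega>' = 1"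
  shows "AE v in P. \<forall>k::nat. \<exists>m. Z v - 1 / Suc k < J (\<lambda>u. \<sigma> m (shift_path T s u)) v"
proof -
  have [measurable]: "J (\<lambda>u. \<sigma> m (shift_path T s u)) \<in> borel_measurable (path_filt T t s)" for m
    by (intro borel_measurable_J stop_times_shift \<sigma> times)
  note [measurable] = Z
  \<comment> \<open>Both quantifiers range over \<open>nat\<close>, which is what makes
    \<open>G\<close> measurable in the raw filtration.\<close>
  define G where "G = {v \<in> space (path_filt T t s). \<forall>k::nat. \<exists>m. Z v - 1 / Suc k < J (\<lambda>u. \<sigma> m (shift_path T s u)) v}"
  have "G \<in> sets (path_filt T t s)"
    unfolding G_def by measurable
  then have G: "G \<in> sets (path_filt T t T)" "G \<in> sets P"
    using sets_filt_P sets_P by auto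
  have "\<Omega>' \<subseteq> G"
    using sets.sets_into_space[OF ext(5)] dense by (auto simp: G_def ext(2))
  then have "emeasure P' \<Omega>' \<le> emeasure P' G"
    using G(1) ext(3) by (intro emeasure_mono) auto
  then have "1 \<le> emeasure P G"
    using ext(4)[OF G(1)] ext(6) by simp
  then have "prob G = 1"
    using prob_le_1[of G] by (simp add: emeasure_eq_measure)
  then have "AE v in P. v \<in> G"
    using G(2) by (simp add: AE_in_set_eq_1)
  then show ?thesis
    by eventually_elim (simp add: G_def)
qed

lemma modified_cost_le_SUP_cost:
  assumes pc: "path_continuity T \<rho> g L U \<P>"
    and ext: "prob_space P'" "space P' = Path T t" "sets (path_filt T t T) \<subseteq> sets P'"
      "\<And>A. A \<in> sets (path_filt T t T) \<Longrightarrow> emeasure P' A = emeasure P A"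
      "\<Omega>' \<in> sets P'" "emeasure P' \<Omega>' = 1"
      "\<And>v. v \<in> \<Omega>' \<Longrightarrow> shift_prob T t s K v \<in> \<P> s (conc t w v)"
    and \<tau>: "\<tau> \<in> stop_times T t \<infinity>"
  shows "(\<integral>v. indicator {v. min (\<tau> v) (\<gamma> v) < s} v * payoff T g L U t w \<tau> \<gamma> v +
      indicator {v. min (\<tau> v) (\<gamma> v) \<ge> s} v * Z v \<partial>P)
    \<le> (SUP \<tau>\<in>stop_times T t \<infinity>. cost t w P \<tau> \<gamma>)"
proof -
  obtain \<S> :: "((real \<Rightarrow> real ^ 'd) \<Rightarrow> real) set" where \<S>: "countable \<S>" "\<S> \<subseteq> stop_times T s \<infinity>"
    and dense: "\<forall>w\<in>Path T 0. \<forall>Q\<in>integrable_probs T g L U s. \<forall>\<gamma>\<in>stop_times T s \<infinity>. \<forall>\<sigma>\<in>stop_times T s \<infinity>. \<forall>e>0.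
      \<exists>\<sigma>'\<in>\<S>. cost s w Q \<sigma> \<gamma> - e < cost s w Q \<sigma>' \<gamma>"
    using countable_dense_stop_times[OF s_in] by blast
  \<comment> \<open>The constant time \<open>s\<close> is added to have a nonempty family to
    enumerate.\<close>
  define \<sigma> where "\<sigma> = from_nat_into (insert (\<lambda>_. s) \<S>)"
  have range: "range \<sigma> = insert (\<lambda>_. s) \<S>"
    unfolding \<sigma>_def using \<S>(1) by (intro range_from_nat_into) auto
  have \<sigma>: "\<sigma> n \<in> stop_times T s \<infinity>" for n
  proof -
    have "\<sigma> n \<in> insert (\<lambda>_. s) \<S>" using range by blast
    then show ?thesis using \<S>(2) stop_times_const[of s s T] times by auto
  qed
  have Zm: "Z \<in> borel_measurable (path_filt T t s)" by (rule borel_measurable_Z[OF pc])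
  have approx: "AE v in P. \<forall>k::nat. \<exists>m. Z v - 1 / Suc k < J (\<lambda>u. \<sigma> m (shift_path T s u)) v"
  proof (rule AE_Z_approx[OF Zm \<sigma> _ ext(1-6)])
    fix v and e :: real assume v: "v \<in> \<Omega>'" and e: "0 < e"
    have "v \<in> Path T t" using sets.sets_into_space[OF ext(5)] v ext(2) by auto
    then obtain \<sigma>' where \<sigma>': "\<sigma>' \<in> \<S>" "Z v - e < J (\<lambda>u. \<sigma>' (shift_path T s u)) v"
      using Z_approx[OF dense \<S>(2) _ ext(7)[OF v] e] by blast
    then have "\<sigma>' \<in> range \<sigma>" by (simp add: range)
    with \<sigma>'(2) show "\<exists>m. Z v - e < J (\<lambda>u. \<sigma> m (shift_path T s u)) v" by auto
  qed
  have "\<forall>n. \<exists>\<theta>. \<theta> \<in> stop_times T t \<infinity> \<and> (\<forall>v\<in>Path T t. s \<le> \<theta> v) \<and>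
    (\<forall>m\<le>n. \<forall>v\<in>Path T t. J (\<lambda>u. \<sigma> m (shift_path T s u)) v \<le> J \<theta> v)"
    using J_max_attained[of \<sigma>, OF \<sigma>] by blast
  from choice[OF this] obtain \<theta> where \<theta>': "\<forall>n. \<theta> n \<in> stop_times T t \<infinity> \<and> (\<forall>v\<in>Path T t. s \<le> \<theta> n v) \<and>
    (\<forall>m\<le>n. \<forall>v\<in>Path T t. J (\<lambda>u. \<sigma> m (shift_path T s u)) v \<le> J (\<theta> n) v)"
    by (rule exE)
  have \<theta>: "\<theta> n \<in> stop_times T t \<infinity>" "v \<in> Path T t \<Longrightarrow> s \<le> \<theta> n v"
    "m \<le> n \<Longrightarrow> v \<in> Path T t \<Longrightarrow> J (\<lambda>u. \<sigma> m (shift_path T s u)) v \<le> J (\<theta> n) v" for n m v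
    using \<theta>' by blast+
  let ?Y = "\<lambda>v. path_bound t (conc t w v)"
  have Y: "integrable P ?Y" by (rule integrable_path_bound[OF P_int w t_in])
  have Y0: "0 \<le> ?Y v" if "v \<in> Path T t" for v by (intro path_bound_nonneg conc_in_Path that t_in)
  define B where "B v = (\<integral>u. ?Y u \<partial>K v)" for v
  have B: "integrable P B" unfolding B_def[abs_def] by (rule integral_K(2)[OF Y])
  have J_B: "AE v in P. \<forall>\<tau>\<in>stop_times T t \<infinity>. \<bar>J \<tau> v\<bar> \<le> B v"
    using integral_K(1)[OF Y] AE_space
    by eventually_elim (auto simp: B_def space_P intro!: abs_J_le)
  \<comment> \<open>The upper bound on \<open>Z\<close> comes from its approximants: each
    \<open>J\<close> is at most the conditional expectation \<open>B\<close> of the majorant. The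
    lower bound is pathwise.\<close>
  have Z_B: "AE v in P. \<bar>Z v\<bar> \<le> ?Y v + \<bar>B v\<bar>"
    using approx J_B AE_space
  proof eventually_elim
    case (elim v)
    then have v: "v \<in> Path T t" by (simp add: space_P)
    have "Z v \<le> B v"
    proof (rule field_le_epsilon)
      fix e :: real assume "0 < e"
      then obtain k where k: "1 / Suc k < e" using nat_approx_posE by blast
      from elim(1) obtain m where "Z v - 1 / Suc k < J (\<lambda>u. \<sigma> m (shift_path T s u)) v" by blast
      moreover have "\<bar>J (\<lambda>u. \<sigma> m (shift_path T s u)) v\<bar> \<le> B v"
        using elim(2) stop_times_shift[OF \<sigma> times] by blast
      ultimately show "Z v \<le> B v + e" using k by linarith
    qed
    then show ?case using neg_path_bound_le_Z[OF v] Y0[OF v] by linarith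
  qed
  let ?C = "{v \<in> Path T t. s \<le> min (\<tau> v) (\<gamma> v)}"
  have "?C = space (path_filt T t s) - ({v \<in> Path T t. \<tau> v < s} \<union> {v \<in> Path T t. \<gamma> v < s})"
    by auto
  then have C: "?C \<in> sets (path_filt T t s)"
    using stop_times_sets_less[OF \<tau>, of s] stop_times_sets_less[OF \<gamma>, of s]
    by (simp only: sets.Diff sets.Un sets.top)
  have CP [measurable]: "?C \<in> sets P" by (rule sets_filt_P[OF C])
  have Z_P [measurable]: "Z \<in> borel_measurable P" by (rule borel_measurable_filt_P[OF Zm])
  have J_P [measurable]: "J (\<theta> n) \<in> borel_measurable P" for n
    by (intro borel_measurable_filt_P borel_measurable_J \<theta>)
  have YB: "integrable P (\<lambda>v. ?Y v + \<bar>B v\<bar>)" using Y B by auto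
  have CZ: "integrable P (\<lambda>v. indicator ?C v * Z v)"
  proof (rule Bochner_Integration.integrable_bound[OF YB])
    show "AE v in P. norm (indicator ?C v * Z v) \<le> norm (?Y v + \<bar>B v\<bar>)"
      using Z_B by eventually_elim (auto simp: indicator_def)
  qed measurable
  have CJ: "integrable P (\<lambda>v. indicator ?C v * J (\<theta> n) v)" for n
  proof (rule Bochner_Integration.integrable_bound[OF B])
    show "AE v in P. norm (indicator ?C v * J (\<theta> n) v) \<le> norm (B v)"
      using J_B by eventually_elim (use \<theta>(1)[of n] in \<open>auto simp: indicator_def\<close>)
  qed measurable
  \<comment> \<open>\<open>J (\<theta> n)\<close> may exceed \<open>Z\<close>, so it need not
    converge to \<open>Z\<close>; its minimum with \<open>Z\<close> does, and a lower estimate of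
    the payoffs is all that is required.\<close>
  let ?h = "\<lambda>n v. indicator ?C v * min (Z v) (J (\<theta> n) v)"
  have lim: "(\<lambda>n. \<integral>v. ?h n v \<partial>P) \<longlonglongrightarrow> (\<integral>v. indicator ?C v * Z v \<partial>P)"
  proof (rule integral_dominated_convergence[OF _ _ YB])
    show "AE v in P. (\<lambda>n. ?h n v) \<longlonglongrightarrow> indicator ?C v * Z v"
      using approx AE_space
    proof eventually_elim
      case (elim v)
      then have v: "v \<in> Path T t" by (simp add: space_P)
      have "(\<lambda>n. min (Z v) (J (\<theta> n) v)) \<longlonglongrightarrow> Z v"
      proof (rule LIMSEQ_I)
        fix e :: real assume "0 < e"
        then obtain k where k: "1 / Suc k < e" using nat_approx_posE by blast
        from elim(1) obtain m where m: "Z v - 1 / Suc k < J (\<lambda>u. \<sigma> m (shift_path T s u)) v" by blast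
        have "norm (min (Z v) (J (\<theta> n) v) - Z v) < e" if "m \<le> n" for n
          using \<theta>(3)[OF that v] m k \<open>0 < e\<close> by (auto simp: min_def abs_if)
        then show "\<exists>n0. \<forall>n\<ge>n0. norm (min (Z v) (J (\<theta> n) v) - Z v) < e" by blast
      qed
      then show ?case by (intro tendsto_mult_left)
    qed
    show "AE v in P. norm (?h n v) \<le> ?Y v + \<bar>B v\<bar>" for n
      using Z_B J_B AE_space
    proof eventually_elim
      case (elim v)
      have "\<bar>J (\<theta> n) v\<bar> \<le> B v" using elim(2) \<theta>(1) by blast
      moreover have "0 \<le> ?Y v" using elim(3) Y0 by (simp add: space_P)
      ultimately show ?case using elim(1) by (auto simp: indicator_def min_def)
    qed
  qed measurable
  let ?f = "\<lambda>v. indicator (- ?C) v * payoff T g L U t w \<tau> \<gamma> v"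
  have f: "integrable P ?f"
  proof -
    have "integrable P (\<lambda>v. payoff T g L U t w \<tau> \<gamma> v - indicator ?C v * payoff T g L U t w \<tau> \<gamma> v)"
      using integrable_payoff[OF P_int w t_in \<tau> \<gamma>]
        integrable_mult_indicator[OF CP integrable_payoff[OF P_int w t_in \<tau> \<gamma>]] by simp
    then show ?thesis
      by (rule Bochner_Integration.integrable_cong[THEN iffD1, rotated -1]) (auto simp: indicator_def)
  qed
  have upper: "(\<integral>v. ?f v \<partial>P) + (\<integral>v. ?h n v \<partial>P) \<le> (SUP \<tau>\<in>stop_times T t \<infinity>. cost t w P \<tau> \<gamma>)" for n
  proof -
    \<comment> \<open>Switching happens wherever \<open>\<tau>\<close> has not stopped before
      \<open>s\<close>, regardless of \<open>\<gamma>\<close>; by \<open>payoff_switch\<close> this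
      matters only on \<open>?C\<close>.\<close>
    let ?\<tau> = "\<lambda>v. if v \<in> {v \<in> Path T t. \<tau> v < s} then \<tau> v else \<theta> n v"
    have stop: "?\<tau> \<in> stop_times T t \<infinity>"
      by (rule stop_times_if[OF \<tau> \<theta>(1) stop_times_sets_less[OF \<tau>] times]) (auto simp: \<theta>(2))
    have \<theta>i: "integrable P (payoff T g L U t w (\<theta> n) \<gamma>\<^sub>s)"
      by (rule integrable_payoff[OF P_int w t_in \<theta>(1) \<gamma>\<^sub>s_stop])
    have C\<theta>i: "integrable P (\<lambda>v. indicator ?C v * payoff T g L U t w (\<theta> n) \<gamma>\<^sub>s v)"
      using integrable_mult_indicator[OF CP \<theta>i] by simp
    have "(\<integral>v. ?h n v \<partial>P) \<le> (\<integral>v. indicator ?C v * J (\<theta> n) v \<partial>P)"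
    proof (rule integral_mono[OF _ CJ])
      show "integrable P (?h n)"
      proof (rule Bochner_Integration.integrable_bound[OF Bochner_Integration.integrable_add[OF integrable_abs[OF CZ] integrable_abs[OF CJ[of n]]]])
        show "AE v in P. norm (?h n v) \<le> norm (\<bar>indicator ?C v * Z v\<bar> + \<bar>indicator ?C v * J (\<theta> n) v\<bar>)"
          by (intro AE_I2) (auto simp: indicator_def min_def)
      qed measurable
    qed (auto simp: indicator_def)
    \<comment> \<open>Since \<open>?C\<close> belongs to time \<open>s\<close>, the conditional
      payoff can be exchanged for the payoff itself.\<close>
    also have "\<dots> = (\<integral>v. indicator ?C v * payoff T g L U t w (\<theta> n) \<gamma>\<^sub>s v \<partial>P)"
      unfolding J_def by (rule integral_indicator_K[OF \<theta>i C, symmetric])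
    finally have "(\<integral>v. ?f v \<partial>P) + (\<integral>v. ?h n v \<partial>P) \<le>
        (\<integral>v. ?f v + indicator ?C v * payoff T g L U t w (\<theta> n) \<gamma>\<^sub>s v \<partial>P)"
      unfolding Bochner_Integration.integral_add[OF f C\<theta>i] by (rule add_left_mono)
    also have "\<dots> = cost t w P ?\<tau> \<gamma>"
    proof (rule Bochner_Integration.integral_cong[OF refl])
      fix v assume "v \<in> space P"
      then have v: "v \<in> Path T t" by (simp add: space_P)
      show "?f v + indicator ?C v * payoff T g L U t w (\<theta> n) \<gamma>\<^sub>s v = payoff T g L U t w ?\<tau> \<gamma> v"
        by (subst payoff_switch[OF \<tau> \<theta>(1) _ v]) (use v \<theta>(2) in \<open>auto simp: indicator_def\<close>)
    qed
    also have "\<dots> \<le> (SUP \<tau>\<in>stop_times T t \<infinity>. cost t w P \<tau> \<gamma>)"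
      by (rule cSUP_upper[OF stop bdd_above_cost[OF P_int w t_in \<gamma>]])
    finally show ?thesis .
  qed
  have "(\<integral>v. indicator {v. min (\<tau> v) (\<gamma> v) < s} v * payoff T g L U t w \<tau> \<gamma> v +
      indicator {v. min (\<tau> v) (\<gamma> v) \<ge> s} v * Z v \<partial>P) = (\<integral>v. ?f v + indicator ?C v * Z v \<partial>P)"
    by (rule Bochner_Integration.integral_cong) (auto simp: indicator_def space_P)
  also have "\<dots> = (\<integral>v. ?f v \<partial>P) + (\<integral>v. indicator ?C v * Z v \<partial>P)"
    by (rule Bochner_Integration.integral_add[OF f CZ])
  also have "\<dots> \<le> (SUP \<tau>\<in>stop_times T t \<infinity>. cost t w P \<tau> \<gamma>)"
    by (rule LIMSEQ_le_const2[OF tendsto_add[OF tendsto_const lim]]) (use upper in blast)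
  finally show ?thesis .
qed

end

theorem proposition3p2:
  fixes T :: real and \<rho>0 :: "real \<Rightarrow> real"
    and g L U :: "real \<Rightarrow> (real \<Rightarrow> real ^ 'd) \<Rightarrow> real"
    and \<P> :: "real \<Rightarrow> (real \<Rightarrow> real ^ 'd) \<Rightarrow> (real \<Rightarrow> real ^ 'd) measure set"
    and t s :: real and w :: "real \<Rightarrow> real ^ 'd"
  assumes "0 < T"
    and "payoff_regularity T \<rho>0 g L U"
    and "integrability T g L U"
    and "adaptedness T g L U \<P>"
    and "stability_conditioning T \<P>"
    and "weak_pasting T g L U \<P>"
    and "path_continuity T \<rho>0 g L U \<P>"
    and "0 \<le> t" and "t \<le> s" and "s \<le> T" and "w \<in> Path T 0"
  shows "val T g L U \<P> \<infinity> t w \<ge>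
    (INF P\<in>\<P> t w. INF \<gamma>\<in>stop_times T t \<infinity>. SUP \<tau>\<in>stop_times T t \<infinity>.
       \<integral>w'. indicator {v. min (\<tau> v) (\<gamma> v) < s} w' * payoff T g L U t w \<tau> \<gamma> w' +
            indicator {v. min (\<tau> v) (\<gamma> v) \<ge> s} w' *
              (val T g L U \<P> \<infinity> s (concat_path T 0 t w w') +
               (LBINT r:{t..s}. g r (concat_path T 0 t w w'))) \<partial>P)"

\<comment> \<open>Passage to the infimum over laws and opposing strategies\<close>
proof -
  interpret control_problem T \<rho>0 g L U \<P>
    by unfold_locales (use assms in auto)
  have t: "t \<in> {0..T}" using assms by auto
  have tT: "t \<le> T" using t by simp
  note w = assms(11)
  let ?M = "\<lambda>P \<gamma> \<tau>. \<integral>w'. indicator {v. min (\<tau> v) (\<gamma> v) < s} w' * payoff T g L U t w \<tau> \<gamma> w' +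
    indicator {v. min (\<tau> v) (\<gamma> v) \<ge> s} w' * (V s (conc t w w') + (LBINT r:{t..s}. g r (conc t w w'))) \<partial>P"
  show ?thesis
  proof (cases "t = s")
    case True
    \<comment> \<open>With \<open>t = s\<close> nobody stops before \<open>s\<close> and the running
      reward vanishes, so the modified payoff is the constant \<open>V t w\<close>.\<close>
    have "(SUP \<tau>\<in>stop_times T t \<infinity>. ?M P \<gamma> \<tau>) = V t w"
      if P: "P \<in> \<P> t w" and \<gamma>: "\<gamma> \<in> stop_times T t \<infinity>" for P \<gamma>
    proof -
      note Pi = \<P>_integrable[OF t w P]
      interpret prob_space P by (rule integrable_probsD(1)[OF Pi])
      have "?M P \<gamma> \<tau> = (\<integral>v. V t w \<partial>P)" if \<tau>: "\<tau> \<in> stop_times T t \<infinity>" for \<tau>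
      proof (rule Bochner_Integration.integral_cong[OF refl])
        fix v assume "v \<in> space P"
        then have v: "v \<in> Path T t" using integrable_probsD(3)[OF Pi] by simp
        have "V t (conc t w v) = V t w"
          using t v by (intro V_agree concat_path_in_Path w concat_path_before) auto
        moreover have "(LBINT r:{t..t}. g r (conc t w v)) = 0"
          by (subst LBINT_continuous) auto
        ultimately show "indicator {v. min (\<tau> v) (\<gamma> v) < s} v * payoff T g L U t w \<tau> \<gamma> v +
          indicator {v. min (\<tau> v) (\<gamma> v) \<ge> s} v * (V s (conc t w v) + (LBINT r:{t..s}. g r (conc t w v))) = V t w"
          using stop_timesD(3)[OF \<tau> v] stop_timesD(3)[OF \<gamma> v] True by (auto simp: indicator_def)
      qed
      then have "(SUP \<tau>\<in>stop_times T t \<infinity>. ?M P \<gamma> \<tau>) = (SUP \<tau>\<in>(stop_times T t \<infinity> :: ((real \<Rightarrow> real ^ 'd) \<Rightarrow> real) set). V t w)"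
        by (intro SUP_cong) (auto simp: prob_space)
      then show ?thesis by (simp add: stop_times_nonempty tT)
    qed
    then have "(INF P\<in>\<P> t w. INF \<gamma>\<in>stop_times T t \<infinity>. SUP \<tau>\<in>stop_times T t \<infinity>. ?M P \<gamma> \<tau>)
        = (INF P\<in>\<P> t w. INF \<gamma>\<in>(stop_times T t \<infinity> :: ((real \<Rightarrow> real ^ 'd) \<Rightarrow> real) set). V t w)"
      by (intro INF_cong refl) auto
    then show ?thesis by (simp add: INF_INF_const[OF t w])
  next
    case False
    then have ts: "t < s" using assms by simp
    have bound: "?M P \<gamma> \<tau> \<le> (SUP \<tau>\<in>stop_times T t \<infinity>. cost t w P \<tau> \<gamma>)"
      if P: "P \<in> \<P> t w" and \<gamma>: "\<gamma> \<in> stop_times T t \<infinity>" and \<tau>: "\<tau> \<in> stop_times T t \<infinity>" for P \<gamma> \<tau>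
    proof -
      obtain K P' \<Omega>' where K: "is_rcpd T t s P K" and ext: "prob_space P'" "space P' = Path T t"
        "sets (path_filt T t T) \<subseteq> sets P'"
        "\<forall>A\<in>sets (path_filt T t T). emeasure P' A = emeasure P A"
        "\<Omega>' \<in> sets P'" "emeasure P' \<Omega>' = 1"
        "\<forall>v\<in>\<Omega>'. shift_prob T t s K v \<in> \<P> s (conc t w v)"
        using assms(5) P ts assms(8,10) w unfolding stability_conditioning_def by metis
      have PP: "P \<in> path_probs T t"
        using \<P>_integrable[OF t w P] by (simp add: integrable_probs_def)
      interpret C: conditioned_control T \<rho>0 g L U \<P> t s P K w \<gamma>
        by unfold_locales (use assms PP K P \<gamma> in auto)
      show ?thesis
        by (rule C.modified_cost_le_SUP_cost[unfolded C.Z_def, OF assms(7) ext(1-3) _ ext(5,6) _ \<tau>])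
          (use ext(4,7) in blast)+
    qed
    \<comment> \<open>Since \<open>t < s\<close>, the time constantly equal to \<open>t\<close>
      falls under the first indicator and earns \<open>L t w\<close>. This is the uniform lower
      bound demanded by \<open>INF_INF_mono\<close>; the upper bound on the suprema is supplied by
      \<open>bound\<close>.\<close>
    have low: "L t w \<le> (SUP \<tau>\<in>stop_times T t \<infinity>. ?M P \<gamma> \<tau>)"
      if P: "P \<in> \<P> t w" and \<gamma>: "\<gamma> \<in> stop_times T t \<infinity>" for P \<gamma>
    proof (rule cSUP_upper2)
      note Pi = \<P>_integrable[OF t w P]
      interpret prob_space P by (rule integrable_probsD(1)[OF Pi])
      show "bdd_above (?M P \<gamma> ` stop_times T t \<infinity>)"
        using bound[OF P \<gamma>] by (rule bdd_aboveI2)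
      show "(\<lambda>_. t) \<in> stop_times T t \<infinity>" using tT by (intro stop_times_const) simp
      have "?M P \<gamma> (\<lambda>_. t) = (\<integral>v. L t w \<partial>P)"
      proof (rule Bochner_Integration.integral_cong[OF refl])
        fix v assume "v \<in> space P"
        then have v: "v \<in> Path T t" using integrable_probsD(3)[OF Pi] by simp
        have "min t (\<gamma> v) < s" using ts by simp
        moreover have "\<not> s \<le> t" using ts by simp
        ultimately show "indicator {v. min t (\<gamma> v) < s} v * payoff T g L U t w (\<lambda>_. t) \<gamma> v +
          indicator {v. min t (\<gamma> v) \<ge> s} v * (V s (conc t w v) + (LBINT r:{t..s}. g r (conc t w v))) = L t w"
          using payoff_stop_at_start[OF w v t \<gamma>] by (simp add: indicator_def)
      qed
      then show "L t w \<le> ?M P \<gamma> (\<lambda>_. t)" by (simp add: prob_space)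
    qed
    show ?thesis
      unfolding val_def[of T g L U \<P> \<infinity> t w]
    proof (rule INF_INF_mono[OF t w low])
      fix P and \<gamma> :: "(real \<Rightarrow> real ^ 'd) \<Rightarrow> real"
      assume *: "P \<in> \<P> t w" "\<gamma> \<in> stop_times T t \<infinity>"
      show "(SUP \<tau>\<in>stop_times T t \<infinity>. ?M P \<gamma> \<tau>) \<le> (SUP \<tau>\<in>stop_times T t \<infinity>. cost t w P \<tau> \<gamma>)"
        by (intro cSUP_least stop_times_nonempty tT bound *)
    qed
  qed
qed

end
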